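(* Let $f:\mathbb{R}^n\to\mathbb{R}$ be twice continuously differentiable, convex, radially unbounded, with a unique minimizer $x^*\in\mathbb{R}^n$, and suppose in addition that $f$ is $\mu$-strongly convex ($\mu>0$) with globally Lipschitz gradient with constant $L$. Let $0<T_{\min}<T_{\max}<\infty$ and $c>0$ satisfy $$T_{\max}^2-T_{\min}^2>\frac{1}{\mu c}.$$ Consider the hybrid system HAND-2 defined in the context, and the compact set $$\mathcal{A}:=\{x^*\}\times\{x^*\}\times[T_{\min},T_{\max}]\subset\mathbb{R}^{2n+1}.$$ Then the following hold. (a) Every maximal solution of HAND-2 is complete, and the set $\mathcal{A}$ is uniformly globally asymptotically stable (UGAS) for HAND-2. (b) For each $\delta>0$ and each compact set $K_0\subset\mathbb{R}^{2n}$ there exist $\varepsilon^*>0$ and $T>0$ such that, for all measurable admissible perturbations $e_1,\dots,e_6:\mathbb{R}_{\geq0}\to\mathbb{R}^{2n+1}$ satisfying $\sup_{t\geq0}|e_i(t)|\leq\varepsilon^*$ for all $i$, and every initial condition with $x(0,0)=(x_1(0,0),x_2(0,0))\in K_0$, the solutions $z$ of the perturbed HAND-2 dynamics (see context) satisfy $|z(t,j)|_{\mathcal{A}}\leq\delta$ for all $(t,j)\in\text{dom}(z)$ such that $t+j\geq T$. (c) Let $\Delta T:=T_{\max}-T_{\min}$, $f^*:=f(x^* )$, $$k_0:=\frac{(c\mu)^{-1}+T_{\min}^2}{T_{\max}^2},\qquad \tilde k_b:=1-k_0,\qquad \tilde\alpha(t+j):=\frac{\max\{t+j-\Delta T,0\}}{\Delta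 T+1}.$$ There is a constant $k_a>0$ such that every solution $z=(x_1,x_2,\tau)$ of HAND-2 with $x_1(0,0)=x_2(0,0)$ and $\tau(0,0)=T_{\min}$ satisfies $$f(x_1(t,j))-f^*\leq k_a\exp\left(-\tilde k_b\,\tilde\alpha(t+j)\right)|x_1(0,0)-x^*|^2$$ for all $(t,j)\in\text{dom}(z)$.
   Context: Notation: $|\cdot|$ is the Euclidean norm; for a compact set $\mathcal{A}$, $|z|_{\mathcal{A}}:=\min_{y\in\mathcal{A}}|z-y|$. A function $f$ is radially unbounded if $f(x)\to\infty$ as $|x|\to\infty$. A function is of class $\mathcal{K}_\infty$ if it is continuous, zero at zero, strictly increasing and tends to $\infty$ at $\infty$. Hybrid systems: a hybrid dynamical system with state $z$ is given by $\dot z=F(z)$ for $z\in C$ (flows) and $z^+=G(z)$ for $z\in D$ (jumps). Solutions are understood in the standard sense of Goebel, Sanfelice and Teel: $z$ is defined on a hybrid time domain $\text{dom}(z)\subset\mathbb{R}_{\geq0}\times\mathbb{Z}_{\geq0}$, i.e. a set that, for each $(T,J)$ in it, intersected with $[0,T]\times\{0,\dots,J\}$ is a finite union of intervals $[t_j,t_{j+1}]\times\{j\}$ with $0=t_0\leq t_1\leq\dots$; $z(0,0)\in\overline{C}\cup D$; for each $j$, $t\mapsto z(t,j)$ is locally absolutely continuous, with $z(t,j)\in C$ on the interior of the interval $\{t:(t,j)\in\text{dom}(z)\}$ and $\dot z(t,j)=F(z(t,j))$ for almost every $t$ in it; and whenever $(t,j),(t,j+1)\in\text{dom}(z)$, $z(t,j)\in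 D$ and $z(t,j+1)=G(z(t,j))$. A solution is maximal if it cannot be extended to a larger hybrid time domain, and complete if its domain is unbounded. UGAS: a compact set $\mathcal{A}$ is UGAS if (i) there is $\alpha\in\mathcal{K}_\infty$ such that every solution satisfies $|z(t,j)|_{\mathcal{A}}\leq\alpha(|z(0,0)|_{\mathcal{A}})$ for all $(t,j)\in\text{dom}(z)$; and (ii) for each $\varepsilon>0$ and $r>0$ there is $T>0$ such that, for every solution $z$ with $|z(0,0)|_{\mathcal{A}}\leq r$, $(t,j)\in\text{dom}(z)$ and $t+j\geq T$ imply $|z(t,j)|_{\mathcal{A}}\leq\varepsilon$. HAND-2: the state is $z=(x_1,x_2,\tau)\in\mathbb{R}^n\times\mathbb{R}^n\times\mathbb{R}$, with $x=(x_1,x_2)$. The flow map is $$F(z)=\left(\tfrac{2}{\tau}(x_2-x_1),\ -2c\tau\nabla f(x_1),\ 1\right),$$ the jump map is $G(z)=(x_1,x_1,T_{\min})$, and the flow and jump sets are $$C=\{z\in\mathbb{R}^{2n+1}:\tau\in[T_{\min},T_{\max}]\},\qquad D=\{z\in\mathbb{R}^{2n+1}:\tau=T_{\max}\}.$$ Perturbed HAND-2 dynamics: given measurable admissible signals $e_i:\mathbb{R}_{\geq0}\to\mathbb{R}^{2n+1}$, $i=1,\dots,6$ (evaluated at the continuous time $t$ along solutions), $$\dot z=F(z+e_1)+e_2,\quad z+e_3\in C;\qquad z^+=G(z+e_4)+e_5,\quad z+e_6\in D.$$ *)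

theory Defs
  imports "HOL-Analysis.Analysis"
begin

section \<open>Functions\<close>

text \<open>The gradient is only meaningful at points where \<open>f\<close> is differentiable.\<close>

definition grad :: "('a::euclidean_space \<Rightarrow> real) \<Rightarrow> 'a \<Rightarrow> 'a" where
  "grad f x = (THE g. GDERIV f x :> g)"

definition twice_continuously_differentiable :: "('a::euclidean_space \<Rightarrow> real) \<Rightarrow> bool" where
  "twice_continuously_differentiable f \<longleftrightarrow>
     (\<forall>x. f differentiable (at x)) \<and>
     (\<exists>H :: 'a \<Rightarrow> 'a \<Rightarrow>\<^sub>L 'a. (\<forall>x. (grad f has_derivative blinfun_apply (H x)) (at x)) \<and>
        continuous_on UNIV H)"

definition radially_unbounded :: "('a::real_normed_vector \<Rightarrow> real) \<Rightarrow> bool" where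
  "radially_unbounded f \<longleftrightarrow> filterlim f at_top at_infinity"

definition unique_minimizer :: "('a \<Rightarrow> real) \<Rightarrow> 'a \<Rightarrow> bool" where
  "unique_minimizer f xs \<longleftrightarrow>
     (\<forall>y. f xs \<le> f y) \<and> (\<forall>x. (\<forall>y. f x \<le> f y) \<longrightarrow> x = xs)"

definition strongly_convex :: "real \<Rightarrow> ('a::real_normed_vector \<Rightarrow> real) \<Rightarrow> bool" where
  "strongly_convex \<mu> f \<longleftrightarrow>
     (\<forall>x y. \<forall>s\<in>{0..1}. f ((1 - s) *\<^sub>R x + s *\<^sub>R y)
        \<le> (1 - s) * f x + s * f y - \<mu> / 2 * s * (1 - s) * (norm (x - y))\<^sup>2)"

definition class_K_infinity :: "(real \<Rightarrow> real) \<Rightarrow> bool" where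
  "class_K_infinity \<alpha> \<longleftrightarrow> continuous_on {0..} \<alpha> \<and> \<alpha> 0 = 0 \<and> strict_mono_on {0..} \<alpha> \<and>
     filterlim \<alpha> at_top at_top"

definition absolutely_continuous_Icc ::
    "real \<Rightarrow> real \<Rightarrow> (real \<Rightarrow> 'a::real_normed_vector) \<Rightarrow> bool" where
  "absolutely_continuous_Icc a b g \<longleftrightarrow>
     (\<forall>\<epsilon>>0. \<exists>\<delta>>0. \<forall>(N::nat) (u::nat \<Rightarrow> real) (v::nat \<Rightarrow> real).
        (\<forall>k<N. a \<le> u k \<and> u k \<le> v k \<and> v k \<le> b) \<and>
        disjoint_family_on (\<lambda>k. {u k<..<v k}) {..<N} \<and>
        (\<Sum>k<N. v k - u k) < \<delta>
        \<longrightarrow> (\<Sum>k<N. norm (g (v k) - g (u k))) < \<epsilon>)"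

definition locally_absolutely_continuous_on ::
    "real set \<Rightarrow> (real \<Rightarrow> 'a::real_normed_vector) \<Rightarrow> bool" where
  "locally_absolutely_continuous_on I g \<longleftrightarrow>
     (\<forall>a b. {a..b} \<subseteq> I \<longrightarrow> absolutely_continuous_Icc a b g)"


section \<open>Hybrid systems\<close>

text \<open>A hybrid arc is a pair of a domain \<open>E\<close> and a function \<open>z\<close>, of which only the values
  \<open>z t j\<close> with \<open>(t, j) \<in> E\<close> matter.\<close>

definition hybrid_time_domain :: "(real \<times> nat) set \<Rightarrow> bool" where
  "hybrid_time_domain E \<longleftrightarrow> E \<subseteq> {0..} \<times> UNIV \<and>
     (\<forall>(T, J)\<in>E. \<exists>(N::nat) (ts::nat \<Rightarrow> real).
        ts 0 = 0 \<and> (\<forall>j<N. ts j \<le> ts (Suc j)) \<and>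
        E \<inter> ({0..T} \<times> {..J}) = (\<Union>j<N. {ts j..ts (Suc j)} \<times> {j}))"

definition time_slice :: "(real \<times> nat) set \<Rightarrow> nat \<Rightarrow> real set" where
  "time_slice E j = {t. (t, j) \<in> E}"

text \<open>The data may depend on the continuous time, which accommodates the perturbed dynamics.\<close>

definition tv_hybrid_solution ::
    "(real \<Rightarrow> 's::real_normed_vector \<Rightarrow> 's) \<Rightarrow> (real \<Rightarrow> 's set) \<Rightarrow> (real \<Rightarrow> 's \<Rightarrow> 's) \<Rightarrow> (real \<Rightarrow> 's set)
      \<Rightarrow> (real \<times> nat) set \<Rightarrow> (real \<Rightarrow> nat \<Rightarrow> 's) \<Rightarrow> bool" where
  "tv_hybrid_solution F C G D E z \<longleftrightarrow>
     hybrid_time_domain E \<and> (0, 0) \<in> E \<and>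
     z 0 0 \<in> closure (C 0) \<union> D 0 \<and>
     (\<forall>j. locally_absolutely_continuous_on (time_slice E j) (\<lambda>t. z t j) \<and>
          (\<forall>t \<in> interior (time_slice E j). z t j \<in> C t) \<and>
          (AE t in lebesgue. t \<in> time_slice E j \<longrightarrow>
             ((\<lambda>s. z s j) has_vector_derivative F t (z t j)) (at t within time_slice E j))) \<and>
     (\<forall>t j. (t, j) \<in> E \<and> (t, Suc j) \<in> E \<longrightarrow> z t j \<in> D t \<and> z t (Suc j) = G t (z t j))"

definition hybrid_solution ::
    "('s::real_normed_vector \<Rightarrow> 's) \<Rightarrow> 's set \<Rightarrow> ('s \<Rightarrow> 's) \<Rightarrow> 's set
      \<Rightarrow> (real \<times> nat) set \<Rightarrow> (real \<Rightarrow> nat \<Rightarrow> 's) \<Rightarrow> bool" where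
  "hybrid_solution F C G D = tv_hybrid_solution (\<lambda>_. F) (\<lambda>_. C) (\<lambda>_. G) (\<lambda>_. D)"

definition perturbed_hybrid_solution ::
    "('s::real_normed_vector \<Rightarrow> 's) \<Rightarrow> 's set \<Rightarrow> ('s \<Rightarrow> 's) \<Rightarrow> 's set \<Rightarrow> (nat \<Rightarrow> real \<Rightarrow> 's)
      \<Rightarrow> (real \<times> nat) set \<Rightarrow> (real \<Rightarrow> nat \<Rightarrow> 's) \<Rightarrow> bool" where
  "perturbed_hybrid_solution F C G D e =
     tv_hybrid_solution
       (\<lambda>t z. F (z + e 1 t) + e 2 t) (\<lambda>t. {z. z + e 3 t \<in> C})
       (\<lambda>t z. G (z + e 4 t) + e 5 t) (\<lambda>t. {z. z + e 6 t \<in> D})"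

definition maximal_hybrid_solution ::
    "('s::real_normed_vector \<Rightarrow> 's) \<Rightarrow> 's set \<Rightarrow> ('s \<Rightarrow> 's) \<Rightarrow> 's set
      \<Rightarrow> (real \<times> nat) set \<Rightarrow> (real \<Rightarrow> nat \<Rightarrow> 's) \<Rightarrow> bool" where
  "maximal_hybrid_solution F C G D E z \<longleftrightarrow>
     hybrid_solution F C G D E z \<and>
     \<not> (\<exists>E' z'. hybrid_solution F C G D E' z' \<and> E \<subset> E' \<and> (\<forall>(t, j)\<in>E. z' t j = z t j))"

definition complete_hybrid_domain :: "(real \<times> nat) set \<Rightarrow> bool" where
  "complete_hybrid_domain E \<longleftrightarrow> \<not> bounded ((\<lambda>(t, j). (t, real j)) ` E)"

definition UGAS ::
    "('s::real_normed_vector \<Rightarrow> 's) \<Rightarrow> 's set \<Rightarrow> ('s \<Rightarrow> 's) \<Rightarrow> 's set \<Rightarrow> 's set \<Rightarrow> bool" where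
  "UGAS F C G D A \<longleftrightarrow>
     compact A \<and> A \<noteq> {} \<and>
     (\<exists>\<alpha>. class_K_infinity \<alpha> \<and>
        (\<forall>E z. hybrid_solution F C G D E z \<longrightarrow>
           (\<forall>(t, j)\<in>E. infdist (z t j) A \<le> \<alpha> (infdist (z 0 0) A)))) \<and>
     (\<forall>\<epsilon>>0. \<forall>r>0. \<exists>T>0. \<forall>E z.
        hybrid_solution F C G D E z \<and> infdist (z 0 0) A \<le> r \<longrightarrow>
        (\<forall>(t, j)\<in>E. t + real j \<ge> T \<longrightarrow> infdist (z t j) A \<le> \<epsilon>))"


section \<open>HAND-2\<close>

text \<open>The norm of a product type is the Euclidean one, so this type is $R^{2n+1}$.\<close>

type_synonym 'n hand_state = "(real ^ 'n) \<times> (real ^ 'n) \<times> real"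

definition hand2_F ::
    "real \<Rightarrow> (real ^ 'n::finite \<Rightarrow> real) \<Rightarrow> 'n hand_state \<Rightarrow> 'n hand_state" where
  "hand2_F c f = (\<lambda>(x1, x2, \<tau>). ((2 / \<tau>) *\<^sub>R (x2 - x1), (- 2 * c * \<tau>) *\<^sub>R grad f x1, 1))"

definition hand2_G :: "real \<Rightarrow> 'n::finite hand_state \<Rightarrow> 'n hand_state" where
  "hand2_G Tmin = (\<lambda>(x1, x2, \<tau>). (x1, x1, Tmin))"

definition hand2_C :: "real \<Rightarrow> real \<Rightarrow> 'n::finite hand_state set" where
  "hand2_C Tmin Tmax = {(x1, x2, \<tau>). \<tau> \<in> {Tmin..Tmax}}"

definition hand2_D :: "real \<Rightarrow> 'n::finite hand_state set" where
  "hand2_D Tmax = {(x1, x2, \<tau>). \<tau> = Tmax}"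

definition hand2_A :: "real ^ 'n::finite \<Rightarrow> real \<Rightarrow> real \<Rightarrow> 'n hand_state set" where
  "hand2_A xs Tmin Tmax = {xs} \<times> {xs} \<times> {Tmin..Tmax}"

definition hand2_solution ::
    "real \<Rightarrow> (real ^ 'n::finite \<Rightarrow> real) \<Rightarrow> real \<Rightarrow> real
      \<Rightarrow> (real \<times> nat) set \<Rightarrow> (real \<Rightarrow> nat \<Rightarrow> 'n hand_state) \<Rightarrow> bool" where
  "hand2_solution c f Tmin Tmax =
     hybrid_solution (hand2_F c f) (hand2_C Tmin Tmax) (hand2_G Tmin) (hand2_D Tmax)"

definition hand2_maximal_solution ::
    "real \<Rightarrow> (real ^ 'n::finite \<Rightarrow> real) \<Rightarrow> real \<Rightarrow> real
      \<Rightarrow> (real \<times> nat) set \<Rightarrow> (real \<Rightarrow> nat \<Rightarrow> 'n hand_state) \<Rightarrow> bool" where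
  "hand2_maximal_solution c f Tmin Tmax =
     maximal_hybrid_solution (hand2_F c f) (hand2_C Tmin Tmax) (hand2_G Tmin) (hand2_D Tmax)"

definition hand2_perturbed_solution ::
    "real \<Rightarrow> (real ^ 'n::finite \<Rightarrow> real) \<Rightarrow> real \<Rightarrow> real \<Rightarrow> (nat \<Rightarrow> real \<Rightarrow> 'n hand_state)
      \<Rightarrow> (real \<times> nat) set \<Rightarrow> (real \<Rightarrow> nat \<Rightarrow> 'n hand_state) \<Rightarrow> bool" where
  "hand2_perturbed_solution c f Tmin Tmax =
     perturbed_hybrid_solution (hand2_F c f) (hand2_C Tmin Tmax) (hand2_G Tmin) (hand2_D Tmax)"

end

theory Submission
  imports Defs
begin

text \<open>
  Write \<open>x* = xs\<close>. Everything rests on the Lyapunov function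
  \<open>W (x1, x2, \<tau>) = |x2 - x*|^2 / 2 + c \<tau>^2 (f x1 - f x*)\<close>, which is comparable with the squared
  distance of \<open>(x1, x2)\<close> to \<open>(x*, x*)\<close> because \<open>f - f x*\<close> lies between two quadratics.
  Along a flow its derivative is \<open>2 c \<tau>\<close> times \<open>(f x1 - f x*) - <grad f x1, x1 - x*>\<close>, which is
  nonpositive by convexity. A jump happens at \<open>\<tau> = Tmax\<close>, resets \<open>x2\<close> to \<open>x1\<close> and \<open>\<tau>\<close> to \<open>Tmin\<close>;
  since \<open>|x1 - x*|^2 / 2 \<le> (f x1 - f x*) / \<mu>\<close>, it multiplies \<open>W\<close> by at most \<open>k0\<close>
  (\<open>jump_nominal\<close>), and \<open>k0 < 1\<close> is exactly the assumed gap between \<open>Tmin\<close> and \<open>Tmax\<close>. The timer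
  forces a jump at least once every \<open>Tmax - Tmin\<close> units of time, so \<open>t + j\<close> large means \<open>j\<close> large,
  and \<open>W\<close> decays like \<open>k0 ^ j\<close>.

  Nominal solutions are perturbed solutions with zero perturbation, so one analysis with
  perturbations of size \<open>\<epsilon>\<close> serves all three claims. A perturbation of size \<open>\<epsilon>\<close> costs
  at most \<open>K \<epsilon> (1 + W)\<close> in the flow rate and at each jump (\<open>flow_rate\<close>, \<open>jump_const\<close>), as the
  error terms grow at most quadratically. Gronwall on each flow interval and induction over the jumps
  give the affine recursion in \<open>trajectory_bound\<close>, whose factor and offset tend to \<open>k0\<close> and \<open>0\<close> as
  \<open>\<epsilon>\<close> tends to \<open>0\<close>. For \<open>\<epsilon> = 0\<close> this is \<open>W \<le> k0 ^ j W(0,0)\<close>, hence UGAS and the exponential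
  rate; for small \<open>\<epsilon>\<close> it is practical stability.

  Solutions are only absolutely continuous, so monotonicity along flows uses that an absolutely
  continuous function with nonpositive derivative almost everywhere is nonincreasing
  (\<open>ac_nonincreasing\<close>), proved with a fine tagged division.

  For completeness, a solution with bounded domain is extended past its last flow interval: by its
  limit if that interval does not contain its supremum (the bound on \<open>W\<close> makes the solution
  Lipschitz), by a jump if the timer has reached \<open>Tmax\<close>, and otherwise by a flow obtained from
  Picard iteration.
\<close>

section \<open>Elementary estimates\<close>

lemma le_one_plus_square: "0 \<le> r \<Longrightarrow> r \<le> 1 + r\<^sup>2" for r :: real
  using sum_power2_ge_zero[of "r - 1" 0] zero_le_power2[of r] by (simp add: power2_eq_square algebra_simps)

lemma exp_lip:
  fixes k :: real
  assumes "0 \<le> k" "0 \<le> r" "r \<le> r'"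
  shows "\<bar>exp (- k * r') - exp (- k * r)\<bar> \<le> k * (r' - r)"
proof -
  have "exp (- k * r') = exp (- k * r) * exp (- (k * (r' - r)))"
    by (simp add: exp_add[symmetric] algebra_simps)
  then have "exp (- k * r) - exp (- k * r') = exp (- k * r) * (1 - exp (- (k * (r' - r))))"
    by (simp add: algebra_simps)
  also have "\<dots> \<le> 1 * (k * (r' - r))"
    using assms exp_ge_add_one_self[of "- (k * (r' - r))"]
    by (intro mult_mono) auto
  finally show ?thesis using assms mult_left_mono[of r r' k] by simp
qed

lemma sum_geometric_step:
  fixes a :: real
  shows "a * (\<Sum>i<j. a ^ i) + 1 = (\<Sum>i<Suc j. a ^ i)"
  by (simp only: sum.lessThan_Suc_shift sum_distrib_left power_Suc) simp

lemma geometric_small: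
  assumes "0 \<le> \<rho>" "\<rho> < (1::real)" "0 < \<eta>"
  obtains J :: nat where "\<And>j. J \<le> j \<Longrightarrow> \<rho> ^ j * B \<le> \<eta>"
proof -
  have "(\<lambda>j. \<rho> ^ j * B) \<longlonglongrightarrow> 0 * B"
    using assms by (intro tendsto_intros LIMSEQ_power_zero) auto
  then have "\<forall>\<^sub>F j in sequentially. \<rho> ^ j * B < \<eta>" using assms(3) by (intro order_tendstoD) auto
  then show thesis using that unfolding eventually_sequentially by (meson less_imp_le)
qed

lemma norm_components:
  fixes z :: "'a::real_normed_vector \<times> 'b::real_normed_vector \<times> 'c::real_normed_vector"
  shows "norm (fst z) \<le> norm z" "norm (fst (snd z)) \<le> norm z" "norm (snd (snd z)) \<le> norm z"
  using norm_fst_le[of "fst z" "snd z"] norm_snd_le[of "snd z" "fst z"]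
    norm_fst_le[of "fst (snd z)" "snd (snd z)"] norm_snd_le[of "snd (snd z)" "fst (snd z)"]
  by auto

text \<open>Flow intervals of length at most \<open>h\<close> turn a large \<open>t + j\<close> into a large number of jumps.\<close>

lemma many_jumps:
  assumes "t \<le> (real j + 1) * h" "0 \<le> h" "(real J + 1) * (h + 1) \<le> t + real j"
  shows "J \<le> j"
proof -
  have "(real J + 1) * (h + 1) \<le> (real j + 1) * (h + 1)"
    using assms by (simp add: algebra_simps)
  then show ?thesis using assms(2) by simp
qed

section \<open>Absolutely continuous functions\<close>

lemma ac_delta:
  assumes "absolutely_continuous_Icc a b g" "e > 0"
  obtains d where "d > 0"
    "\<And>(N::nat) u v. (\<forall>k<N. a \<le> u k \<and> u k \<le> v k \<and> v k \<le> b) \<Longrightarrow>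
        disjoint_family_on (\<lambda>k. {u k<..<v k}) {..<N} \<Longrightarrow>
        (\<Sum>k<N. v k - u k) < d \<Longrightarrow> (\<Sum>k<N. norm (g (v k) - g (u k))) < e"
  using assms unfolding absolutely_continuous_Icc_def by meson

text \<open>The form in which absolute continuity passes from a solution to the scalar functions built from
  it: locally Lipschitz functions of the state, possibly with a Lipschitz dependence on time.\<close>

lemma ac_dominated:
  fixes g :: "real \<Rightarrow> 'a::real_normed_vector" and h :: "real \<Rightarrow> 'b::real_normed_vector"
  assumes ac: "absolutely_continuous_Icc a b g" and A: "0 \<le> A" and B: "0 \<le> B"
    and dom: "\<And>s t. a \<le> s \<Longrightarrow> s \<le> t \<Longrightarrow> t \<le> b \<Longrightarrow>
                norm (h t - h s) \<le> A * norm (g t - g s) + B * (t - s)"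
  shows "absolutely_continuous_Icc a b h"
  unfolding absolutely_continuous_Icc_def
proof (intro allI impI)
  fix e :: real assume e: "e > 0"
  define e1 where "e1 = e / (2 * (A + 1))"
  have e1: "e1 > 0" using e A by (simp add: e1_def)
  obtain d where d: "d > 0" and dd: "\<And>(N::nat) u v. (\<forall>k<N. a \<le> u k \<and> u k \<le> v k \<and> v k \<le> b) \<Longrightarrow>
        disjoint_family_on (\<lambda>k. {u k<..<v k}) {..<N} \<Longrightarrow>
        (\<Sum>k<N. v k - u k) < d \<Longrightarrow> (\<Sum>k<N. norm (g (v k) - g (u k))) < e1"
    using ac_delta[OF ac e1] by blast
  define d1 where "d1 = min d (e / (2 * (B + 1)))"
  have d1: "d1 > 0" using d e B by (simp add: d1_def)
  show "\<exists>\<delta>>0. \<forall>(N::nat) u v. (\<forall>k<N. a \<le> u k \<and> u k \<le> v k \<and> v k \<le> b) \<and>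
        disjoint_family_on (\<lambda>k. {u k<..<v k}) {..<N} \<and> (\<Sum>k<N. v k - u k) < \<delta> \<longrightarrow>
        (\<Sum>k<N. norm (h (v k) - h (u k))) < e"
  proof (intro exI[of _ d1] conjI d1 allI impI)
    fix N :: nat and u v :: "nat \<Rightarrow> real"
    assume *: "(\<forall>k<N. a \<le> u k \<and> u k \<le> v k \<and> v k \<le> b) \<and>
        disjoint_family_on (\<lambda>k. {u k<..<v k}) {..<N} \<and> (\<Sum>k<N. v k - u k) < d1"
    have 1: "(\<Sum>k<N. norm (g (v k) - g (u k))) < e1"
      using * by (intro dd) (auto simp: d1_def)
    have "(\<Sum>k<N. norm (h (v k) - h (u k)))
        \<le> (\<Sum>k<N. A * norm (g (v k) - g (u k)) + B * (v k - u k))"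
      using * by (intro sum_mono dom) auto
    also have "\<dots> = A * (\<Sum>k<N. norm (g (v k) - g (u k))) + B * (\<Sum>k<N. v k - u k)"
      by (simp only: sum.distrib sum_distrib_left)
    also have "\<dots> \<le> A * e1 + B * (e / (2 * (B + 1)))"
      using 1 * A B by (intro add_mono mult_left_mono) (auto simp: d1_def)
    also have "\<dots> < e / 2 + e / 2"
    proof (intro add_strict_mono)
      show "A * e1 < e / 2" using A e by (simp add: e1_def field_simps)
      show "B * (e / (2 * (B + 1))) < e / 2" using B e by (simp add: field_simps)
    qed
    finally show "(\<Sum>k<N. norm (h (v k) - h (u k))) < e" by simp
  qed
qed

lemma ac_subinterval:
  assumes "absolutely_continuous_Icc a b g" "a \<le> a'" "b' \<le> b"
  shows "absolutely_continuous_Icc a' b' g"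
  unfolding absolutely_continuous_Icc_def
proof (intro allI impI)
  fix e :: real assume "e > 0"
  then obtain d where "d > 0" and d: "\<And>(N::nat) u v. (\<forall>k<N. a \<le> u k \<and> u k \<le> v k \<and> v k \<le> b) \<Longrightarrow>
        disjoint_family_on (\<lambda>k. {u k<..<v k}) {..<N} \<Longrightarrow>
        (\<Sum>k<N. v k - u k) < d \<Longrightarrow> (\<Sum>k<N. norm (g (v k) - g (u k))) < e"
    using ac_delta[OF assms(1)] by blast
  then show "\<exists>\<delta>>0. \<forall>(N::nat) u v. (\<forall>k<N. a' \<le> u k \<and> u k \<le> v k \<and> v k \<le> b') \<and>
        disjoint_family_on (\<lambda>k. {u k<..<v k}) {..<N} \<and> (\<Sum>k<N. v k - u k) < \<delta> \<longrightarrow>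
        (\<Sum>k<N. norm (g (v k) - g (u k))) < e"
  proof (intro exI[of _ d] conjI allI impI)
    fix N :: nat and u v :: "nat \<Rightarrow> real"
    assume *: "(\<forall>k<N. a' \<le> u k \<and> u k \<le> v k \<and> v k \<le> b') \<and>
        disjoint_family_on (\<lambda>k. {u k<..<v k}) {..<N} \<and> (\<Sum>k<N. v k - u k) < d"
    then have "\<forall>k<N. a \<le> u k \<and> u k \<le> v k \<and> v k \<le> b"
      using assms(2,3) by (meson order_trans)
    then show "(\<Sum>k<N. norm (g (v k) - g (u k))) < e" using * by (intro d) auto
  qed
qed

lemma lipschitz_imp_ac:
  fixes h :: "real \<Rightarrow> 'b::real_normed_vector"
  assumes "0 \<le> B" "\<And>s t. a \<le> s \<Longrightarrow> s \<le> t \<Longrightarrow> t \<le> b \<Longrightarrow> norm (h t - h s) \<le> B * (t - s)"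
  shows "absolutely_continuous_Icc a b h"
proof (rule ac_dominated[where g = "\<lambda>_. 0::real" and A = 0])
  show "absolutely_continuous_Icc a b (\<lambda>_. 0::real)"
    by (auto simp: absolutely_continuous_Icc_def intro: exI[of _ 1])
qed (use assms in auto)

lemma ac_imp_continuous_on:
  fixes g :: "real \<Rightarrow> 'a::real_normed_vector"
  assumes "absolutely_continuous_Icc a b g"
  shows "continuous_on {a..b} g"
  unfolding continuous_on_iff
proof (intro ballI allI impI)
  fix x e :: real assume x: "x \<in> {a..b}" and "e > 0"
  then obtain d where "d > 0" and d: "\<And>(N::nat) u v. (\<forall>k<N. a \<le> u k \<and> u k \<le> v k \<and> v k \<le> b) \<Longrightarrow>
        disjoint_family_on (\<lambda>k. {u k<..<v k}) {..<N} \<Longrightarrow>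
        (\<Sum>k<N. v k - u k) < d \<Longrightarrow> (\<Sum>k<N. norm (g (v k) - g (u k))) < e"
    using ac_delta[OF assms] by blast
  have "dist (g y) (g x) < e" if y: "y \<in> {a..b}" "dist y x < d" for y
  proof -
    have "(\<Sum>k<1::nat. norm (g (max x y) - g (min x y))) < e"
      using x y by (intro d) (auto simp: disjoint_family_on_def dist_real_def)
    then show ?thesis
      by (auto simp: dist_norm max_def min_def norm_minus_commute split: if_splits)
  qed
  with \<open>d > 0\<close> show "\<exists>d>0. \<forall>x'\<in>{a..b}. dist x' x < d \<longrightarrow> dist (g x') (g x) < e" by blast
qed

text \<open>An interval that straddles \<open>m\<close> is cut at \<open>m\<close>; \<open>min\<close> and \<open>max\<close> do this for all intervals
  of a family at once.\<close>

lemma ac_concat: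
  fixes g :: "real \<Rightarrow> 'a::real_normed_vector"
  assumes 1: "absolutely_continuous_Icc a m g" and 2: "absolutely_continuous_Icc m b g"
    and "a \<le> m" "m \<le> b"
  shows "absolutely_continuous_Icc a b g"
  unfolding absolutely_continuous_Icc_def
proof (intro allI impI)
  fix e :: real assume "e > 0"
  then have e2: "e / 2 > 0" by simp
  obtain d1 where d1: "d1 > 0" "\<And>(N::nat) u v. (\<forall>k<N. a \<le> u k \<and> u k \<le> v k \<and> v k \<le> m) \<Longrightarrow>
        disjoint_family_on (\<lambda>k. {u k<..<v k}) {..<N} \<Longrightarrow>
        (\<Sum>k<N. v k - u k) < d1 \<Longrightarrow> (\<Sum>k<N. norm (g (v k) - g (u k))) < e / 2"
    using ac_delta[OF 1 e2] by blast
  obtain d2 where d2: "d2 > 0" "\<And>(N::nat) u v. (\<forall>k<N. m \<le> u k \<and> u k \<le> v k \<and> v k \<le> b) \<Longrightarrow>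
        disjoint_family_on (\<lambda>k. {u k<..<v k}) {..<N} \<Longrightarrow>
        (\<Sum>k<N. v k - u k) < d2 \<Longrightarrow> (\<Sum>k<N. norm (g (v k) - g (u k))) < e / 2"
    using ac_delta[OF 2 e2] by blast
  show "\<exists>\<delta>>0. \<forall>(N::nat) u v. (\<forall>k<N. a \<le> u k \<and> u k \<le> v k \<and> v k \<le> b) \<and>
        disjoint_family_on (\<lambda>k. {u k<..<v k}) {..<N} \<and> (\<Sum>k<N. v k - u k) < \<delta> \<longrightarrow>
        (\<Sum>k<N. norm (g (v k) - g (u k))) < e"
  proof (intro exI[of _ "min d1 d2"] conjI allI impI)
    fix N :: nat and u v :: "nat \<Rightarrow> real"
    assume *: "(\<forall>k<N. a \<le> u k \<and> u k \<le> v k \<and> v k \<le> b) \<and>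
        disjoint_family_on (\<lambda>k. {u k<..<v k}) {..<N} \<and> (\<Sum>k<N. v k - u k) < min d1 d2"
    have le: "(\<Sum>k<N. min (v k) m - min (u k) m) \<le> (\<Sum>k<N. v k - u k)"
             "(\<Sum>k<N. max (v k) m - max (u k) m) \<le> (\<Sum>k<N. v k - u k)"
      using * by (auto intro!: sum_mono)
    have A: "(\<Sum>k<N. norm (g (min (v k) m) - g (min (u k) m))) < e / 2"
    proof (rule d1(2))
      show "disjoint_family_on (\<lambda>k. {min (u k) m<..<min (v k) m}) {..<N}"
        using * by (fastforce simp: disjoint_family_on_def)
    qed (use * le \<open>a \<le> m\<close> in \<open>auto simp: min_le_iff_disj\<close>)
    have B: "(\<Sum>k<N. norm (g (max (v k) m) - g (max (u k) m))) < e / 2"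
    proof (rule d2(2))
      show "disjoint_family_on (\<lambda>k. {max (u k) m<..<max (v k) m}) {..<N}"
        using * by (fastforce simp: disjoint_family_on_def)
    qed (use * le \<open>m \<le> b\<close> in \<open>auto simp: le_max_iff_disj\<close>)
    have "(\<Sum>k<N. norm (g (v k) - g (u k))) \<le>
      (\<Sum>k<N. norm (g (min (v k) m) - g (min (u k) m)) + norm (g (max (v k) m) - g (max (u k) m)))"
    proof (intro sum_mono)
      fix k assume "k \<in> {..<N}"
      have "g (v k) - g (u k) = (g (min (v k) m) - g (min (u k) m)) + (g (max (v k) m) - g (max (u k) m))"
        by (auto simp: min_def max_def)
      then show "norm (g (v k) - g (u k)) \<le> norm (g (min (v k) m) - g (min (u k) m)) + norm (g (max (v k) m) - g (max (u k) m))"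
        by (metis norm_triangle_ineq)
    qed
    also have "\<dots> < e / 2 + e / 2" unfolding sum.distrib using A B by simp
    finally show "(\<Sum>k<N. norm (g (v k) - g (u k))) < e" by simp
  qed (use d1 d2 in auto)
qed

text \<open>Henstock's argument: on a sufficiently fine tagged division, the subintervals tagged outside the
  exceptional set contribute at most \<open>e / 2\<close> by differentiability. Those tagged in it lie in an open
  set of small measure, so absolute continuity bounds their contribution by \<open>e / 2\<close>.\<close>

lemma ac_nonincreasing:
  fixes h :: "real \<Rightarrow> real"
  assumes ac: "absolutely_continuous_Icc a b h" and ab: "a \<le> b" and N: "negligible N"
    and der: "\<And>t. t \<in> {a..b} - N \<Longrightarrow> \<exists>D\<le>0. (h has_real_derivative D) (at t within {a..b})"
  shows "h b \<le> h a"
proof (rule field_le_epsilon)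
  fix e :: real assume e: "e > 0"
  define e1 where "e1 = e / (2 * (b - a + 1))"
  have e1: "e1 > 0" using e ab by (simp add: e1_def)
  have e2: "e / 2 > 0" using e by simp
  obtain d where d: "d > 0" and dd: "\<And>(K::nat) u v. (\<forall>k<K. a \<le> u k \<and> u k \<le> v k \<and> v k \<le> b) \<Longrightarrow>
        disjoint_family_on (\<lambda>k. {u k<..<v k}) {..<K} \<Longrightarrow>
        (\<Sum>k<K. v k - u k) < d \<Longrightarrow> (\<Sum>k<K. norm (h (v k) - h (u k))) < e / 2"
    using ac_delta[OF ac e2] by blast
  have Ns: "N \<in> sets lebesgue" "N \<in> lmeasurable" "measure lebesgue N = 0"
    using N negligible_imp_measurable negligible_imp_measure0 by blast+
  obtain U where U: "open U" "N \<subseteq> U" "U - N \<in> lmeasurable" "emeasure lebesgue (U - N) < ennreal d"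
    using sets_lebesgue_outer_open[OF Ns(1) d] by blast
  then have UN: "measure lebesgue (U - N) < d"
    using d by (simp add: emeasure_eq_measure2 ennreal_less_iff)
  have Um: "U \<in> lmeasurable"
    using fmeasurable.Un[OF U(3) Ns(2)] U(2) by (simp add: Un_absorb2)
  have mU: "measure lebesgue U < d"
    using UN measure_Un_le[of "U - N" lebesgue N] U(2,3) Ns by (simp add: Un_absorb2 fmeasurableD)
  have "\<exists>r>0. \<forall>u v. u \<in> {a..b} \<and> v \<in> {a..b} \<and> u \<le> t \<and> t \<le> v \<and> {u..v} \<subseteq> ball t r \<longrightarrow>
          h v - h u \<le> e1 * (v - u)" if t: "t \<in> {a..b} - N" for t
  proof -
    obtain D where D: "D \<le> 0" "(h has_real_derivative D) (at t within {a..b})" using der t by blast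
    from D(2) have "(h has_derivative (\<lambda>x. D * x)) (at t within {a..b})"
      by (simp add: has_field_derivative_def)
    then obtain r where r: "r > 0" "\<And>y. y \<in> {a..b} \<Longrightarrow> norm (y - t) < r \<Longrightarrow>
        norm (h y - h t - D * (y - t)) \<le> e1 * norm (y - t)"
      unfolding has_derivative_within_alt using e1 by blast
    show ?thesis
    proof (intro exI[of _ r] conjI r allI impI)
      fix u v assume uv: "u \<in> {a..b} \<and> v \<in> {a..b} \<and> u \<le> t \<and> t \<le> v \<and> {u..v} \<subseteq> ball t r"
      then have "u \<in> {u..v}" "v \<in> {u..v}" by auto
      with uv have "u \<in> ball t r" "v \<in> ball t r" by blast+
      then have "norm (h u - h t - D * (u - t)) \<le> e1 * norm (u - t)"
           "norm (h v - h t - D * (v - t)) \<le> e1 * norm (v - t)"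
        using uv by (intro r(2); simp add: dist_real_def)+
      then have "h v - h t \<le> D * (v - t) + e1 * (v - t)" "h t - h u \<le> D * (t - u) + e1 * (t - u)"
        using uv by (auto simp: algebra_simps abs_le_iff)
      moreover have "D * (v - t) \<le> 0" "D * (t - u) \<le> 0"
        using D uv by (auto intro: mult_nonpos_nonneg)
      ultimately show "h v - h u \<le> e1 * (v - u)" by (simp add: algebra_simps)
    qed
  qed
  then obtain r where r: "\<And>t. t \<in> {a..b} - N \<Longrightarrow> r t > 0"
      "\<And>t u v. t \<in> {a..b} - N \<Longrightarrow> u \<in> {a..b} \<Longrightarrow> v \<in> {a..b} \<Longrightarrow> u \<le> t \<Longrightarrow> t \<le> v \<Longrightarrow>
         {u..v} \<subseteq> ball t (r t) \<Longrightarrow> h v - h u \<le> e1 * (v - u)"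
    by metis
  define \<gamma> where "\<gamma> t = (if t \<in> N then U else if t \<in> {a..b} then ball t (r t) else UNIV)" for t
  have "gauge \<gamma>" using U r unfolding gauge_def \<gamma>_def by auto
  then obtain p where p: "p tagged_division_of {a..b}" "\<gamma> fine p"
    using fine_division_exists_real by blast
  have fin: "finite p" using p by blast
  have pK: "K = {Inf K..Sup K} \<and> Inf K \<le> x \<and> x \<le> Sup K \<and> a \<le> Inf K \<and> Sup K \<le> b \<and> K \<subseteq> \<gamma> x"
    if "(x, K) \<in> p" for x K
  proof -
    have "x \<in> K" "K \<subseteq> {a..b}" "\<exists>u v. K = cbox u v" using tagged_division_ofD[OF p(1)] that by blast+
    moreover have "K \<subseteq> \<gamma> x" using p(2) that by (auto simp: fine_def)
    ultimately show ?thesis by (auto simp: cbox_interval)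
  qed
  define q where "q = {xK \<in> p. fst xK \<in> N}"
  have finq: "finite q" using fin by (simp add: q_def)
  have tele: "(\<Sum>(x,K)\<in>p. g (Sup K) - g (Inf K)) = g b - g a" for g :: "real \<Rightarrow> real"
    using additive_tagged_division_1[OF ab p(1)] .
  have good: "(\<Sum>(x,K)\<in>p - q. h (Sup K) - h (Inf K)) \<le> e / 2"
  proof -
    have "(\<Sum>(x,K)\<in>p - q. h (Sup K) - h (Inf K)) \<le> (\<Sum>(x,K)\<in>p - q. e1 * (Sup K - Inf K))"
    proof (intro sum_mono, clarify)
      fix x K assume xK: "(x, K) \<in> p" "(x, K) \<notin> q"
      then have "x \<in> {a..b} - N" using pK[OF xK(1)] by (auto simp: q_def)
      then show "h (Sup K) - h (Inf K) \<le> e1 * (Sup K - Inf K)"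
        using pK[OF xK(1)] by (intro r(2)[of x]) (auto simp: \<gamma>_def)
    qed
    also have "\<dots> \<le> (\<Sum>(x,K)\<in>p. e1 * (Sup K - Inf K))"
      using fin pK e1 by (intro sum_mono2) (auto intro!: mult_nonneg_nonneg, force)
    also have "\<dots> = e1 * (b - a)"
      using tele[of "\<lambda>x. e1 * x"] by (simp add: algebra_simps)
    also have "\<dots> \<le> e / 2" using e ab by (simp add: e1_def field_simps)
    finally show ?thesis .
  qed
  have bad: "(\<Sum>(x,K)\<in>q. h (Sup K) - h (Inf K)) \<le> e / 2"
  proof -
    obtain \<phi> where \<phi>: "bij_betw \<phi> {..<card q} q"
      using ex_bij_betw_nat_finite[OF finq] by (auto simp: lessThan_atLeast0)
    define u where "u k = Inf (snd (\<phi> k))" for k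
    define v where "v k = Sup (snd (\<phi> k))" for k
    have \<phi>q: "\<phi> k \<in> p \<and> fst (\<phi> k) \<in> N" if "k < card q" for k
      using bij_betwE[OF \<phi>] that by (auto simp: q_def)
    have uv: "snd (\<phi> k) = {u k..v k} \<and> u k \<le> v k \<and> a \<le> u k \<and> v k \<le> b \<and> {u k..v k} \<subseteq> U" if "k < card q" for k
      using pK[of "fst (\<phi> k)" "snd (\<phi> k)"] \<phi>q[OF that] unfolding u_def v_def \<gamma>_def by force
    have dis: "disjoint_family_on (\<lambda>k. {u k<..<v k}) {..<card q}"
      unfolding disjoint_family_on_def
    proof (intro ballI impI)
      fix k l assume kl: "k \<in> {..<card q}" "l \<in> {..<card q}" "k \<noteq> l"
      then have "\<phi> k \<noteq> \<phi> l" using \<phi> by (metis bij_betw_def inj_onD)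
      then have "interior (snd (\<phi> k)) \<inter> interior (snd (\<phi> l)) = {}"
        using tagged_division_ofD(5)[OF p(1), of "fst (\<phi> k)" "snd (\<phi> k)" "fst (\<phi> l)" "snd (\<phi> l)"]
          \<phi>q kl by (auto simp: prod_eq_iff)
      then show "{u k<..<v k} \<inter> {u l<..<v l} = {}"
        using uv kl by (auto simp: interior_atLeastAtMost_real)
    qed
    have "(\<Sum>k<card q. v k - u k) = (\<Sum>k<card q. measure lebesgue {u k<..<v k})"
      using uv by (intro sum.cong) auto
    also have "\<dots> = measure lebesgue (\<Union>k<card q. {u k<..<v k})"
      using uv by (intro measure_finite_Union[symmetric] dis) (auto simp: emeasure_lborel_Ioo)
    also have "\<dots> \<le> measure lebesgue U"
      using uv by (intro measure_mono_fmeasurable Um) (auto, force)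
    finally have "(\<Sum>k<card q. v k - u k) < d" using mU by simp
    then have "(\<Sum>k<card q. norm (h (v k) - h (u k))) < e / 2"
      using uv dis by (intro dd) auto
    moreover have "(\<Sum>(x,K)\<in>q. h (Sup K) - h (Inf K)) = (\<Sum>k<card q. h (v k) - h (u k))"
      by (subst sum.reindex_bij_betw[OF \<phi>, symmetric]) (simp add: u_def v_def case_prod_beta)
    moreover have "\<dots> \<le> (\<Sum>k<card q. norm (h (v k) - h (u k)))" by (intro sum_mono) auto
    ultimately show ?thesis by linarith
  qed
  have "h b - h a = (\<Sum>(x,K)\<in>p - q. h (Sup K) - h (Inf K)) + (\<Sum>(x,K)\<in>q. h (Sup K) - h (Inf K))"
    using tele[of h] sum.subset_diff[OF _ fin, of q "\<lambda>(x,K). h (Sup K) - h (Inf K)"]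
    by (simp add: q_def)
  then show "h b \<le> h a + e" using good bad by simp
qed

text \<open>Reduction to the scalar case by pairing with the unit vector along \<open>g b - g a\<close>.\<close>

lemma ac_lipschitz:
  fixes g :: "real \<Rightarrow> 'a::real_inner"
  assumes ac: "absolutely_continuous_Icc a b g" and ab: "a \<le> b" and N: "negligible N" and M: "0 \<le> M"
    and der: "\<And>t. t \<in> {a..b} - N \<Longrightarrow>
                \<exists>D. norm D \<le> M \<and> (g has_vector_derivative D) (at t within {a..b})"
  shows "norm (g b - g a) \<le> M * (b - a)"
proof -
  define y where "y = sgn (g b - g a)"
  have y: "norm y \<le> 1" by (simp add: y_def norm_sgn)
  define h where "h t = inner y (g t) - M * t" for t
  have "h b \<le> h a"
  proof (rule ac_nonincreasing[OF _ ab N])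
    show "absolutely_continuous_Icc a b h"
    proof (rule ac_dominated[OF ac, of 1 M])
      fix s t assume "a \<le> s" "s \<le> t" "t \<le> b"
      have "norm (h t - h s) \<le> \<bar>inner y (g t - g s)\<bar> + M * (t - s)"
        using M \<open>s \<le> t\<close> abs_triangle_ineq4[of "inner y (g t - g s)" "M * (t - s)"]
          mult_left_mono[OF \<open>s \<le> t\<close> M]
        by (simp add: h_def algebra_simps abs_mult)
      also have "\<bar>inner y (g t - g s)\<bar> \<le> norm y * norm (g t - g s)" by (rule Cauchy_Schwarz_ineq2)
      also have "\<dots> \<le> 1 * norm (g t - g s)" using y by (intro mult_right_mono) auto
      finally show "norm (h t - h s) \<le> 1 * norm (g t - g s) + M * (t - s)" by simp
    qed (use M in auto)
  next
    fix t assume "t \<in> {a..b} - N"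
    then obtain D where D: "norm D \<le> M" "(g has_vector_derivative D) (at t within {a..b})"
      using der by blast
    have "inner y D \<le> norm y * norm D" by (rule norm_cauchy_schwarz)
    also have "\<dots> \<le> 1 * M" using y D(1) by (intro mult_mono) auto
    finally have "inner y D - M \<le> 0" by simp
    moreover have "(h has_real_derivative (inner y D - M)) (at t within {a..b})"
      unfolding h_def has_real_derivative_iff_has_vector_derivative using D(2)
      by (auto intro!: derivative_eq_intros
          bounded_linear.has_vector_derivative[OF bounded_linear_inner_right])
    ultimately show "\<exists>D\<le>0. (h has_real_derivative D) (at t within {a..b})" by blast
  qed
  moreover have "inner y (g b - g a) = norm (g b - g a)"
    by (cases "g b = g a") (simp_all add: y_def sgn_div_norm dot_square_norm power2_eq_square)
  ultimately show ?thesis by (simp add: h_def algebra_simps)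
qed

lemma C1_imp_ac:
  fixes y :: "real \<Rightarrow> 'a::real_normed_vector"
  assumes der: "\<And>t. t \<in> {a..b} \<Longrightarrow> (y has_vector_derivative y' t) (at t within {a..b})"
    and cont: "continuous_on {a..b} y'"
  shows "absolutely_continuous_Icc a b y"
proof -
  have "bounded (y' ` {a..b})" by (intro compact_imp_bounded compact_continuous_image cont) auto
  then obtain B where B: "B > 0" "\<And>t. t \<in> {a..b} \<Longrightarrow> norm (y' t) \<le> B"
    unfolding bounded_pos by auto
  show ?thesis
  proof (rule lipschitz_imp_ac[of B])
    fix s t assume st: "a \<le> s" "s \<le> t" "t \<le> b"
    have "norm (y t - y s) \<le> B * norm (t - s)"
    proof (rule differentiable_bound)
      show "(y has_derivative (\<lambda>h. h *\<^sub>R y' r)) (at r within {a..b})" if "r \<in> {a..b}" for r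
        using der[OF that] by (simp add: has_vector_derivative_def)
      show "onorm (\<lambda>h. h *\<^sub>R y' r) \<le> B" if "r \<in> {a..b}" for r
        using B(1) B(2)[OF that] by (intro onorm_bound) (auto simp: mult.commute[of B] mult_left_mono)
    qed (use st in auto)
    then show "norm (y t - y s) \<le> B * (t - s)" using st by simp
  qed (use B in auto)
qed

text \<open>Derivatives within a set only see the set and the function near the point; used where a solution
  is glued from two pieces.\<close>

lemma vector_derivative_local:
  assumes f: "(f has_vector_derivative D) (at x within S)" and U: "open U" "x \<in> U" and x: "x \<in> S"
    and ST: "S \<inter> U = T \<inter> U" and eq: "\<And>y. y \<in> S \<inter> U \<Longrightarrow> g y = f y"
  shows "(g has_vector_derivative D) (at x within T)"
proof -
  have "(f has_vector_derivative D) (at x within S \<inter> U)"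
    using f by (rule has_vector_derivative_within_subset) auto
  then have "(g has_vector_derivative D) (at x within S \<inter> U)"
    by (rule has_vector_derivative_transform[rotated 2]) (use x U eq in auto)
  moreover have "at x within S \<inter> U = at x within T"
  proof (rule at_within_nhd[OF U(2,1)])
    show "S \<inter> U \<inter> U - {x} = T \<inter> U - {x}" using ST by blast
  qed
  ultimately show ?thesis by simp
qed

section \<open>Hybrid time domains\<close>

text \<open>Below a point \<open>(t, j)\<close> the domain consists of exactly the levels \<open>0..j\<close>, and the last of
  the intervals ends at \<open>t\<close>.\<close>

lemma hybrid_time_domain_at:
  assumes E: "hybrid_time_domain E" and tj: "(t, j) \<in> E"
  obtains ts where "ts 0 = (0::real)" "\<forall>i\<le>j. ts i \<le> ts (Suc i)" "ts (Suc j) = t"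
    "E \<inter> ({0..t} \<times> {..j}) = (\<Union>i<Suc j. {ts i..ts (Suc i)} \<times> {i})"
proof -
  have t0: "0 \<le> t" using assms by (auto simp: hybrid_time_domain_def)
  obtain N ts where ts: "ts 0 = (0::real)" "\<forall>i<N. ts i \<le> ts (Suc i)"
      "E \<inter> ({0..t} \<times> {..j}) = (\<Union>i<N. {ts i..ts (Suc i)} \<times> {i})"
    using bspec[OF conjunct2[OF E[unfolded hybrid_time_domain_def]] tj] by auto
  have tin: "(t, j) \<in> (\<Union>i<N. {ts i..ts (Suc i)} \<times> {i})" unfolding ts(3)[symmetric] using tj t0 by simp
  then have jN: "j < N" "t \<le> ts (Suc j)" by auto
  have "\<not> Suc j < N"
  proof
    assume "Suc j < N"
    then have "(ts (Suc j), Suc j) \<in> (\<Union>i<N. {ts i..ts (Suc i)} \<times> {i})" using ts(2) by auto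
    then show False unfolding ts(3)[symmetric] by simp
  qed
  then have N: "N = Suc j" using jN by simp
  have "(ts (Suc j), j) \<in> (\<Union>i<N. {ts i..ts (Suc i)} \<times> {i})" using ts(2) jN by auto
  then have "ts (Suc j) \<le> t" unfolding ts(3)[symmetric] by simp
  then have "ts (Suc j) = t" using jN by simp
  then show thesis using that[of ts] ts N by (simp add: less_Suc_eq_le)
qed

lemma hybrid_time_domain_slice_0:
  assumes "hybrid_time_domain E" "(t, 0) \<in> E"
  shows "0 \<le> t" "{0..t} \<subseteq> time_slice E 0"
proof -
  obtain ts where ts: "ts 0 = (0::real)" "\<forall>i\<le>0. ts i \<le> ts (Suc i)" "ts (Suc 0) = t"
    "E \<inter> ({0..t} \<times> {..0}) = (\<Union>i<Suc 0. {ts i..ts (Suc i)} \<times> {i})"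
    by (rule hybrid_time_domain_at[OF assms])
  show "0 \<le> t" using ts(1-3) by simp
  show "{0..t} \<subseteq> time_slice E 0"
  proof
    fix r assume "r \<in> {0..t}"
    then have "(r, 0) \<in> (\<Union>i<Suc 0. {ts i..ts (Suc i)} \<times> {i})" using ts(1,3) by simp
    then show "r \<in> time_slice E 0" unfolding ts(4)[symmetric] by (simp add: time_slice_def)
  qed
qed

text \<open>The induction step over jumps: a point on level \<open>j + 1\<close> is reached by a jump from level \<open>j\<close>
  followed by a flow. Only the part of the domain below the point is used, because the domain may
  branch: a level can continue after the time at which the next level starts.\<close>

lemma hybrid_time_domain_slice_Suc:
  assumes "hybrid_time_domain E" "(t, Suc j) \<in> E"
  obtains s where "0 \<le> s" "s \<le> t" "(s, j) \<in> E" "(s, Suc j) \<in> E" "{s..t} \<subseteq> time_slice E (Suc j)"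
proof -
  obtain ts where ts: "ts 0 = (0::real)" "\<forall>i\<le>Suc j. ts i \<le> ts (Suc i)" "ts (Suc (Suc j)) = t"
    "E \<inter> ({0..t} \<times> {..Suc j}) = (\<Union>i<Suc (Suc j). {ts i..ts (Suc i)} \<times> {i})"
    by (rule hybrid_time_domain_at[OF assms])
  have le: "ts (Suc j) \<le> t" "ts j \<le> ts (Suc j)" using ts(2,3) by (auto dest: spec[of _ j] spec[of _ "Suc j"])
  have sub: "(r, Suc j) \<in> E" if "ts (Suc j) \<le> r" "r \<le> t" for r
  proof -
    have "(r, Suc j) \<in> (\<Union>i<Suc (Suc j). {ts i..ts (Suc i)} \<times> {i})" using that ts(3) by auto
    then show ?thesis unfolding ts(4)[symmetric] by simp
  qed
  have "(ts (Suc j), j) \<in> (\<Union>i<Suc (Suc j). {ts i..ts (Suc i)} \<times> {i})" using le by auto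
  then have "(ts (Suc j), j) \<in> E" unfolding ts(4)[symmetric] by simp
  moreover have "0 \<le> ts (Suc j)"
    using calculation assms(1) by (auto simp: hybrid_time_domain_def)
  moreover have "{ts (Suc j)..t} \<subseteq> time_slice E (Suc j)"
    using sub by (auto simp: time_slice_def)
  ultimately show thesis using that[of "ts (Suc j)"] le sub[of "ts (Suc j)"] by simp
qed

lemma hybrid_time_domain_at_iff:
  assumes E: "hybrid_time_domain E" and tj: "(t, j) \<in> E"
  obtains ts where "ts 0 = (0::real)" "\<forall>i\<le>j. ts i \<le> ts (Suc i)" "ts (Suc j) = t"
    "\<And>r i. i \<le> j \<Longrightarrow> (r, i) \<in> E \<and> 0 \<le> r \<and> r \<le> t \<longleftrightarrow> ts i \<le> r \<and> r \<le> ts (Suc i)"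
proof -
  obtain ts where ts: "ts 0 = (0::real)" "\<forall>i\<le>j. ts i \<le> ts (Suc i)" "ts (Suc j) = t"
    "E \<inter> ({0..t} \<times> {..j}) = (\<Union>i<Suc j. {ts i..ts (Suc i)} \<times> {i})"
    by (rule hybrid_time_domain_at[OF E tj])
  have "(r, i) \<in> E \<and> 0 \<le> r \<and> r \<le> t \<longleftrightarrow> ts i \<le> r \<and> r \<le> ts (Suc i)" if "i \<le> j" for r i
  proof -
    have "(r, i) \<in> E \<inter> ({0..t} \<times> {..j}) \<longleftrightarrow> (r, i) \<in> (\<Union>i<Suc j. {ts i..ts (Suc i)} \<times> {i})"
      by (simp only: ts(4))
    then show ?thesis using that by auto
  qed
  then show thesis using that[of ts] ts(1-3) by blast
qed

lemma hybrid_time_domainI: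
  assumes "\<And>t j. (t, j) \<in> E \<Longrightarrow> 0 \<le> t"
    and "\<And>t j. (t, j) \<in> E \<Longrightarrow> \<exists>ts. ts 0 = (0::real) \<and> (\<forall>i\<le>j. ts i \<le> ts (Suc i)) \<and>
      (\<forall>r i. i \<le> j \<longrightarrow> ((r, i) \<in> E \<and> 0 \<le> r \<and> r \<le> t \<longleftrightarrow> ts i \<le> r \<and> r \<le> ts (Suc i)))"
  shows "hybrid_time_domain E"
  unfolding hybrid_time_domain_def
proof (intro conjI ballI)
  show "E \<subseteq> {0..} \<times> UNIV" using assms(1) by auto
  fix x assume x: "x \<in> E"
  obtain t j where [simp]: "x = (t, j)" by (cases x)
  obtain ts where ts: "ts 0 = (0::real)" "\<forall>i\<le>j. ts i \<le> ts (Suc i)"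
      "\<forall>r i. i \<le> j \<longrightarrow> ((r, i) \<in> E \<and> 0 \<le> r \<and> r \<le> t \<longleftrightarrow> ts i \<le> r \<and> r \<le> ts (Suc i))"
    using assms(2) x by force
  have "E \<inter> ({0..t} \<times> {..j}) = (\<Union>i<Suc j. {ts i..ts (Suc i)} \<times> {i})"
  proof (rule set_eqI)
    fix p :: "real \<times> nat"
    obtain r i where [simp]: "p = (r, i)" by (cases p)
    show "p \<in> E \<inter> ({0..t} \<times> {..j}) \<longleftrightarrow> p \<in> (\<Union>i<Suc j. {ts i..ts (Suc i)} \<times> {i})"
      using ts(3)[rule_format, of i r] by auto
  qed
  then show "case x of (T, J) \<Rightarrow> \<exists>N ts. ts 0 = 0 \<and> (\<forall>j<N. ts j \<le> ts (Suc j)) \<and>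
        E \<inter> ({0..T} \<times> {..J}) = (\<Union>j<N. {ts j..ts (Suc j)} \<times> {j})"
    using ts by (auto intro!: exI[of _ "Suc j"] exI[of _ ts] simp: less_Suc_eq_le)
qed

lemma time_slice_convex:
  assumes E: "hybrid_time_domain E" and "(s, j) \<in> E" "(t, j) \<in> E"
  shows "{s..t} \<subseteq> time_slice E j"
proof (cases "s \<le> t")
  case True
  obtain ts where ts: "ts 0 = (0::real)" "\<forall>i\<le>j. ts i \<le> ts (Suc i)" "ts (Suc j) = t"
    "\<And>r i. i \<le> j \<Longrightarrow> (r, i) \<in> E \<and> 0 \<le> r \<and> r \<le> t \<longleftrightarrow> ts i \<le> r \<and> r \<le> ts (Suc i)"
    by (rule hybrid_time_domain_at_iff[OF E assms(3)]) blast
  have "0 \<le> s" using E assms(2) by (auto simp: hybrid_time_domain_def)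
  then have "ts j \<le> s" using ts(4)[of j s] assms(2) True by simp
  then show ?thesis using ts(4)[of j] ts(3) by (force simp: time_slice_def)
qed auto

text \<open>The hypothesis \<open>order\<close> does not follow from the definition of a hybrid time domain, in which a
  lower level may extend beyond \<open>t0\<close>. For solutions it is a consequence of the timer
  (\<open>nominal_ordered\<close>).\<close>

lemma hybrid_time_domain_extend_flow:
  assumes E: "hybrid_time_domain E" and top: "\<And>t j. (t, j) \<in> E \<Longrightarrow> j \<le> J"
    and t0: "(t0, J) \<in> E" "t0 \<le> t1" and t1: "\<And>t. (t, J) \<in> E \<Longrightarrow> t \<le> t1"
    and order: "\<And>t j. (t, j) \<in> E \<Longrightarrow> j < J \<Longrightarrow> t \<le> t0"
  shows "hybrid_time_domain (E \<union> {t0..t1} \<times> {J})"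
proof (rule hybrid_time_domainI)
  have nonneg: "0 \<le> t" if "(t, j) \<in> E" for t j using E that by (auto simp: hybrid_time_domain_def)
  show "0 \<le> t" if "(t, j) \<in> E \<union> {t0..t1} \<times> {J}" for t j
    using that nonneg[of t j] nonneg[OF t0(1)] by auto
  obtain ts where ts: "ts 0 = (0::real)" "\<forall>i\<le>J. ts i \<le> ts (Suc i)" "ts (Suc J) = t0"
    "\<And>r i. i \<le> J \<Longrightarrow> (r, i) \<in> E \<and> 0 \<le> r \<and> r \<le> t0 \<longleftrightarrow> ts i \<le> r \<and> r \<le> ts (Suc i)"
    by (rule hybrid_time_domain_at_iff[OF E t0(1)]) blast
  fix t j assume tj: "(t, j) \<in> E \<union> {t0..t1} \<times> {J}"
  show "\<exists>ts. ts 0 = (0::real) \<and> (\<forall>i\<le>j. ts i \<le> ts (Suc i)) \<and>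
      (\<forall>r i. i \<le> j \<longrightarrow> ((r, i) \<in> E \<union> {t0..t1} \<times> {J} \<and> 0 \<le> r \<and> r \<le> t \<longleftrightarrow> ts i \<le> r \<and> r \<le> ts (Suc i)))"
  proof (cases "j < J \<or> t \<le> t0")
    case True
    then have tjE: "(t, j) \<in> E" using tj t0 by auto
    obtain us where us: "us 0 = (0::real)" "\<forall>i\<le>j. us i \<le> us (Suc i)" "us (Suc j) = t"
      "\<And>r i. i \<le> j \<Longrightarrow> (r, i) \<in> E \<and> 0 \<le> r \<and> r \<le> t \<longleftrightarrow> us i \<le> r \<and> r \<le> us (Suc i)"
      by (rule hybrid_time_domain_at_iff[OF E tjE]) blast
    have "(r, i) \<in> E \<union> {t0..t1} \<times> {J} \<and> r \<le> t \<longleftrightarrow> (r, i) \<in> E \<and> r \<le> t" if "i \<le> j" for r i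
      using True that t0 top[OF tjE] by (cases "r = t0") auto
    then have "(r, i) \<in> E \<union> {t0..t1} \<times> {J} \<and> 0 \<le> r \<and> r \<le> t \<longleftrightarrow> us i \<le> r \<and> r \<le> us (Suc i)"
      if "i \<le> j" for r i
      using us(4)[OF that, of r] that by blast
    then show ?thesis by (intro exI[of _ us] conjI allI impI us(1) us(2))
  next
    case False
    then have jJ: "j = J" and t: "t0 < t" "t \<le> t1" using tj top[of t j] t1[of t] by auto
    define us where "us = ts(Suc J := t)"
    have us: "us i = ts i" if "i \<le> J" for i using that by (simp add: us_def)
    have usJ: "us (Suc J) = t" by (simp add: us_def)
    have "us i \<le> us (Suc i)" if "i \<le> J" for i
    proof (cases "i = J")
      case True
      then show ?thesis using us[of J] usJ t ts(2)[rule_format, of J] ts(3) by auto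
    next
      case False
      then show ?thesis using us[of i] us[of "Suc i"] that ts(2) by auto
    qed
    moreover have "(r, i) \<in> E \<union> {t0..t1} \<times> {J} \<and> 0 \<le> r \<and> r \<le> t \<longleftrightarrow> us i \<le> r \<and> r \<le> us (Suc i)"
      if i: "i \<le> J" for r i
    proof (cases "i = J")
      case True
      have "ts J \<le> t0" using ts(2)[rule_format, of J] ts(3) by auto
      moreover have "0 \<le> t0" using nonneg t0 by blast
      ultimately show ?thesis
        using True us[of J] usJ t ts(3) ts(4)[of J r] by auto
    next
      case False
      then have "i < J" using i by simp
      then show ?thesis
        using us[of i] us[of "Suc i"] t ts(4)[of i r] order[of r i] nonneg[of r i] by auto
    qed
    ultimately show ?thesis
      using ts(1) us[of 0] jJ by (intro exI[of _ us]) auto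
  qed
qed

lemma hybrid_time_domain_extend_jump:
  assumes E: "hybrid_time_domain E" and top: "\<And>t j. (t, j) \<in> E \<Longrightarrow> j \<le> J" and T: "(T, J) \<in> E"
  shows "hybrid_time_domain (insert (T, Suc J) E)"
proof (rule hybrid_time_domainI)
  have nonneg: "0 \<le> t" if "(t, j) \<in> E" for t j using E that by (auto simp: hybrid_time_domain_def)
  show "0 \<le> t" if "(t, j) \<in> insert (T, Suc J) E" for t j
    using that nonneg[of t j] nonneg[OF T] by auto
  obtain ts where ts: "ts 0 = (0::real)" "\<forall>i\<le>J. ts i \<le> ts (Suc i)" "ts (Suc J) = T"
    "\<And>r i. i \<le> J \<Longrightarrow> (r, i) \<in> E \<and> 0 \<le> r \<and> r \<le> T \<longleftrightarrow> ts i \<le> r \<and> r \<le> ts (Suc i)"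
    by (rule hybrid_time_domain_at_iff[OF E T]) blast
  fix t j assume tj: "(t, j) \<in> insert (T, Suc J) E"
  show "\<exists>ts. ts 0 = (0::real) \<and> (\<forall>i\<le>j. ts i \<le> ts (Suc i)) \<and>
      (\<forall>r i. i \<le> j \<longrightarrow> ((r, i) \<in> insert (T, Suc J) E \<and> 0 \<le> r \<and> r \<le> t \<longleftrightarrow> ts i \<le> r \<and> r \<le> ts (Suc i)))"
  proof (cases "(t, j) \<in> E")
    case True
    obtain us where us: "us 0 = (0::real)" "\<forall>i\<le>j. us i \<le> us (Suc i)" "us (Suc j) = t"
      "\<And>r i. i \<le> j \<Longrightarrow> (r, i) \<in> E \<and> 0 \<le> r \<and> r \<le> t \<longleftrightarrow> us i \<le> r \<and> r \<le> us (Suc i)"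
      by (rule hybrid_time_domain_at_iff[OF E True]) blast
    have "(r, i) \<in> insert (T, Suc J) E \<longleftrightarrow> (r, i) \<in> E" if "i \<le> j" for r i
      using that top[OF True] by auto
    then have "(r, i) \<in> insert (T, Suc J) E \<and> 0 \<le> r \<and> r \<le> t \<longleftrightarrow> us i \<le> r \<and> r \<le> us (Suc i)"
      if "i \<le> j" for r i
      using us(4)[OF that, of r] that by blast
    then show ?thesis by (intro exI[of _ us] conjI allI impI us(1) us(2))
  next
    case False
    then have tj: "t = T" "j = Suc J" using tj by auto
    define us where "us = ts(Suc (Suc J) := T)"
    have us: "us i = ts i" if "i \<le> Suc J" for i using that by (simp add: us_def)
    have usJ: "us (Suc (Suc J)) = T" by (simp add: us_def)
    have "us i \<le> us (Suc i)" if "i \<le> Suc J" for i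
      using that us[of i] us[of "Suc i"] usJ ts(2,3) by (cases "i = Suc J") auto
    moreover have "(r, i) \<in> insert (T, Suc J) E \<and> 0 \<le> r \<and> r \<le> T \<longleftrightarrow> us i \<le> r \<and> r \<le> us (Suc i)"
      if i: "i \<le> Suc J" for r i
    proof (cases "i = Suc J")
      case True
      have "(r, Suc J) \<notin> E" using top[of r "Suc J"] by auto
      then show ?thesis using True us[of "Suc J"] usJ ts(3) nonneg[OF T] by auto
    next
      case False
      then have "i \<le> J" using i by simp
      then show ?thesis using us[of i] us[of "Suc i"] ts(4)[of i r] False by auto
    qed
    ultimately show ?thesis
      using ts(1) us[of 0] tj by (intro exI[of _ us]) auto
  qed
qed

section \<open>Local existence for ordinary differential equations\<close>

text \<open>Picard iteration as a contraction on bounded continuous functions on the whole line, where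
  the integral is frozen outside \<open>{a..b}\<close> by the clamping \<open>p\<close>.\<close>

lemma picard_local:
  fixes \<Phi> :: "real \<Rightarrow> 'a::banach \<Rightarrow> 'a"
  assumes ab: "a \<le> b" and \<Lambda>: "0 \<le> \<Lambda>" "\<Lambda> * (b - a) < 1"
    and lip: "\<And>t x y. t \<in> {a..b} \<Longrightarrow> norm (\<Phi> t x - \<Phi> t y) \<le> \<Lambda> * norm (x - y)"
    and cont: "\<And>w. continuous_on {a..b} w \<Longrightarrow> continuous_on {a..b} (\<lambda>t. \<Phi> t (w t))"
  obtains y where "y a = y0"
    "\<And>t. t \<in> {a..b} \<Longrightarrow> (y has_vector_derivative \<Phi> t (y t)) (at t within {a..b})"
proof -
  define p where "p t = max a (min b t)" for t
  have p: "p t \<in> {a..b}" for t using ab by (auto simp: p_def)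
  define q where "q w t = y0 + integral {a..t} (\<lambda>s. \<Phi> s (apply_bcontfun w s))" for w t
  have cw: "continuous_on {a..b} (\<lambda>s. \<Phi> s (apply_bcontfun w s))" for w
    by (intro cont continuous_on_apply_bcontfun)
  have cq: "continuous_on {a..b} (q w)" for w
    unfolding q_def by (intro continuous_intros indefinite_integral_continuous_1 integrable_continuous_real cw)
  have qb: "(\<lambda>t. q w (p t)) \<in> bcontfun" for w
  proof -
    have "continuous_on UNIV p" unfolding p_def by (intro continuous_intros)
    then have "continuous_on UNIV (\<lambda>t. q w (p t))"
      using p by (intro continuous_on_compose2[OF cq]) auto
    moreover have "bounded (range (\<lambda>t. q w (p t)))"
    proof (rule bounded_subset)
      show "bounded (q w ` {a..b})"
        by (intro compact_imp_bounded compact_continuous_image cq) auto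
    qed (use p in auto)
    ultimately show ?thesis by (simp add: bcontfun_def)
  qed
  define P where "P w = Bcontfun (\<lambda>t. q w (p t))" for w
  have P: "apply_bcontfun (P w) t = q w (p t)" for w t
    unfolding P_def using Bcontfun_inverse[OF qb] by simp
  have "dist (P w) (P w') \<le> (\<Lambda> * (b - a)) * dist w w'" for w w'
  proof (rule dist_bound)
    fix t
    have "q w (p t) - q w' (p t) = integral {a..p t} (\<lambda>s. \<Phi> s (apply_bcontfun w s) - \<Phi> s (apply_bcontfun w' s))"
      unfolding q_def using p[of t]
      by (subst integral_diff) (auto intro!: integrable_continuous_real continuous_on_subset[OF cw])
    also have "norm \<dots> \<le> (\<Lambda> * dist w w') * (p t - a)"
    proof (rule integral_bound)
      show "a \<le> p t" using p[of t] by simp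
      show "continuous_on {a..p t} (\<lambda>s. \<Phi> s (apply_bcontfun w s) - \<Phi> s (apply_bcontfun w' s))"
        using p[of t] by (intro continuous_on_diff continuous_on_subset[OF cw]) auto
      fix s assume s: "s \<in> {a..p t}"
      then have "norm (\<Phi> s (apply_bcontfun w s) - \<Phi> s (apply_bcontfun w' s))
          \<le> \<Lambda> * norm (apply_bcontfun w s - apply_bcontfun w' s)"
        using p[of t] by (intro lip) auto
      also have "\<dots> \<le> \<Lambda> * dist w w'"
        using dist_bounded[of w s w'] \<Lambda> by (intro mult_left_mono) (auto simp: dist_norm)
      finally show "norm (\<Phi> s (apply_bcontfun w s) - \<Phi> s (apply_bcontfun w' s)) \<le> \<Lambda> * dist w w'" .
    qed
    also have "\<dots> \<le> (\<Lambda> * dist w w') * (b - a)"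
      using p[of t] \<Lambda> by (intro mult_left_mono) auto
    finally show "dist (apply_bcontfun (P w) t) (apply_bcontfun (P w') t) \<le> (\<Lambda> * (b - a)) * dist w w'"
      by (simp add: P dist_norm mult_ac)
  qed
  then have "\<exists>!w. P w = w"
    using \<Lambda> ab by (intro banach_fix_type) auto
  then obtain w where w: "P w = w" by blast
  have wq: "apply_bcontfun w t = q w t" if "t \<in> {a..b}" for t
    using P[of w t] that unfolding w by (auto simp: p_def max_def min_def)
  show thesis
  proof (rule that)
    show "apply_bcontfun w a = y0" using wq[of a] ab by (simp add: q_def)
    fix t assume t: "t \<in> {a..b}"
    have "(q w has_vector_derivative \<Phi> t (apply_bcontfun w t)) (at t within {a..b})"
      unfolding q_def
      using has_vector_derivative_add[OF has_vector_derivative_const integral_has_vector_derivative[OF cw t]]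
      by simp
    then show "(apply_bcontfun w has_vector_derivative \<Phi> t (apply_bcontfun w t)) (at t within {a..b})"
      using has_vector_derivative_transform[where g = "apply_bcontfun w", OF t wq] by blast
  qed
qed

section \<open>Solutions on a flow interval\<close>

lemma tv_flow_ac:
  assumes "tv_hybrid_solution F C G D E z" "{s..t} \<subseteq> time_slice E j"
  shows "absolutely_continuous_Icc s t (\<lambda>r. z r j)"
  using assms by (simp add: tv_hybrid_solution_def locally_absolutely_continuous_on_def)

lemma tv_flow_in:
  assumes "tv_hybrid_solution F C G D E z" "{s..t} \<subseteq> time_slice E j" "r \<in> {s<..<t}"
  shows "z r j \<in> C r"
proof -
  have "{s<..<t} \<subseteq> interior (time_slice E j)"
    using assms(2) by (intro interior_maximal) auto
  then show ?thesis using assms(1,3) by (auto simp: tv_hybrid_solution_def)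
qed

lemma tv_flow_deriv:
  assumes "tv_hybrid_solution F C G D E z" "{s..t} \<subseteq> time_slice E j"
  obtains N where "negligible N" "\<And>r. r \<in> {s..t} - N \<Longrightarrow>
    ((\<lambda>r. z r j) has_vector_derivative F r (z r j)) (at r within {s..t})"
proof -
  have "AE r in lebesgue. r \<in> time_slice E j \<longrightarrow>
      ((\<lambda>r. z r j) has_vector_derivative F r (z r j)) (at r within time_slice E j)"
    using assms(1) by (simp add: tv_hybrid_solution_def)
  then obtain N where N: "N \<in> null_sets lebesgue" "{r \<in> space lebesgue. \<not> (r \<in> time_slice E j \<longrightarrow>
      ((\<lambda>r. z r j) has_vector_derivative F r (z r j)) (at r within time_slice E j))} \<subseteq> N"
    by (rule AE_E3) auto
  show thesis
  proof (rule that)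
    show "negligible N" using N(1) by (simp add: negligible_iff_null_sets)
    fix r assume "r \<in> {s..t} - N"
    then have "((\<lambda>r. z r j) has_vector_derivative F r (z r j)) (at r within time_slice E j)"
      using N(2) assms(2) by auto
    then show "((\<lambda>r. z r j) has_vector_derivative F r (z r j)) (at r within {s..t})"
      using assms(2) by (rule has_vector_derivative_within_subset)
  qed
qed

section \<open>The objective function\<close>

lemma GDERIV_grad:
  assumes "f differentiable (at x)"
  shows "GDERIV f x :> grad f x"
proof -
  obtain D where D: "(f has_derivative D) (at x)" using assms by (auto simp: differentiable_def)
  define g where "g = adjoint D 1"
  have "linear D" using D has_derivative_linear by blast
  then have "D = (\<lambda>h. inner h g)"
    by (simp add: g_def adjoint_works fun_eq_iff)
  then have "GDERIV f x :> g" using D by (simp add: gderiv_def)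
  moreover have "g' = g" if "GDERIV f x :> g'" for g'
  proof -
    have "(\<lambda>h. inner h g') = (\<lambda>h. inner h g)"
      using that \<open>GDERIV f x :> g\<close> has_derivative_unique unfolding gderiv_def by blast
    then show ?thesis by (simp add: fun_eq_iff vector_eq_ldot)
  qed
  ultimately show ?thesis unfolding grad_def by (rule theI)
qed

locale hand2_data =
  fixes f :: "real ^ 'n::finite \<Rightarrow> real" and xs :: "real ^ 'n" and \<mu> L Tmin Tmax c :: real
  assumes diff: "\<And>x. f differentiable (at x)"
    and cvx: "convex_on UNIV f"
    and min: "\<And>y. f xs \<le> f y"
    and mu: "\<mu> > 0"
    and scvx: "strongly_convex \<mu> f"
    and lip: "L-lipschitz_on UNIV (grad f)"
    and Tmin: "0 < Tmin"
    and Tmax: "Tmin < Tmax"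
    and c: "c > 0"
    and gap: "Tmax\<^sup>2 - Tmin\<^sup>2 > 1 / (\<mu> * c)"
begin

lemma L: "0 \<le> L" using lip by (rule lipschitz_on_nonneg)

lemma gder: "(f has_derivative (\<lambda>h. inner (grad f x) h)) (at x)"
  using GDERIV_grad[OF diff] by (simp add: gderiv_def inner_commute)

lemma along_line:
  "((\<lambda>s::real. f (x + s *\<^sub>R y)) has_real_derivative inner (grad f x) y) (at 0)"
proof -
  have "((\<lambda>s::real. f (x + s *\<^sub>R y)) has_derivative (\<lambda>s. inner (grad f x) (s *\<^sub>R y))) (at 0)"
    by (rule has_derivative_compose[of "\<lambda>s. x + s *\<^sub>R y" "\<lambda>s. s *\<^sub>R y" 0 UNIV f, simplified])
      (auto intro!: derivative_eq_intros gder)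
  then show ?thesis by (simp add: has_field_derivative_def mult_commute_abs)
qed

lemma grad_ineq: "f x + inner (grad f x) (y - x) \<le> f y"
proof -
  have "((\<lambda>s. (f (x + s *\<^sub>R (y - x)) - f x) / s) \<longlongrightarrow> inner (grad f x) (y - x)) (at 0)"
    using along_line[of x "y - x"] by (simp add: has_field_derivative_iff)
  then have "((\<lambda>s. (f (x + s *\<^sub>R (y - x)) - f x) / s) \<longlongrightarrow> inner (grad f x) (y - x)) (at_right 0)"
    by (rule filterlim_mono) (auto simp: at_le)
  moreover have "\<forall>\<^sub>F s in at_right 0. (f (x + s *\<^sub>R (y - x)) - f x) / s \<le> f y - f x"
  proof (rule eventually_at_rightI[of 0 1])
    fix s :: real assume s: "s \<in> {0<..<1}"
    then have "f ((1 - s) *\<^sub>R x + s *\<^sub>R y) \<le> (1 - s) * f x + s * f y"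
      using convex_onD[OF cvx, of s x y] by simp
    moreover have "(1 - s) *\<^sub>R x + s *\<^sub>R y = x + s *\<^sub>R (y - x)" by (simp add: algebra_simps)
    ultimately have "f (x + s *\<^sub>R (y - x)) - f x \<le> (f y - f x) * s" by (simp add: algebra_simps)
    then show "(f (x + s *\<^sub>R (y - x)) - f x) / s \<le> f y - f x"
      using s by (subst pos_divide_le_eq) auto
  qed simp
  ultimately have "inner (grad f x) (y - x) \<le> f y - f x"
    by (intro tendsto_upperbound) auto
  then show ?thesis by simp
qed

text \<open>Strong convexity on the segment from \<open>xs\<close> to \<open>x\<close>, divided by the parameter, which then tends
  to \<open>0\<close>.\<close>

lemma quad_growth: "\<mu> / 2 * (norm (x - xs))\<^sup>2 \<le> f x - f xs"
proof -
  have "((\<lambda>s. \<mu> / 2 * (1 - s) * (norm (x - xs))\<^sup>2) \<longlongrightarrow> \<mu> / 2 * (1 - 0) * (norm (x - xs))\<^sup>2) (at_right 0)"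
    by (intro tendsto_intros)
  moreover have "\<forall>\<^sub>F s in at_right 0. \<mu> / 2 * (1 - s) * (norm (x - xs))\<^sup>2 \<le> f x - f xs"
  proof (rule eventually_at_rightI[of 0 1])
    fix s :: real assume s: "s \<in> {0<..<1}"
    have "f xs \<le> f ((1 - s) *\<^sub>R xs + s *\<^sub>R x)" by (rule min)
    also have "\<dots> \<le> (1 - s) * f xs + s * f x - \<mu> / 2 * s * (1 - s) * (norm (xs - x))\<^sup>2"
      using scvx s by (simp add: strongly_convex_def)
    finally have "s * (\<mu> / 2 * (1 - s) * (norm (x - xs))\<^sup>2) \<le> s * (f x - f xs)"
      by (simp add: algebra_simps norm_minus_commute)
    then show "\<mu> / 2 * (1 - s) * (norm (x - xs))\<^sup>2 \<le> f x - f xs" using s by simp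
  qed simp
  ultimately have "\<mu> / 2 * (1 - 0) * (norm (x - xs))\<^sup>2 \<le> f x - f xs"
    by (rule tendsto_upperbound) simp
  then show ?thesis by simp
qed

lemma grad_xs: "grad f xs = 0"
proof -
  have "(\<lambda>h. inner (grad f xs) h) = (\<lambda>h. 0)"
    using differential_zero_maxmin[OF _ open_UNIV gder, of xs] min by auto
  then have "inner (grad f xs) (grad f xs) = 0" by meson
  then show ?thesis by simp
qed

lemma grad_diff: "norm (grad f x - grad f y) \<le> L * norm (x - y)"
  using lipschitz_onD[OF lip, of x y] by (simp add: dist_norm)

lemma grad_bound: "norm (grad f x) \<le> L * norm (x - xs)"
  using grad_diff[of x xs] by (simp add: grad_xs)

text \<open>The constant \<open>L\<close> instead of \<open>L / 2\<close> suffices and avoids integrating the gradient.\<close>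

lemma f_upper: "f x - f xs \<le> L * (norm (x - xs))\<^sup>2"
proof -
  have "f x - f xs \<le> inner (grad f x) (x - xs)"
    using grad_ineq[of x xs] by (simp add: algebra_simps)
  also have "\<dots> \<le> norm (grad f x) * norm (x - xs)" by (rule norm_cauchy_schwarz)
  also have "\<dots> \<le> L * norm (x - xs) * norm (x - xs)" by (intro mult_right_mono grad_bound) auto
  finally show ?thesis by (simp add: power2_eq_square)
qed

lemma f_step: "f (x + y) \<le> f x + L * (norm (x - xs) + norm y) * norm y"
proof -
  have "f (x + y) - f x \<le> inner (grad f (x + y)) y"
    using grad_ineq[of "x + y" x] by (simp add: algebra_simps)
  also have "\<dots> \<le> norm (grad f (x + y)) * norm y" by (rule norm_cauchy_schwarz)
  also have "\<dots> \<le> L * norm (x + y - xs) * norm y" by (intro mult_right_mono grad_bound) auto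
  also have "\<dots> \<le> L * (norm (x - xs) + norm y) * norm y"
    using norm_triangle_ineq[of "x - xs" y] L
    by (intro mult_right_mono mult_left_mono) (auto simp: algebra_simps)
  finally show ?thesis by simp
qed

lemma f_lip:
  assumes "norm (x - xs) \<le> R" "norm (y - xs) \<le> R"
  shows "\<bar>f x - f y\<bar> \<le> L * R * norm (x - y)"
proof -
  have *: "f x - f y \<le> L * R * norm (x - y)" if "norm (x - xs) \<le> R" for x y
  proof -
    have "f x - f y \<le> inner (grad f x) (x - y)"
      using grad_ineq[of x y] by (simp add: algebra_simps)
    also have "\<dots> \<le> norm (grad f x) * norm (x - y)" by (rule norm_cauchy_schwarz)
    also have "\<dots> \<le> L * R * norm (x - y)"
      using grad_bound[of x] that L by (intro mult_right_mono) (auto intro: order_trans mult_left_mono)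
    finally show ?thesis .
  qed
  show ?thesis using *[of x y] *[of y x] assms by (auto simp: abs_le_iff norm_minus_commute)
qed

section \<open>The Lyapunov function\<close>

definition W :: "'n hand_state \<Rightarrow> real" where
  "W z = (norm (fst (snd z) - xs))\<^sup>2 / 2 + c * (snd (snd z))\<^sup>2 * (f (fst z) - f xs)"

lemma W_eq: "W (x1, x2, \<tau>) = (norm (x2 - xs))\<^sup>2 / 2 + c * \<tau>\<^sup>2 * (f x1 - f xs)"
  by (simp add: W_def)

lemma W_nonneg: "0 \<le> W z"
  using c min by (auto simp: W_def)

text \<open>For the perturbation sizes considered below, the timer and its perturbed value stay in
  \<open>{T0..T1}\<close>.\<close>

definition T0 :: real where "T0 = Tmin / 2"
definition T1 :: real where "T1 = Tmin + Tmax"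

lemma T01: "0 < T0" "T0 < Tmin" "Tmax < T1" "T0 \<le> T1" "0 < T1"
  using Tmin Tmax by (auto simp: T0_def T1_def)

definition Klow :: real where "Klow = 2 + 2 / (c * T0\<^sup>2 * \<mu>)"

lemma Klow: "Klow > 0" using c mu T01 by (auto simp: Klow_def intro!: add_pos_pos)

lemma W_lower:
  assumes "T0 \<le> \<tau>"
  shows "(norm (x1 - xs))\<^sup>2 + (norm (x2 - xs))\<^sup>2 \<le> Klow * W (x1, x2, \<tau>)"
proof -
  have p: "c * T0\<^sup>2 * \<mu> > 0" using c mu T01 by simp
  have t: "T0\<^sup>2 \<le> \<tau>\<^sup>2" using assms T01 by (intro power_mono) auto
  have "c * T0\<^sup>2 * \<mu> / 2 * (norm (x1 - xs))\<^sup>2 = c * T0\<^sup>2 * (\<mu> / 2 * (norm (x1 - xs))\<^sup>2)" by simp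
  also have "\<dots> \<le> c * \<tau>\<^sup>2 * (f x1 - f xs)"
    using t c mu min by (intro mult_mono quad_growth) auto
  also have "\<dots> \<le> W (x1, x2, \<tau>)" by (simp add: W_eq)
  finally have 1: "(norm (x1 - xs))\<^sup>2 \<le> 2 / (c * T0\<^sup>2 * \<mu>) * W (x1, x2, \<tau>)"
    using p by (simp add: field_simps)
  have 2: "(norm (x2 - xs))\<^sup>2 \<le> 2 * W (x1, x2, \<tau>)" using c min by (simp add: W_eq)
  show ?thesis using 1 2 unfolding Klow_def by (simp add: algebra_simps)
qed

definition Kup :: real where "Kup = 1 + c * T1\<^sup>2 * L"

lemma Kup: "Kup > 0" using c L T01 by (auto simp: Kup_def intro!: add_pos_nonneg)

lemma W_upper:
  assumes "0 \<le> \<tau>" "\<tau> \<le> T1"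
  shows "W (x1, x2, \<tau>) \<le> Kup * ((norm (x1 - xs))\<^sup>2 + (norm (x2 - xs))\<^sup>2)"
proof -
  have "c * \<tau>\<^sup>2 * (f x1 - f xs) \<le> c * T1\<^sup>2 * (L * (norm (x1 - xs))\<^sup>2)"
    using assms c min f_upper by (intro mult_mono power_mono) auto
  then have "W (x1, x2, \<tau>) \<le> (norm (x2 - xs))\<^sup>2 / 2 + c * T1\<^sup>2 * L * (norm (x1 - xs))\<^sup>2"
    by (simp add: W_eq)
  also have "\<dots> \<le> Kup * ((norm (x1 - xs))\<^sup>2 + (norm (x2 - xs))\<^sup>2)"
    using c L unfolding Kup_def by (simp add: algebra_simps add_nonneg_nonneg)
  finally show ?thesis .
qed

text \<open>The monomials that occur in the error terms, all dominated by \<open>1 + W\<close>.\<close>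

lemma absorb:
  obtains K where "K \<ge> 0" "\<And>x1 x2 \<tau>. T0 \<le> \<tau> \<Longrightarrow>
    1 + norm (x1 - xs) + norm (x2 - xs) + (norm (x1 - xs))\<^sup>2 + (norm (x2 - xs))\<^sup>2 +
      norm (x1 - xs) * norm (x2 - xs)
    \<le> K * (1 + W (x1, x2, \<tau>))"
proof
  show "0 \<le> 3 + 3 * Klow" using Klow by simp
  fix x1 x2 \<tau> assume t: "T0 \<le> \<tau>"
  define u v where "u = norm (x1 - xs)" and "v = norm (x2 - xs)"
  have "u \<le> 1 + u\<^sup>2" "v \<le> 1 + v\<^sup>2" "u * v \<le> u\<^sup>2 + v\<^sup>2"
    using le_one_plus_square[of u] le_one_plus_square[of v] sum_squares_bound[of u v]
    by (auto simp: u_def v_def intro: order_trans[rotated])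
  moreover have "u\<^sup>2 + v\<^sup>2 \<le> Klow * W (x1, x2, \<tau>)" unfolding u_def v_def using t by (rule W_lower)
  moreover have "W (x1, x2, \<tau>) \<ge> 0" by (rule W_nonneg)
  ultimately have "1 + u + v + u\<^sup>2 + v\<^sup>2 + u * v \<le> (3 + 3 * Klow) * (1 + W (x1, x2, \<tau>))"
    using Klow by (simp add: algebra_simps)
  then show "1 + norm (x1 - xs) + norm (x2 - xs) + (norm (x1 - xs))\<^sup>2 + (norm (x2 - xs))\<^sup>2 +
      norm (x1 - xs) * norm (x2 - xs) \<le> (3 + 3 * Klow) * (1 + W (x1, x2, \<tau>))"
    by (simp add: u_def v_def)
qed

text \<open>The left-hand side is the derivative of \<open>W\<close> along the perturbed flow: \<open>b\<close> is the perturbation of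
  the point at which the gradient is evaluated, \<open>p\<close> that of \<open>x2 - x1\<close>, \<open>\<sigma>\<close> the perturbed timer, and
  the \<open>q\<close> are added to the flow map. It is split into the nominal derivative, which is nonpositive, and
  errors \<open>d1\<close>, \<open>d2\<close> of order \<open>\<epsilon>\<close>.\<close>

lemma flow_rate:
  obtains K where "K \<ge> 0"
    "\<And>x1 x2 \<tau> \<sigma> p b q1 q2 q3 \<epsilon>. \<lbrakk> 0 \<le> \<epsilon>; \<tau> \<in> {T0..T1}; \<sigma> \<in> {T0..T1}; \<bar>\<sigma> - \<tau>\<bar> \<le> \<epsilon>;
       norm p \<le> 2 * \<epsilon>; norm b \<le> \<epsilon>; norm q1 \<le> \<epsilon>; norm q2 \<le> \<epsilon>; \<bar>q3\<bar> \<le> \<epsilon> \<rbrakk> \<Longrightarrow>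
      inner (x2 - xs) ((- 2 * c * \<sigma>) *\<^sub>R grad f (x1 + b) + q2) + 2 * c * \<tau> * (1 + q3) * (f x1 - f xs)
        + c * \<tau>\<^sup>2 * inner (grad f x1) ((2 / \<sigma>) *\<^sub>R (x2 - x1 + p) + q1)
      \<le> K * \<epsilon> * (1 + W (x1, x2, \<tau>))"
proof -
  obtain Ka where Ka: "Ka \<ge> 0" "\<And>x1 x2 \<tau>. T0 \<le> \<tau> \<Longrightarrow>
    1 + norm (x1 - xs) + norm (x2 - xs) + (norm (x1 - xs))\<^sup>2 + (norm (x2 - xs))\<^sup>2 +
      norm (x1 - xs) * norm (x2 - xs) \<le> Ka * (1 + W (x1, x2, \<tau>))"
    using absorb by blast
  define A where "A = 2 * c * L + 2 * c * T1 * L + 1 + 2 * c * T1 * L + c * T1\<^sup>2 * L * (2 / T0\<^sup>2 + 2 / T0 * 2 + 1)"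
  have A: "A \<ge> 0" unfolding A_def using c L T01 by (auto intro!: add_nonneg_nonneg mult_nonneg_nonneg)
  show thesis
  proof (rule that[of "A * Ka"])
    show "0 \<le> A * Ka" using A Ka by simp
    fix x1 x2 p b q1 q2 :: "real ^ 'n" and \<tau> \<sigma> q3 \<epsilon> :: real
    assume e: "0 \<le> \<epsilon>" and \<tau>: "\<tau> \<in> {T0..T1}" and \<sigma>: "\<sigma> \<in> {T0..T1}" and \<sigma>\<tau>: "\<bar>\<sigma> - \<tau>\<bar> \<le> \<epsilon>"
      and p: "norm p \<le> 2 * \<epsilon>" and b: "norm b \<le> \<epsilon>" and q1: "norm q1 \<le> \<epsilon>" and q2: "norm q2 \<le> \<epsilon>"
      and q3: "\<bar>q3\<bar> \<le> \<epsilon>"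
    define u v where "u = norm (x1 - xs)" and "v = norm (x2 - xs)"
    have u: "0 \<le> u" and v: "0 \<le> v" by (auto simp: u_def v_def)
    define \<phi> where "\<phi> = f x1 - f xs"
    define g where "g = grad f x1"
    have g: "norm g \<le> L * u" unfolding g_def u_def by (rule grad_bound)
    have pos: "0 < \<tau>" "0 < \<sigma>" using \<tau> \<sigma> T01 by auto
    have phi: "0 \<le> \<phi>" "\<phi> \<le> L * u\<^sup>2" "\<phi> \<le> inner g (x1 - xs)"
      using min f_upper[of x1] grad_ineq[of x1 xs] by (auto simp: \<phi>_def u_def g_def algebra_simps)
    define d2 where "d2 = (- 2 * c) *\<^sub>R (\<sigma> *\<^sub>R grad f (x1 + b) - \<tau> *\<^sub>R g) + q2"
    define d1 where "d1 = (2 / \<sigma> - 2 / \<tau>) *\<^sub>R (x2 - x1) + (2 / \<sigma>) *\<^sub>R p + q1"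
    have eq: "inner (x2 - xs) ((- 2 * c * \<sigma>) *\<^sub>R grad f (x1 + b) + q2) + 2 * c * \<tau> * (1 + q3) * \<phi>
        + c * \<tau>\<^sup>2 * inner g ((2 / \<sigma>) *\<^sub>R (x2 - x1 + p) + q1)
       = 2 * c * \<tau> * (\<phi> - inner g (x1 - xs)) + inner (x2 - xs) d2 + 2 * c * \<tau> * q3 * \<phi> + c * \<tau>\<^sup>2 * inner g d1"
    proof -
      have e1: "(- 2 * c * \<sigma>) *\<^sub>R grad f (x1 + b) + q2 = (- 2 * c * \<tau>) *\<^sub>R g + d2"
        by (simp add: d2_def algebra_simps)
      have e2: "(2 / \<sigma>) *\<^sub>R (x2 - x1 + p) + q1 = (2 / \<tau>) *\<^sub>R ((x2 - xs) - (x1 - xs)) + d1"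
        by (simp add: d1_def algebra_simps)
      have "c * \<tau>\<^sup>2 * (2 / \<tau>) = 2 * c * \<tau>" using pos by (simp add: power2_eq_square)
      then have e3: "c * \<tau>\<^sup>2 * inner g ((2 / \<tau>) *\<^sub>R ((x2 - xs) - (x1 - xs)) + d1)
          = 2 * c * \<tau> * (inner g (x2 - xs) - inner g (x1 - xs)) + c * \<tau>\<^sup>2 * inner g d1"
        unfolding inner_add_right inner_scaleR_right inner_diff_right[of g "x2 - xs" "x1 - xs"] distrib_left
        by (simp only: mult.assoc[symmetric])
      show ?thesis unfolding e1 e2 e3
        by (simp add: inner_add_right inner_commute[of g] algebra_simps)
    qed
    have 0: "2 * c * \<tau> * (\<phi> - inner g (x1 - xs)) \<le> 0"
      using phi pos c by (intro mult_nonneg_nonpos) auto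
    have 1: "inner (x2 - xs) d2 \<le> \<epsilon> * (2 * c * L * (u * v) + 2 * c * T1 * L * v + v)"
    proof -
      have "norm (\<sigma> *\<^sub>R grad f (x1 + b) - \<tau> *\<^sub>R g) = norm ((\<sigma> - \<tau>) *\<^sub>R g + \<sigma> *\<^sub>R (grad f (x1 + b) - g))"
        by (simp add: algebra_simps)
      also have "\<dots> \<le> \<bar>\<sigma> - \<tau>\<bar> * norm g + \<sigma> * norm (grad f (x1 + b) - g)"
        using norm_triangle_ineq[of "(\<sigma> - \<tau>) *\<^sub>R g" "\<sigma> *\<^sub>R (grad f (x1 + b) - g)"] pos by simp
      also have "\<dots> \<le> \<epsilon> * (L * u) + T1 * (L * \<epsilon>)"
      proof (intro add_mono mult_mono)
        show "norm (grad f (x1 + b) - g) \<le> L * \<epsilon>"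
          using grad_diff[of "x1 + b" x1] mult_left_mono[OF b L] by (simp add: g_def)
      qed (use \<sigma>\<tau> g e \<sigma> T01 in auto)
      finally have "norm d2 \<le> 2 * c * (\<epsilon> * (L * u) + T1 * (L * \<epsilon>)) + \<epsilon>"
        unfolding d2_def using c q2
        by (intro order_trans[OF norm_triangle_ineq] add_mono) (auto simp: mult_left_mono)
      then have "v * norm d2 \<le> v * (2 * c * (\<epsilon> * (L * u) + T1 * (L * \<epsilon>)) + \<epsilon>)"
        using v by (intro mult_left_mono)
      moreover have "inner (x2 - xs) d2 \<le> v * norm d2" unfolding v_def by (rule norm_cauchy_schwarz)
      ultimately show ?thesis by (simp add: algebra_simps)
    qed
    have 2: "2 * c * \<tau> * q3 * \<phi> \<le> \<epsilon> * (2 * c * T1 * L * u\<^sup>2)"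
    proof -
      have "2 * c * \<tau> * q3 * \<phi> \<le> 2 * c * T1 * \<epsilon> * (L * u\<^sup>2)"
      proof (rule mult_mono)
        have "\<tau> * q3 \<le> T1 * \<epsilon>"
          using order_trans[OF mult_left_mono[of q3 \<epsilon> \<tau>] mult_right_mono[of \<tau> T1 \<epsilon>]] \<tau> q3 pos e by simp
        then show "2 * c * \<tau> * q3 \<le> 2 * c * T1 * \<epsilon>" using c by (simp add: mult.assoc)
      qed (use phi c T01 e in auto)
      then show ?thesis by (simp add: algebra_simps)
    qed
    have 3: "c * \<tau>\<^sup>2 * inner g d1 \<le> \<epsilon> * (c * T1\<^sup>2 * L * (2 / T0\<^sup>2 * (u\<^sup>2 + u * v) + (2 / T0 * 2 + 1) * u))"
    proof -
      have \<sigma>0: "2 / \<sigma> \<le> 2 / T0" using \<sigma> T01 by (intro divide_left_mono) auto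
      have "\<bar>2 / \<sigma> - 2 / \<tau>\<bar> = 2 * \<bar>\<sigma> - \<tau>\<bar> / (\<sigma> * \<tau>)"
        using pos by (cases "\<sigma> \<le> \<tau>") (simp_all add: field_simps abs_if)
      also have "\<dots> \<le> 2 * \<epsilon> / T0\<^sup>2"
      proof (intro frac_le)
        show "T0\<^sup>2 \<le> \<sigma> * \<tau>" unfolding power2_eq_square using \<sigma> \<tau> T01 by (intro mult_mono) auto
      qed (use \<sigma>\<tau> e T01 in auto)
      finally have r: "\<bar>2 / \<sigma> - 2 / \<tau>\<bar> \<le> 2 * \<epsilon> / T0\<^sup>2" .
      have uv: "norm (x2 - x1) \<le> u + v"
        unfolding u_def v_def using norm_triangle_ineq4[of "x2 - xs" "x1 - xs"] by simp
      have "norm d1 \<le> \<bar>2 / \<sigma> - 2 / \<tau>\<bar> * norm (x2 - x1) + (2 / \<sigma>) * norm p + norm q1"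
        unfolding d1_def using pos
        by (intro order_trans[OF norm_triangle_ineq] add_mono order_trans[OF norm_triangle_ineq]) auto
      also have "\<dots> \<le> 2 * \<epsilon> / T0\<^sup>2 * (u + v) + (2 / T0) * (2 * \<epsilon>) + \<epsilon>"
        using r uv \<sigma>0 p q1 e T01 u v by (intro add_mono mult_mono) auto
      finally have n: "norm d1 \<le> 2 * \<epsilon> / T0\<^sup>2 * (u + v) + (2 / T0) * (2 * \<epsilon>) + \<epsilon>" .
      have "inner g d1 \<le> norm g * norm d1" by (rule norm_cauchy_schwarz)
      also have "\<dots> \<le> (L * u) * (2 * \<epsilon> / T0\<^sup>2 * (u + v) + (2 / T0) * (2 * \<epsilon>) + \<epsilon>)"
        using g n L u by (intro mult_mono) auto
      finally have i: "inner g d1 \<le> (L * u) * (2 * \<epsilon> / T0\<^sup>2 * (u + v) + (2 / T0) * (2 * \<epsilon>) + \<epsilon>)" .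
      have nn: "0 \<le> (L * u) * (2 * \<epsilon> / T0\<^sup>2 * (u + v) + (2 / T0) * (2 * \<epsilon>) + \<epsilon>)"
        using L u v e T01 by (auto intro!: mult_nonneg_nonneg add_nonneg_nonneg divide_nonneg_nonneg)
      have "c * \<tau>\<^sup>2 * inner g d1 \<le> c * \<tau>\<^sup>2 * ((L * u) * (2 * \<epsilon> / T0\<^sup>2 * (u + v) + (2 / T0) * (2 * \<epsilon>) + \<epsilon>))"
        using i c by (intro mult_left_mono) auto
      also have "\<dots> \<le> c * T1\<^sup>2 * ((L * u) * (2 * \<epsilon> / T0\<^sup>2 * (u + v) + (2 / T0) * (2 * \<epsilon>) + \<epsilon>))"
        using nn \<tau> pos c by (intro mult_right_mono mult_left_mono power_mono) auto
      also have "\<dots> = \<epsilon> * (c * T1\<^sup>2 * L * (2 / T0\<^sup>2 * (u\<^sup>2 + u * v) + (2 / T0 * 2 + 1) * u))"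
        by (simp add: algebra_simps power2_eq_square)
      finally show ?thesis .
    qed
    define Q where "Q = 1 + u + v + u\<^sup>2 + v\<^sup>2 + u * v"
    have Q: "u * v \<le> Q" "v \<le> Q" "u\<^sup>2 \<le> Q" "u \<le> Q" "u\<^sup>2 + u * v \<le> Q"
      using u v by (auto simp: Q_def add_nonneg_nonneg)
    have "2 * c * L * (u * v) + 2 * c * T1 * L * v + v + 2 * c * T1 * L * u\<^sup>2 +
       c * T1\<^sup>2 * L * (2 / T0\<^sup>2 * (u\<^sup>2 + u * v) + (2 / T0 * 2 + 1) * u)
      \<le> 2 * c * L * Q + 2 * c * T1 * L * Q + Q + 2 * c * T1 * L * Q +
       c * T1\<^sup>2 * L * (2 / T0\<^sup>2 * Q + (2 / T0 * 2 + 1) * Q)"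
      using Q c L T01 by (intro add_mono mult_left_mono) (auto intro!: add_nonneg_nonneg)
    also have "\<dots> = A * Q" by (simp add: A_def algebra_simps)
    also have "\<dots> \<le> A * (Ka * (1 + W (x1, x2, \<tau>)))"
      using Ka(2)[of \<tau> x1 x2] \<tau> A by (intro mult_left_mono) (auto simp: Q_def u_def v_def)
    finally have "\<epsilon> * (2 * c * L * (u * v) + 2 * c * T1 * L * v + v + 2 * c * T1 * L * u\<^sup>2 +
       c * T1\<^sup>2 * L * (2 / T0\<^sup>2 * (u\<^sup>2 + u * v) + (2 / T0 * 2 + 1) * u)) \<le> \<epsilon> * (A * (Ka * (1 + W (x1, x2, \<tau>))))"
      using e by (rule mult_left_mono)
    then have "2 * c * \<tau> * (\<phi> - inner g (x1 - xs)) + inner (x2 - xs) d2 + 2 * c * \<tau> * q3 * \<phi> + c * \<tau>\<^sup>2 * inner g d1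
      \<le> \<epsilon> * (A * (Ka * (1 + W (x1, x2, \<tau>))))"
      using 0 1 2 3 unfolding distrib_left by linarith
    then show "inner (x2 - xs) ((- 2 * c * \<sigma>) *\<^sub>R grad f (x1 + b) + q2) + 2 * c * \<tau> * (1 + q3) * (f x1 - f xs)
        + c * \<tau>\<^sup>2 * inner (grad f x1) ((2 / \<sigma>) *\<^sub>R (x2 - x1 + p) + q1)
      \<le> A * Ka * \<epsilon> * (1 + W (x1, x2, \<tau>))"
      using eq by (simp add: \<phi>_def g_def mult_ac)
  qed
qed

definition k0 :: real where "k0 = (1 / (c * \<mu>) + Tmin\<^sup>2) / Tmax\<^sup>2"

lemma k0: "0 < k0" "k0 < 1"
proof -
  have "1 / (c * \<mu>) > 0" using c mu by simp
  then show "0 < k0" using Tmin Tmax unfolding k0_def by (intro divide_pos_pos add_pos_nonneg) auto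
  show "k0 < 1" using gap Tmin Tmax unfolding k0_def by (simp add: mult.commute)
qed

text \<open>Strong convexity turns the reset of \<open>x2\<close> to \<open>x1\<close> into a term proportional to \<open>f x1 - f xs\<close>; the
  definition of \<open>k0\<close> collects the two coefficients.\<close>

lemma jump_nominal:
  "(norm (x1 - xs))\<^sup>2 / 2 + c * Tmin\<^sup>2 * (f x1 - f xs) \<le> k0 * (c * Tmax\<^sup>2 * (f x1 - f xs))"
proof -
  have "k0 * (c * Tmax\<^sup>2 * (f x1 - f xs)) = (1 / \<mu> + c * Tmin\<^sup>2) * (f x1 - f xs)"
    using Tmin Tmax c mu unfolding k0_def by (simp add: field_simps)
  moreover have "(norm (x1 - xs))\<^sup>2 / 2 \<le> 1 / \<mu> * (f x1 - f xs)"
    using quad_growth[of x1] mu by (simp add: field_simps)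
  ultimately show ?thesis by (simp add: algebra_simps)
qed

definition jump_const :: "real \<Rightarrow> bool" where
  "jump_const K \<longleftrightarrow> 0 \<le> K \<and>
    (\<forall>x1 x2 \<tau> a1 a2 a3 \<epsilon>. 0 \<le> \<epsilon> \<longrightarrow> \<epsilon> \<le> 1 \<longrightarrow> \<epsilon> \<le> T0 \<longrightarrow> \<tau> \<in> {T0..T1} \<longrightarrow> Tmax - \<epsilon> \<le> \<tau> \<longrightarrow>
       norm a1 \<le> 2 * \<epsilon> \<longrightarrow> norm a2 \<le> 2 * \<epsilon> \<longrightarrow> \<bar>a3\<bar> \<le> \<epsilon> \<longrightarrow>
      W (x1 + a1, x1 + a2, Tmin + a3) \<le> k0 * W (x1, x2, \<tau>) + K * \<epsilon> * (1 + W (x1, x2, \<tau>)))"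

lemma jump_const:
  obtains K where "jump_const K"
proof -
  obtain Ka where Ka: "Ka \<ge> 0" "\<And>x1 x2 \<tau>. T0 \<le> \<tau> \<Longrightarrow>
    1 + norm (x1 - xs) + norm (x2 - xs) + (norm (x1 - xs))\<^sup>2 + (norm (x2 - xs))\<^sup>2 +
      norm (x1 - xs) * norm (x2 - xs) \<le> Ka * (1 + W (x1, x2, \<tau>))"
    using absorb by blast
  define A where "A = 4 + c * (2 * Tmin + 1) * L + 6 * c * T1\<^sup>2 * L + 2 * c * T1 * L"
  have A: "A \<ge> 0" unfolding A_def using c L Tmin T01 by (auto intro!: add_nonneg_nonneg mult_nonneg_nonneg)
  show thesis
  proof (rule that[of "A * Ka"])
    show "jump_const (A * Ka)"
      unfolding jump_const_def
    proof (intro conjI allI impI)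
      show "0 \<le> A * Ka" using A Ka by simp
      fix x1 x2 a1 a2 :: "real ^ 'n" and \<tau> a3 \<epsilon> :: real
      assume e: "0 \<le> \<epsilon>" "\<epsilon> \<le> 1" "\<epsilon> \<le> T0" and \<tau>: "\<tau> \<in> {T0..T1}" "Tmax - \<epsilon> \<le> \<tau>"
        and a1: "norm a1 \<le> 2 * \<epsilon>" and a2: "norm a2 \<le> 2 * \<epsilon>" and a3: "\<bar>a3\<bar> \<le> \<epsilon>"
      define u where "u = norm (x1 - xs)"
      have u: "0 \<le> u" by (auto simp: u_def)
      define \<phi> where "\<phi> = f x1 - f xs"
      have phi: "0 \<le> \<phi>" "\<phi> \<le> L * u\<^sup>2" using min f_upper[of x1] by (auto simp: \<phi>_def u_def)
      have ee: "\<epsilon> * \<epsilon> \<le> \<epsilon>" using e mult_left_mono[of \<epsilon> 1 \<epsilon>] by simp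
      have 1: "(norm (x1 + a2 - xs))\<^sup>2 / 2 \<le> u\<^sup>2 / 2 + \<epsilon> * (2 * u + 2)"
      proof -
        have "norm (x1 + a2 - xs) \<le> u + 2 * \<epsilon>"
          using norm_triangle_ineq[of "x1 - xs" a2] a2 by (simp add: u_def algebra_simps)
        then have "(norm (x1 + a2 - xs))\<^sup>2 \<le> (u + 2 * \<epsilon>)\<^sup>2" by (intro power_mono) auto
        then show ?thesis using ee by (simp add: power2_eq_square algebra_simps)
      qed
      have 2: "f (x1 + a1) - f xs \<le> \<phi> + \<epsilon> * (L * (u + 2) * 2)"
      proof -
        have "L * (u + norm a1) * norm a1 \<le> L * (u + 2) * (2 * \<epsilon>)"
          using L u a1 e by (intro mult_mono mult_left_mono) (auto intro!: mult_nonneg_nonneg)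
        then show ?thesis using f_step[of x1 a1] by (simp add: \<phi>_def u_def algebra_simps)
      qed
      have 3: "(Tmin + a3)\<^sup>2 \<le> Tmin\<^sup>2 + \<epsilon> * (2 * Tmin + 1)"
      proof -
        have "0 \<le> Tmin + a3" using a3 e Tmin by (auto simp: T0_def)
        then have "(Tmin + a3)\<^sup>2 \<le> (Tmin + \<epsilon>)\<^sup>2" using a3 by (intro power_mono) auto
        then show ?thesis using ee by (simp add: power2_eq_square algebra_simps)
      qed
      have 4: "(Tmin + a3)\<^sup>2 \<le> T1\<^sup>2"
        using a3 e Tmin Tmax unfolding T0_def T1_def by (intro power_mono) auto
      have 5: "Tmax\<^sup>2 \<le> \<tau>\<^sup>2 + \<epsilon> * (2 * T1)"
      proof (cases "Tmax \<le> \<tau>")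
        case True
        then have "Tmax\<^sup>2 \<le> \<tau>\<^sup>2" using Tmin Tmax by (intro power_mono) auto
        then show ?thesis using e T01 by (smt (verit) mult_nonneg_nonneg)
      next
        case False
        have "Tmax\<^sup>2 - \<tau>\<^sup>2 = (Tmax - \<tau>) * (Tmax + \<tau>)" by (simp add: power2_eq_square algebra_simps)
        also have "\<dots> \<le> \<epsilon> * (2 * T1)" using False \<tau> T01 e by (intro mult_mono) auto
        finally show ?thesis by simp
      qed
      have "W (x1 + a1, x1 + a2, Tmin + a3) = (norm (x1 + a2 - xs))\<^sup>2 / 2 + c * (Tmin + a3)\<^sup>2 * (f (x1 + a1) - f xs)"
        by (simp add: W_eq)
      also have "\<dots> \<le> (u\<^sup>2 / 2 + \<epsilon> * (2 * u + 2)) + c * (Tmin + a3)\<^sup>2 * (\<phi> + \<epsilon> * (L * (u + 2) * 2))"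
        using 1 2 c by (intro add_mono mult_left_mono) auto
      also have "\<dots> = (u\<^sup>2 / 2 + \<epsilon> * (2 * u + 2)) + c * (Tmin + a3)\<^sup>2 * \<phi> + c * (Tmin + a3)\<^sup>2 * (\<epsilon> * (L * (u + 2) * 2))"
        by (simp add: algebra_simps)
      also have "\<dots> \<le> (u\<^sup>2 / 2 + \<epsilon> * (2 * u + 2)) + c * (Tmin\<^sup>2 + \<epsilon> * (2 * Tmin + 1)) * \<phi> + c * T1\<^sup>2 * (\<epsilon> * (L * (u + 2) * 2))"
        using 3 4 c phi L u e by (intro add_mono mult_left_mono mult_right_mono) (auto intro!: mult_nonneg_nonneg)
      also have "\<dots> = (u\<^sup>2 / 2 + c * Tmin\<^sup>2 * \<phi>) + \<epsilon> * (2 * u + 2 + c * (2 * Tmin + 1) * \<phi> + c * T1\<^sup>2 * (L * (u + 2) * 2))"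
        by (simp add: algebra_simps)
      also have "u\<^sup>2 / 2 + c * Tmin\<^sup>2 * \<phi> \<le> k0 * (c * Tmax\<^sup>2 * \<phi>)"
        using jump_nominal[of x1] by (simp add: u_def \<phi>_def)
      also have "k0 * (c * Tmax\<^sup>2 * \<phi>) \<le> k0 * (c * (\<tau>\<^sup>2 + \<epsilon> * (2 * T1)) * \<phi>)"
        using 5 k0 c phi by (intro mult_left_mono mult_right_mono) auto
      also have "\<dots> = k0 * (c * \<tau>\<^sup>2 * \<phi>) + \<epsilon> * (k0 * (2 * c * T1 * \<phi>))"
        by (simp add: algebra_simps)
      also have "\<dots> \<le> k0 * W (x1, x2, \<tau>) + \<epsilon> * (1 * (2 * c * T1 * \<phi>))"
        using k0 c phi T01 e by (intro add_mono mult_left_mono mult_right_mono) (auto simp: W_eq \<phi>_def)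
      finally have 6: "W (x1 + a1, x1 + a2, Tmin + a3) \<le> k0 * W (x1, x2, \<tau>) +
         \<epsilon> * (2 * u + 2 + c * (2 * Tmin + 1) * \<phi> + c * T1\<^sup>2 * (L * (u + 2) * 2) + 2 * c * T1 * \<phi>)"
        by (simp add: algebra_simps)
      define v where "v = norm (x2 - xs)"
      have v: "0 \<le> v" by (simp add: v_def)
      define Q where "Q = 1 + u + v + u\<^sup>2 + v\<^sup>2 + u * v"
      have Q: "2 * u + 2 \<le> 4 * Q" "u + 2 \<le> 3 * Q" "u\<^sup>2 \<le> Q"
        using u v by (auto simp: Q_def add_nonneg_nonneg)
      have \<phi>Q: "\<phi> \<le> L * Q" using phi(2) mult_left_mono[OF Q(3) L] by simp
      have "2 * u + 2 + c * (2 * Tmin + 1) * \<phi> + c * T1\<^sup>2 * (L * (u + 2) * 2) + 2 * c * T1 * \<phi>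
         \<le> 4 * Q + c * (2 * Tmin + 1) * (L * Q) + c * T1\<^sup>2 * (L * (3 * Q) * 2) + 2 * c * T1 * (L * Q)"
        using Q \<phi>Q c L T01 Tmin by (intro add_mono mult_left_mono mult_right_mono) auto
      also have "\<dots> = A * Q" by (simp add: A_def algebra_simps)
      also have "\<dots> \<le> A * (Ka * (1 + W (x1, x2, \<tau>)))"
        using Ka(2)[of \<tau> x1 x2] \<tau> A by (intro mult_left_mono) (auto simp: Q_def u_def v_def)
      finally have "\<epsilon> * (2 * u + 2 + c * (2 * Tmin + 1) * \<phi> + c * T1\<^sup>2 * (L * (u + 2) * 2) + 2 * c * T1 * \<phi>)
          \<le> \<epsilon> * (A * (Ka * (1 + W (x1, x2, \<tau>))))"
        using e(1) by (rule mult_left_mono)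
      then show "W (x1 + a1, x1 + a2, Tmin + a3) \<le> k0 * W (x1, x2, \<tau>) + A * Ka * \<epsilon> * (1 + W (x1, x2, \<tau>))"
        using 6 by (simp add: mult_ac)
    qed
  qed
qed

section \<open>Growth of the Lyapunov function along flows\<close>

lemma W_deriv:
  assumes z: "(z has_vector_derivative (d1, d2, d3)) (at r within S)" and zr: "z r = (x1, x2, \<tau>)"
  shows "((\<lambda>r. W (z r)) has_real_derivative
     inner (x2 - xs) d2 + 2 * c * \<tau> * d3 * (f x1 - f xs) + c * \<tau>\<^sup>2 * inner (grad f x1) d1) (at r within S)"
proof -
  have 1: "((\<lambda>r. fst (z r)) has_derivative (\<lambda>h. h *\<^sub>R d1)) (at r within S)"
    using has_derivative_fst[OF z[unfolded has_vector_derivative_def]] by simp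
  have 2: "((\<lambda>r. fst (snd (z r))) has_derivative (\<lambda>h. h *\<^sub>R d2)) (at r within S)"
    using has_derivative_fst[OF has_derivative_snd[OF z[unfolded has_vector_derivative_def]]] by simp
  have 3: "((\<lambda>r. snd (snd (z r))) has_derivative (\<lambda>h. h *\<^sub>R d3)) (at r within S)"
    using has_derivative_snd[OF has_derivative_snd[OF z[unfolded has_vector_derivative_def]]] by simp
  have 4: "((\<lambda>r. f (fst (z r))) has_derivative (\<lambda>h. inner (grad f x1) (h *\<^sub>R d1))) (at r within S)"
    using has_derivative_compose[OF 1 gder] zr by simp
  have "((\<lambda>r. W (z r)) has_derivative (\<lambda>h. h * (
     inner (x2 - xs) d2 + 2 * c * \<tau> * d3 * (f x1 - f xs) + c * \<tau>\<^sup>2 * inner (grad f x1) d1))) (at r within S)"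
  proof -
    define half :: real where "half = 1 / 2"
    have "W (z r) = half * inner (fst (snd (z r)) - xs) (fst (snd (z r)) - xs)
        + c * (snd (snd (z r)) * snd (snd (z r))) * (f (fst (z r)) - f xs)" for r
      by (simp add: W_def half_def power2_norm_eq_inner power2_eq_square[of "snd (snd (z r))"])
    then show ?thesis
      by (simp only:) (rule 2 3 4 refl derivative_eq_intros | simp add: zr fun_eq_iff inner_commute half_def algebra_simps power2_eq_square)+
  qed
  then show ?thesis unfolding has_field_derivative_def by (simp add: mult_commute_abs)
qed

lemma W_lip:
  assumes "norm (x1 - xs) \<le> R" "norm (x2 - xs) \<le> R" "\<bar>\<tau>\<bar> \<le> R"
    and "norm (y1 - xs) \<le> R" "norm (y2 - xs) \<le> R" "\<bar>\<sigma>\<bar> \<le> R"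
  shows "\<bar>W (x1, x2, \<tau>) - W (y1, y2, \<sigma>)\<bar> \<le> (R + 3 * c * L * R ^ 3) * norm ((x1, x2, \<tau>) - (y1, y2, \<sigma>))"
proof -
  define n where "n = norm ((x1, x2, \<tau>) - (y1, y2, \<sigma>))"
  have R: "0 \<le> R" using assms(1) norm_ge_zero order_trans by blast
  have n1: "norm (x1 - y1) \<le> n" and n23: "norm (x2 - y2, \<tau> - \<sigma>) \<le> n"
    using norm_fst_le[of "x1 - y1" "(x2 - y2, \<tau> - \<sigma>)"] norm_snd_le[of "(x2 - y2, \<tau> - \<sigma>)" "x1 - y1"]
    by (auto simp: n_def)
  have n2: "norm (x2 - y2) \<le> n" and n3: "\<bar>\<tau> - \<sigma>\<bar> \<le> n"
    using norm_fst_le[of "x2 - y2" "\<tau> - \<sigma>"] norm_snd_le[of "\<tau> - \<sigma>" "x2 - y2"] n23 by auto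
  have a: "\<bar>(norm (x2 - xs))\<^sup>2 / 2 - (norm (y2 - xs))\<^sup>2 / 2\<bar> \<le> R * n"
  proof -
    have "\<bar>(norm (x2 - xs))\<^sup>2 - (norm (y2 - xs))\<^sup>2\<bar>
        = (norm (x2 - xs) + norm (y2 - xs)) * \<bar>norm (x2 - xs) - norm (y2 - xs)\<bar>"
      by (simp add: power2_eq_square square_diff_square_factored abs_mult)
    also have "\<dots> \<le> (2 * R) * n"
      using assms R n2 norm_triangle_ineq3[of "x2 - xs" "y2 - xs"] by (intro mult_mono) auto
    finally show ?thesis by simp
  qed
  have b: "\<bar>\<tau>\<^sup>2 * (f x1 - f xs) - \<sigma>\<^sup>2 * (f y1 - f xs)\<bar> \<le> 3 * L * R ^ 3 * n"
  proof -
    have eq: "\<tau>\<^sup>2 * (f x1 - f xs) - \<sigma>\<^sup>2 * (f y1 - f xs) =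
        \<tau>\<^sup>2 * (f x1 - f y1) + (\<tau> + \<sigma>) * (\<tau> - \<sigma>) * (f y1 - f xs)"
      by (simp add: power2_eq_square algebra_simps)
    have "\<bar>f x1 - f y1\<bar> \<le> L * R * norm (x1 - y1)" using assms by (intro f_lip)
    also have "\<dots> \<le> L * R * n" using n1 L R by (intro mult_left_mono) auto
    finally have "\<tau>\<^sup>2 * \<bar>f x1 - f y1\<bar> \<le> R\<^sup>2 * (L * R * n)"
      using assms(3) by (intro mult_mono) (auto simp: abs_le_square_iff[symmetric])
    moreover have "\<bar>\<tau> + \<sigma>\<bar> * \<bar>\<tau> - \<sigma>\<bar> * \<bar>f y1 - f xs\<bar> \<le> (2 * R) * n * (L * R\<^sup>2)"
    proof (intro mult_mono)
      have "f y1 - f xs \<le> L * (norm (y1 - xs))\<^sup>2" by (rule f_upper)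
      also have "\<dots> \<le> L * R\<^sup>2" using assms L by (intro mult_left_mono power_mono) auto
      finally show "\<bar>f y1 - f xs\<bar> \<le> L * R\<^sup>2" using min[of y1] by simp
    qed (use assms n3 R in auto)
    ultimately have "\<tau>\<^sup>2 * \<bar>f x1 - f y1\<bar> + \<bar>\<tau> + \<sigma>\<bar> * \<bar>\<tau> - \<sigma>\<bar> * \<bar>f y1 - f xs\<bar> \<le> 3 * L * R ^ 3 * n"
      by (simp add: power2_eq_square power3_eq_cube algebra_simps)
    then show ?thesis unfolding eq
      by (intro order_trans[OF abs_triangle_ineq]) (simp add: abs_mult)
  qed
  have "\<bar>W (x1, x2, \<tau>) - W (y1, y2, \<sigma>)\<bar> \<le> \<bar>(norm (x2 - xs))\<^sup>2 / 2 - (norm (y2 - xs))\<^sup>2 / 2\<bar>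
      + c * \<bar>\<tau>\<^sup>2 * (f x1 - f xs) - \<sigma>\<^sup>2 * (f y1 - f xs)\<bar>"
  proof -
    have "W (x1, x2, \<tau>) - W (y1, y2, \<sigma>) = ((norm (x2 - xs))\<^sup>2 / 2 - (norm (y2 - xs))\<^sup>2 / 2)
      + c * (\<tau>\<^sup>2 * (f x1 - f xs) - \<sigma>\<^sup>2 * (f y1 - f xs))"
      by (simp add: W_eq algebra_simps)
    then show ?thesis using c by (metis abs_mult abs_of_pos abs_triangle_ineq)
  qed
  also have "\<dots> \<le> R * n + c * (3 * L * R ^ 3 * n)"
    using a b c by (intro add_mono mult_left_mono) auto
  finally show ?thesis by (simp add: n_def algebra_simps)
qed

definition small :: "(nat \<Rightarrow> real \<Rightarrow> 'n hand_state) \<Rightarrow> real \<Rightarrow> bool" where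
  "small e \<epsilon> \<longleftrightarrow> (\<forall>i\<in>{1..6}. \<forall>t\<ge>0. norm (e i t) \<le> \<epsilon>)"

lemma smallD:
  assumes "small e \<epsilon>" "i \<in> {1..6}" "0 \<le> t"
  shows "norm (fst (e i t)) \<le> \<epsilon>" "norm (fst (snd (e i t))) \<le> \<epsilon>" "\<bar>snd (snd (e i t))\<bar> \<le> \<epsilon>"
  using norm_components[of "e i t"] assms unfolding small_def by (auto intro: order_trans)

abbreviation timer :: "'n hand_state \<Rightarrow> real" where "timer z \<equiv> snd (snd z)"

lemma timer_range:
  assumes sol: "hand2_perturbed_solution c f Tmin Tmax e E z" and small: "small e \<epsilon>"
    and st: "0 \<le> s" "{s..t} \<subseteq> time_slice E j"
    and start: "timer (z s j) \<in> {Tmin - \<epsilon>..Tmax + \<epsilon>}" and r: "r \<in> {s..t}"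
  shows "timer (z r j) \<in> {Tmin - \<epsilon>..Tmax + \<epsilon>}"
proof -
  note tv = sol[unfolded hand2_perturbed_solution_def perturbed_hybrid_solution_def]
  have inside: "timer (z r j) \<in> {Tmin - \<epsilon>..Tmax + \<epsilon>}" if "r \<in> {s<..<t}" for r
  proof -
    have "z r j + e 3 r \<in> hand2_C Tmin Tmax" using tv_flow_in[OF tv st(2) that] by simp
    then have "timer (z r j) + timer (e 3 r) \<in> {Tmin..Tmax}"
      by (auto simp: hand2_C_def case_prod_beta)
    then show ?thesis using smallD(3)[OF small, of 3 r] that st(1) by auto
  qed
  show ?thesis
  proof (cases "s < t")
    case True
    have "continuous_on {s..t} (\<lambda>r. timer (z r j))"
      using ac_imp_continuous_on[OF tv_flow_ac[OF tv st(2)]] by (intro continuous_intros)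
    then have "(\<lambda>r. timer (z r j)) ` closure {s<..<t} \<subseteq> {Tmin - \<epsilon>..Tmax + \<epsilon>}"
      using True inside by (intro image_closure_subset) auto
    then show ?thesis using r True by (force simp: image_subset_iff)
  next
    case False
    then show ?thesis using r start by (cases "r = s") auto
  qed
qed

lemma timer_growth:
  assumes sol: "hand2_perturbed_solution c f Tmin Tmax e E z" and small: "small e \<epsilon>"
    and st: "0 \<le> s" "s \<le> t" "{s..t} \<subseteq> time_slice E j" and \<epsilon>: "0 \<le> \<epsilon>" "\<epsilon> \<le> 1"
  shows "(1 - \<epsilon>) * (t - s) \<le> timer (z t j) - timer (z s j)"
proof -
  note tv = sol[unfolded hand2_perturbed_solution_def perturbed_hybrid_solution_def]
  define h where "h r = (1 - \<epsilon>) * r - timer (z r j)" for r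
  obtain N where N: "negligible N" "\<And>r. r \<in> {s..t} - N \<Longrightarrow>
    ((\<lambda>r. z r j) has_vector_derivative hand2_F c f (z r j + e 1 r) + e 2 r) (at r within {s..t})"
    using tv_flow_deriv[OF tv st(3)] by blast
  have "h t \<le> h s"
  proof (rule ac_nonincreasing[OF _ st(2) N(1)])
    show "absolutely_continuous_Icc s t h"
    proof (rule ac_dominated[OF tv_flow_ac[OF tv st(3)], of 1 1])
      fix r r' assume r: "s \<le> r" "r \<le> r'" "r' \<le> t"
      have "norm (h r' - h r) \<le> \<bar>timer (z r' j) - timer (z r j)\<bar> + (1 - \<epsilon>) * (r' - r)"
        using r \<epsilon> mult_left_mono[of r r' "1 - \<epsilon>"] by (simp add: h_def algebra_simps abs_if)
      also have "\<dots> \<le> norm (z r' j - z r j) + 1 * (r' - r)"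
        using norm_components(3)[of "z r' j - z r j"] r \<epsilon>
        by (intro add_mono mult_right_mono) auto
      finally show "norm (h r' - h r) \<le> 1 * norm (z r' j - z r j) + 1 * (r' - r)" by simp
    qed auto
  next
    fix r assume r: "r \<in> {s..t} - N"
    have "((\<lambda>r. timer (z r j)) has_vector_derivative timer (hand2_F c f (z r j + e 1 r) + e 2 r)) (at r within {s..t})"
      using has_derivative_snd[OF has_derivative_snd[OF N(2)[OF r, unfolded has_vector_derivative_def]]]
      by (simp add: has_vector_derivative_def)
    then have "((\<lambda>r. timer (z r j)) has_real_derivative 1 + timer (e 2 r)) (at r within {s..t})"
      by (simp add: has_real_derivative_iff_has_vector_derivative hand2_F_def case_prod_beta)
    then have "(h has_real_derivative (1 - \<epsilon>) - (1 + timer (e 2 r))) (at r within {s..t})"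
      unfolding h_def by (auto intro!: derivative_eq_intros)
    moreover have "(1 - \<epsilon>) - (1 + timer (e 2 r)) \<le> 0"
      using smallD(3)[OF small, of 2 r] r st(1) by auto
    ultimately show "\<exists>D\<le>0. (h has_real_derivative D) (at r within {s..t})" by blast
  qed
  then show ?thesis by (simp add: h_def algebra_simps)
qed

definition flow_const :: "real \<Rightarrow> bool" where
  "flow_const K \<longleftrightarrow> 0 \<le> K \<and>
    (\<forall>e E z \<epsilon> s t j. hand2_perturbed_solution c f Tmin Tmax e E z \<longrightarrow> small e \<epsilon> \<longrightarrow> 0 \<le> \<epsilon> \<longrightarrow> 2 * \<epsilon> \<le> T0 \<longrightarrow>
      0 \<le> s \<longrightarrow> s \<le> t \<longrightarrow> {s..t} \<subseteq> time_slice E j \<longrightarrow> timer (z s j) \<in> {Tmin - \<epsilon>..Tmax + \<epsilon>} \<longrightarrow>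
      1 + W (z t j) \<le> exp (K * \<epsilon> * (t - s)) * (1 + W (z s j)))"

text \<open>Gronwall in the form that \<open>exp (- K \<epsilon> r) (1 + W)\<close> is nonincreasing along a flow.\<close>

lemma flow_const:
  obtains K where "flow_const K"
proof -
  obtain K where K: "K \<ge> 0"
    "\<And>x1 x2 \<tau> \<sigma> p b q1 q2 q3 \<epsilon>. \<lbrakk> 0 \<le> \<epsilon>; \<tau> \<in> {T0..T1}; \<sigma> \<in> {T0..T1}; \<bar>\<sigma> - \<tau>\<bar> \<le> \<epsilon>;
       norm p \<le> 2 * \<epsilon>; norm b \<le> \<epsilon>; norm q1 \<le> \<epsilon>; norm q2 \<le> \<epsilon>; \<bar>q3\<bar> \<le> \<epsilon> \<rbrakk> \<Longrightarrow>
      inner (x2 - xs) ((- 2 * c * \<sigma>) *\<^sub>R grad f (x1 + b) + q2) + 2 * c * \<tau> * (1 + q3) * (f x1 - f xs)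
        + c * \<tau>\<^sup>2 * inner (grad f x1) ((2 / \<sigma>) *\<^sub>R (x2 - x1 + p) + q1)
      \<le> K * \<epsilon> * (1 + W (x1, x2, \<tau>))"
    using flow_rate by blast
  show thesis
  proof (rule that)
    show "flow_const K"
      unfolding flow_const_def
    proof (intro conjI allI impI)
      show "0 \<le> K" by (rule K)
      fix e E z \<epsilon> s t j
      assume sol: "hand2_perturbed_solution c f Tmin Tmax e E z" and small: "small e \<epsilon>"
        and \<epsilon>: "0 \<le> \<epsilon>" "2 * \<epsilon> \<le> T0" and st: "0 \<le> s" "s \<le> t" "{s..t} \<subseteq> time_slice E j"
        and start: "timer (z s j) \<in> {Tmin - \<epsilon>..Tmax + \<epsilon>}"
      note tv = sol[unfolded hand2_perturbed_solution_def perturbed_hybrid_solution_def]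
      note ac = tv_flow_ac[OF tv st(3)]
      define k where "k = K * \<epsilon>"
      have k: "0 \<le> k" using K \<epsilon> by (simp add: k_def)
      define h where "h r = exp (- k * r) * (1 + W (z r j))" for r
      obtain N where N: "negligible N" "\<And>r. r \<in> {s..t} - N \<Longrightarrow>
        ((\<lambda>r. z r j) has_vector_derivative hand2_F c f (z r j + e 1 r) + e 2 r) (at r within {s..t})"
        using tv_flow_deriv[OF tv st(3)] by blast
      have "compact ((\<lambda>r. z r j - (xs, xs, 0)) ` {s..t})"
        using ac_imp_continuous_on[OF ac] by (intro compact_continuous_image continuous_intros) auto
      then obtain R where R: "R > 0" "\<And>r. r \<in> {s..t} \<Longrightarrow> norm (z r j - (xs, xs, 0)) \<le> R"
        using bounded_pos[of "(\<lambda>r. z r j - (xs, xs, 0)) ` {s..t}"] compact_imp_bounded by blast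
      have Rc: "norm (fst (z r j) - xs) \<le> R \<and> norm (fst (snd (z r j)) - xs) \<le> R \<and> \<bar>timer (z r j)\<bar> \<le> R"
        if "r \<in> {s..t}" for r
        using R(2)[OF that] norm_components[of "z r j - (xs, xs, 0)"] by simp
      define A where "A = R + 3 * c * L * R ^ 3"
      have A: "0 \<le> A" using R c L by (simp add: A_def)
      have Wl: "\<bar>W (z r' j) - W (z r j)\<bar> \<le> A * norm (z r' j - z r j)" if "r \<in> {s..t}" "r' \<in> {s..t}" for r r'
        using W_lip[of "fst (z r' j)" R "fst (snd (z r' j))" "timer (z r' j)" "fst (z r j)" "fst (snd (z r j))" "timer (z r j)"]
          Rc[OF that(1)] Rc[OF that(2)] by (simp add: A_def)
      define B where "B = 1 + W (z s j) + A * (2 * R)"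
      have Wb: "1 + W (z r j) \<le> B" if r: "r \<in> {s..t}" for r
      proof -
        have "norm (z r j - z s j) \<le> norm (z r j - (xs, xs, 0)) + norm (z s j - (xs, xs, 0))"
          using norm_triangle_ineq4[of "z r j - (xs, xs, 0)" "z s j - (xs, xs, 0)"] by simp
        also have "\<dots> \<le> 2 * R" using R(2)[of r] R(2)[of s] r st by auto
        finally have "A * norm (z r j - z s j) \<le> A * (2 * R)" using A by (intro mult_left_mono)
        then show ?thesis using Wl[of s r] r st by (auto simp: B_def abs_le_iff)
      qed
      have B: "0 \<le> B" using Wb[of s] st W_nonneg[of "z s j"] by auto
      have "h t \<le> h s"
      proof (rule ac_nonincreasing[OF _ st(2) N(1)])
        show "absolutely_continuous_Icc s t h"
        proof (rule ac_dominated[OF ac A, of "k * B"])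
          show "0 \<le> k * B" using k B by simp
          fix r r' assume r: "s \<le> r" "r \<le> r'" "r' \<le> t"
          have "h r' - h r = exp (- k * r') * (W (z r' j) - W (z r j)) + (exp (- k * r') - exp (- k * r)) * (1 + W (z r j))"
            by (simp add: h_def algebra_simps)
          then have "norm (h r' - h r) \<le> exp (- k * r') * \<bar>W (z r' j) - W (z r j)\<bar> + \<bar>exp (- k * r') - exp (- k * r)\<bar> * \<bar>1 + W (z r j)\<bar>"
            by (metis abs_exp_cancel abs_mult abs_triangle_ineq real_norm_def)
          also have "\<dots> \<le> 1 * (A * norm (z r' j - z r j)) + (k * (r' - r)) * B"
          proof (intro add_mono mult_mono)
            show "\<bar>W (z r' j) - W (z r j)\<bar> \<le> A * norm (z r' j - z r j)" using r by (intro Wl) auto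
            show "\<bar>exp (- k * r') - exp (- k * r)\<bar> \<le> k * (r' - r)" using r st k by (intro exp_lip) auto
            show "\<bar>1 + W (z r j)\<bar> \<le> B" using Wb[of r] W_nonneg[of "z r j"] r by simp
          qed (use r k st in auto)
          finally show "norm (h r' - h r) \<le> A * norm (z r' j - z r j) + k * B * (r' - r)"
            by (simp add: algebra_simps)
        qed
      next
        fix r assume r: "r \<in> {s..t} - N"
        obtain x1 x2 \<tau> where zr: "z r j = (x1, x2, \<tau>)" by (metis prod_cases3)
        obtain a1 b1 \<sigma>1 where e1: "e 1 r = (a1, b1, \<sigma>1)" by (metis prod_cases3)
        obtain q1 q2 q3 where e2: "e 2 r = (q1, q2, q3)" by (metis prod_cases3)
        have r0: "0 \<le> r" using r st by auto
        have n1: "norm a1 \<le> \<epsilon>" "norm b1 \<le> \<epsilon>" "\<bar>\<sigma>1\<bar> \<le> \<epsilon>" using smallD[OF small, of 1 r] r0 e1 by auto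
        have n2: "norm q1 \<le> \<epsilon>" "norm q2 \<le> \<epsilon>" "\<bar>q3\<bar> \<le> \<epsilon>" using smallD[OF small, of 2 r] r0 e2 by auto
        have \<tau>: "\<tau> \<in> {Tmin - \<epsilon>..Tmax + \<epsilon>}"
          using timer_range[OF sol small st(1,3) start, of r] r zr by simp
        have vec: "hand2_F c f (z r j + e 1 r) + e 2 r = ((2 / (\<tau> + \<sigma>1)) *\<^sub>R (x2 - x1 + (b1 - a1)) + q1,
            (- 2 * c * (\<tau> + \<sigma>1)) *\<^sub>R grad f (x1 + a1) + q2, 1 + q3)"
          unfolding zr e1 e2 by (simp add: hand2_F_def algebra_simps)
        have "inner (x2 - xs) ((- 2 * c * (\<tau> + \<sigma>1)) *\<^sub>R grad f (x1 + a1) + q2) + 2 * c * \<tau> * (1 + q3) * (f x1 - f xs)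
          + c * \<tau>\<^sup>2 * inner (grad f x1) ((2 / (\<tau> + \<sigma>1)) *\<^sub>R (x2 - x1 + (b1 - a1)) + q1) \<le> k * (1 + W (x1, x2, \<tau>))"
          (is "?D \<le> _")
          unfolding k_def
        proof (rule K(2)[OF \<epsilon>(1)])
          show "norm (b1 - a1) \<le> 2 * \<epsilon>" using n1 norm_triangle_ineq4[of b1 a1] by simp
        qed (use n1 n2 \<tau> \<epsilon> Tmin Tmax in \<open>auto simp: T0_def T1_def\<close>)
        moreover have "((\<lambda>r. W (z r j)) has_real_derivative ?D) (at r within {s..t})"
          using W_deriv[OF N(2)[OF r, unfolded vec], of x1 x2 \<tau>] zr by simp
        ultimately obtain D where D: "D \<le> k * (1 + W (z r j))"
            "((\<lambda>r. W (z r j)) has_real_derivative D) (at r within {s..t})"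
          unfolding zr by blast
        have "((\<lambda>r. exp (- k * r)) has_real_derivative exp (- k * r) * (- k)) (at r within {s..t})"
          by (auto intro!: derivative_eq_intros)
        moreover have "((\<lambda>r. 1 + W (z r j)) has_real_derivative D) (at r within {s..t})"
          using DERIV_add[OF DERIV_const D(2), of 1] by simp
        ultimately have "(h has_real_derivative exp (- k * r) * (D - k * (1 + W (z r j)))) (at r within {s..t})"
          unfolding h_def by (rule DERIV_cong[OF DERIV_mult]) (simp add: algebra_simps)
        moreover have "exp (- k * r) * (D - k * (1 + W (z r j))) \<le> 0"
          using D(1) by (intro mult_nonneg_nonpos) auto
        ultimately show "\<exists>D\<le>0. (h has_real_derivative D) (at r within {s..t})" by blast
      qed
      then have "exp (k * t) * h t \<le> exp (k * t) * h s" by (intro mult_left_mono) auto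
      then show "1 + W (z t j) \<le> exp (K * \<epsilon> * (t - s)) * (1 + W (z s j))"
        by (simp add: h_def k_def[symmetric] mult.assoc[symmetric] exp_add[symmetric] algebra_simps)
    qed
  qed
qed

section \<open>Decay along solutions\<close>

lemma hand2_C_eq: "hand2_C Tmin Tmax = {z :: 'n hand_state. timer z \<in> {Tmin..Tmax}}"
  by (auto simp: hand2_C_def)

lemma initial_timer:
  assumes sol: "hand2_perturbed_solution c f Tmin Tmax e E z" and small: "small e \<epsilon>"
  shows "timer (z 0 0) \<in> {Tmin - \<epsilon>..Tmax + \<epsilon>}"
proof -
  note tv = sol[unfolded hand2_perturbed_solution_def perturbed_hybrid_solution_def]
  define S where "S = {w :: 'n hand_state. Tmin \<le> timer (w + e 3 0) \<and> timer (w + e 3 0) \<le> Tmax}"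
  have "closed S" unfolding S_def by (intro closed_Collect_conj closed_Collect_le continuous_intros)
  moreover have "{w. w + e 3 0 \<in> hand2_C Tmin Tmax} = S" by (auto simp: S_def hand2_C_eq)
  moreover have "z 0 0 \<in> closure {w. w + e 3 0 \<in> hand2_C Tmin Tmax} \<union> {w. w + e 6 0 \<in> hand2_D Tmax}"
    using tv by (simp add: tv_hybrid_solution_def)
  ultimately have "z 0 0 \<in> S \<or> timer (z 0 0 + e 6 0) = Tmax"
    by (auto simp: hand2_D_def closure_closed case_prod_beta)
  then show ?thesis
    using smallD(3)[OF small, of 3 0] smallD(3)[OF small, of 6 0] Tmin Tmax by (auto simp: S_def)
qed

lemma jump_eq:
  assumes sol: "hand2_perturbed_solution c f Tmin Tmax e E z"
    and E: "(s, j) \<in> E" "(s, Suc j) \<in> E"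
  shows "timer (z s j) + timer (e 6 s) = Tmax"
    "z s (Suc j) = (fst (z s j) + (fst (e 4 s) + fst (e 5 s)),
       fst (z s j) + (fst (e 4 s) + fst (snd (e 5 s))), Tmin + timer (e 5 s))"
proof -
  note tv = sol[unfolded hand2_perturbed_solution_def perturbed_hybrid_solution_def]
  have "z s j + e 6 s \<in> hand2_D Tmax \<and> z s (Suc j) = hand2_G Tmin (z s j + e 4 s) + e 5 s"
    using tv E by (simp add: tv_hybrid_solution_def)
  then show "timer (z s j) + timer (e 6 s) = Tmax"
    "z s (Suc j) = (fst (z s j) + (fst (e 4 s) + fst (e 5 s)),
       fst (z s j) + (fst (e 4 s) + fst (snd (e 5 s))), Tmin + timer (e 5 s))"
    by (auto simp: hand2_D_def hand2_G_def case_prod_beta prod_eq_iff)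
qed

text \<open>The longest possible flow interval: the timer has rate at least \<open>1 - \<epsilon>\<close> and moves within
  \<open>{Tmin - \<epsilon>..Tmax + \<epsilon>}\<close>.\<close>

definition H :: "real \<Rightarrow> real" where "H \<epsilon> = (Tmax - Tmin + 2 * \<epsilon>) / (1 - \<epsilon>)"

text \<open>If \<open>w\<close> bounds \<open>W\<close> on one level, then \<open>a w + (g (1 + Kj \<epsilon>) - 1)\<close> bounds it on the next one: the
  jump contributes \<open>k0\<close> and \<open>Kj\<close>, the flow after it contributes \<open>g\<close>. At \<open>\<epsilon> = 0\<close> one has
  \<open>a = k0\<close>, \<open>g = 1\<close> and no offset.\<close>

lemma trajectory_bound:
  assumes Kf: "flow_const Kf" and Kj: "jump_const Kj"
    and sol: "hand2_perturbed_solution c f Tmin Tmax e E z" and small: "small e \<epsilon>"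
    and \<epsilon>: "0 \<le> \<epsilon>" "\<epsilon> \<le> 1 / 2" "2 * \<epsilon> \<le> T0" and tj: "(t, j) \<in> E"
    and g: "g = exp (Kf * \<epsilon> * H \<epsilon>)" and a: "a = g * (k0 + Kj * \<epsilon>)"
  shows "timer (z t j) \<in> {Tmin - \<epsilon>..Tmax + \<epsilon>} \<and> t \<le> (real j + 1) * H \<epsilon> \<and>
      W (z t j) \<le> a ^ j * (g * (1 + W (z 0 0)) - 1) + (g * (1 + Kj * \<epsilon>) - 1) * (\<Sum>i<j. a ^ i)"
proof -
    have E: "hybrid_time_domain E"
      using sol by (simp add: hand2_perturbed_solution_def perturbed_hybrid_solution_def tv_hybrid_solution_def)
    have g0: "0 \<le> g" by (simp add: g)
    have a0: "0 \<le> a" using k0 Kj \<epsilon> by (simp add: a g jump_const_def)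
    have flow: "timer (z t j) \<in> {Tmin - \<epsilon>..Tmax + \<epsilon>} \<and> t - s \<le> H \<epsilon> \<and>
        W (z t j) \<le> g * (1 + W (z s j)) - 1"
      if s: "0 \<le> s" "s \<le> t" "{s..t} \<subseteq> time_slice E j" "timer (z s j) \<in> {Tmin - \<epsilon>..Tmax + \<epsilon>}" for s t j
    proof -
      have r: "timer (z t j) \<in> {Tmin - \<epsilon>..Tmax + \<epsilon>}"
        using timer_range[OF sol small s(1,3,4), of t] s by auto
      have "(1 - \<epsilon>) * (t - s) \<le> timer (z t j) - timer (z s j)"
        using timer_growth[OF sol small s(1-3)] \<epsilon> by simp
      also have "\<dots> \<le> Tmax - Tmin + 2 * \<epsilon>" using r s(4) by auto
      finally have H: "t - s \<le> H \<epsilon>" unfolding H_def using \<epsilon> by (simp add: field_simps)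
      have "1 + W (z t j) \<le> exp (Kf * \<epsilon> * (t - s)) * (1 + W (z s j))"
        using Kf sol small \<epsilon>(1,3) s unfolding flow_const_def by blast
      also have "\<dots> \<le> g * (1 + W (z s j))"
        unfolding g using H Kf[unfolded flow_const_def] \<epsilon> W_nonneg[of "z s j"]
        by (intro mult_right_mono) (auto intro: mult_left_mono)
      finally show ?thesis using r H by simp
    qed
    show "timer (z t j) \<in> {Tmin - \<epsilon>..Tmax + \<epsilon>} \<and> t \<le> (real j + 1) * H \<epsilon> \<and>
      W (z t j) \<le> a ^ j * (g * (1 + W (z 0 0)) - 1) + (g * (1 + Kj * \<epsilon>) - 1) * (\<Sum>i<j. a ^ i)"
      using tj
    proof (induction j arbitrary: t)
      case 0
      then show ?case
        using flow[of 0 t 0] hybrid_time_domain_slice_0[OF E 0] initial_timer[OF sol small] by simp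
    next
      case (Suc j)
      obtain s where s: "0 \<le> s" "s \<le> t" "(s, j) \<in> E" "(s, Suc j) \<in> E" "{s..t} \<subseteq> time_slice E (Suc j)"
        using hybrid_time_domain_slice_Suc[OF E Suc.prems] by blast
      note IH = Suc.IH[OF s(3)]
      obtain x1 x2 \<tau> where zs: "z s j = (x1, x2, \<tau>)" by (metis prod_cases3)
      note je = jump_eq[OF sol s(3,4)]
      have n: "norm (fst (e 4 s) + fst (e 5 s)) \<le> 2 * \<epsilon>" "norm (fst (e 4 s) + fst (snd (e 5 s))) \<le> 2 * \<epsilon>"
        "\<bar>timer (e 5 s)\<bar> \<le> \<epsilon>" "\<bar>timer (e 6 s)\<bar> \<le> \<epsilon>"
        using smallD[OF small, of 4 s] smallD[OF small, of 5 s] smallD[OF small, of 6 s] s(1)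
          norm_triangle_ineq[of "fst (e 4 s)" "fst (e 5 s)"] norm_triangle_ineq[of "fst (e 4 s)" "fst (snd (e 5 s))"]
        by auto
      have "W (x1 + (fst (e 4 s) + fst (e 5 s)), x1 + (fst (e 4 s) + fst (snd (e 5 s))), Tmin + timer (e 5 s))
         \<le> k0 * W (x1, x2, \<tau>) + Kj * \<epsilon> * (1 + W (x1, x2, \<tau>))"
        using Kj[unfolded jump_const_def, THEN conjunct2, rule_format, of \<epsilon> \<tau>] IH je(1) n \<epsilon> zs Tmin Tmax
        by (auto simp: T0_def T1_def)
      then have J: "W (z s (Suc j)) \<le> k0 * W (z s j) + Kj * \<epsilon> * (1 + W (z s j))"
        unfolding je(2) zs by simp
      have \<tau>s: "timer (z s (Suc j)) \<in> {Tmin - \<epsilon>..Tmax + \<epsilon>}" using n Tmax je(2) by auto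
      note fl = flow[OF s(1,2,5) \<tau>s]
      have "W (z t (Suc j)) \<le> g * (1 + W (z s (Suc j))) - 1" using fl by simp
      also have "\<dots> \<le> g * (1 + (k0 * W (z s j) + Kj * \<epsilon> * (1 + W (z s j)))) - 1"
        using J g0 by (auto intro: mult_left_mono)
      also have "\<dots> = a * W (z s j) + (g * (1 + Kj * \<epsilon>) - 1)" by (simp add: a algebra_simps)
      also have "a * W (z s j) \<le> a * (a ^ j * (g * (1 + W (z 0 0)) - 1) + (g * (1 + Kj * \<epsilon>) - 1) * (\<Sum>i<j. a ^ i))"
        using IH a0 by (intro mult_left_mono) auto
      finally have "W (z t (Suc j)) \<le> a ^ Suc j * (g * (1 + W (z 0 0)) - 1)
          + (g * (1 + Kj * \<epsilon>) - 1) * (a * (\<Sum>i<j. a ^ i) + 1)"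
        by (simp add: algebra_simps)
      then show ?case
        unfolding sum_geometric_step using fl IH by (simp add: algebra_simps)
    qed
qed

lemma nominal_eq_perturbed:
  "hand2_solution c f Tmin Tmax E z \<longleftrightarrow> hand2_perturbed_solution c f Tmin Tmax (\<lambda>_ _. 0) E z"
  by (simp add: hand2_solution_def hybrid_solution_def hand2_perturbed_solution_def perturbed_hybrid_solution_def)

lemma small_0: "small (\<lambda>_ _. 0) 0"
  by (simp add: small_def)

lemma nominal_bound:
  assumes "hand2_solution c f Tmin Tmax E z" "(t, j) \<in> E"
  shows "timer (z t j) \<in> {Tmin..Tmax}" "t \<le> (real j + 1) * (Tmax - Tmin)"
    "W (z t j) \<le> k0 ^ j * W (z 0 0)"
proof -
  obtain Kf where Kf: "flow_const Kf" by (rule flow_const)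
  obtain Kj where Kj: "jump_const Kj" by (rule jump_const)
  from trajectory_bound[OF Kf Kj assms(1)[unfolded nominal_eq_perturbed] small_0 _ _ _ assms(2) refl refl]
  show "timer (z t j) \<in> {Tmin..Tmax}" "t \<le> (real j + 1) * (Tmax - Tmin)" "W (z t j) \<le> k0 ^ j * W (z 0 0)"
    using T01 by (auto simp: H_def)
qed

section \<open>Distance to the attractor\<close>

lemma dist_A_le:
  assumes "timer z \<in> {Tmin - \<epsilon>..Tmax + \<epsilon>}" "0 \<le> \<epsilon>"
  shows "infdist z (hand2_A xs Tmin Tmax) \<le> norm (fst z - xs) + norm (fst (snd z) - xs) + \<epsilon>"
proof -
  obtain x1 x2 \<tau> where z: "z = (x1, x2, \<tau>)" by (metis prod_cases3)
  define \<sigma> where "\<sigma> = max Tmin (min \<tau> Tmax)"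
  have \<sigma>: "\<sigma> \<in> {Tmin..Tmax}" "\<bar>\<tau> - \<sigma>\<bar> \<le> \<epsilon>" using assms Tmax unfolding \<sigma>_def z by auto
  have "infdist z (hand2_A xs Tmin Tmax) \<le> dist z (xs, xs, \<sigma>)"
    using \<sigma> by (intro infdist_le) (auto simp: hand2_A_def)
  also have "\<dots> = norm (x1 - xs, x2 - xs, \<tau> - \<sigma>)" by (simp add: z dist_norm)
  also have "\<dots> \<le> norm (x1 - xs) + norm (x2 - xs, \<tau> - \<sigma>)" by (rule norm_Pair_le)
  also have "norm (x2 - xs, \<tau> - \<sigma>) \<le> norm (x2 - xs) + norm (\<tau> - \<sigma>)" by (rule norm_Pair_le)
  finally show ?thesis using \<sigma> by (simp add: z)
qed

lemma dist_A_eq: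
  assumes "timer z \<in> {Tmin..Tmax}"
  shows "(infdist z (hand2_A xs Tmin Tmax))\<^sup>2 = (norm (fst z - xs))\<^sup>2 + (norm (fst (snd z) - xs))\<^sup>2"
proof -
  obtain x1 x2 \<tau> where z: "z = (x1, x2, \<tau>)" by (metis prod_cases3)
  have ne: "hand2_A xs Tmin Tmax \<noteq> {}" using Tmax by (auto simp: hand2_A_def)
  define n where "n = norm (x1 - xs, x2 - xs)"
  have "infdist z (hand2_A xs Tmin Tmax) \<le> dist z (xs, xs, \<tau>)"
    using assms by (intro infdist_le) (auto simp: hand2_A_def z)
  also have "\<dots> = n" by (simp add: z dist_norm n_def norm_Pair)
  finally have "infdist z (hand2_A xs Tmin Tmax) \<le> n" .
  moreover have "n \<le> infdist z (hand2_A xs Tmin Tmax)"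
    unfolding infdist_notempty[OF ne]
  proof (rule cINF_greatest[OF ne])
    fix y assume "y \<in> hand2_A xs Tmin Tmax"
    then obtain \<sigma> where y: "y = (xs, xs, \<sigma>)" by (auto simp: hand2_A_def)
    show "n \<le> dist z y" by (simp add: y z dist_norm n_def norm_Pair real_sqrt_le_iff)
  qed
  ultimately have "infdist z (hand2_A xs Tmin Tmax) = n" by simp
  then show ?thesis by (simp add: n_def z norm_Pair)
qed

text \<open>On the nominal timer range \<open>W\<close> is comparable with the squared distance, so its decay carries over.\<close>

lemma infdist_bound:
  assumes "hand2_solution c f Tmin Tmax E z" "(t, j) \<in> E"
  shows "infdist (z t j) (hand2_A xs Tmin Tmax) \<le> sqrt (Klow * Kup * k0 ^ j) * infdist (z 0 0) (hand2_A xs Tmin Tmax)"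
proof -
  let ?d = "\<lambda>z. infdist z (hand2_A xs Tmin Tmax)"
  note b = nominal_bound[OF assms]
  have "(0, 0) \<in> E"
    using assms(1) by (simp add: hand2_solution_def hybrid_solution_def tv_hybrid_solution_def)
  note b0 = nominal_bound(1)[OF assms(1) this]
  have "(?d (z t j))\<^sup>2 \<le> Klow * W (z t j)"
    using W_lower[of "timer (z t j)" "fst (z t j)" "fst (snd (z t j))"] b(1) T01 by (simp add: dist_A_eq)
  also have "\<dots> \<le> Klow * (k0 ^ j * W (z 0 0))" using b(3) Klow by (intro mult_left_mono) auto
  also have "\<dots> \<le> Klow * (k0 ^ j * (Kup * (?d (z 0 0))\<^sup>2))"
    using W_upper[of "timer (z 0 0)" "fst (z 0 0)" "fst (snd (z 0 0))"] b0 T01 Tmin Klow k0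
    by (intro mult_left_mono) (auto simp: dist_A_eq)
  also have "\<dots> = (sqrt (Klow * Kup * k0 ^ j) * ?d (z 0 0))\<^sup>2"
    using Klow Kup k0 by (simp add: power_mult_distrib)
  finally show ?thesis
    by (rule power2_le_imp_le) (use Klow Kup k0 in \<open>simp add: infdist_nonneg\<close>)
qed

section \<open>Uniform global asymptotic stability\<close>

lemma UGAS_A:
  "UGAS (hand2_F c f) (hand2_C Tmin Tmax) (hand2_G Tmin) (hand2_D Tmax) (hand2_A xs Tmin Tmax)"
proof -
  let ?d = "\<lambda>z. infdist z (hand2_A xs Tmin Tmax)"
  let ?sol = "hybrid_solution (hand2_F c f) (hand2_C Tmin Tmax) (hand2_G Tmin) (hand2_D Tmax)"
  note bound = infdist_bound[unfolded hand2_solution_def]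
  have KK: "0 < Klow * Kup" using Klow Kup by simp
  show ?thesis
    unfolding UGAS_def
  proof (intro conjI allI impI)
    show "compact (hand2_A xs Tmin Tmax)" unfolding hand2_A_def by (intro compact_Times) auto
    show "hand2_A xs Tmin Tmax \<noteq> {}" using Tmax by (auto simp: hand2_A_def)
    show "\<exists>\<alpha>. class_K_infinity \<alpha> \<and> (\<forall>E z. ?sol E z \<longrightarrow> (\<forall>(t, j)\<in>E. ?d (z t j) \<le> \<alpha> (?d (z 0 0))))"
    proof (intro exI[of _ "\<lambda>s. sqrt (Klow * Kup) * s"] conjI allI impI ballI)
      show "class_K_infinity (\<lambda>s. sqrt (Klow * Kup) * s)"
        unfolding class_K_infinity_def
      proof (intro conjI)
        show "continuous_on {0..} (\<lambda>s. sqrt (Klow * Kup) * s)" by (intro continuous_intros)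
        show "strict_mono_on {0..} (\<lambda>s. sqrt (Klow * Kup) * s)"
          using KK by (auto simp: strict_mono_on_def)
        show "filterlim (\<lambda>s. sqrt (Klow * Kup) * s) at_top at_top"
          using KK by (intro filterlim_tendsto_pos_mult_at_top[OF tendsto_const] filterlim_ident) auto
      qed simp
      fix E z x assume sol: "?sol E z" and x: "x \<in> E"
      obtain t j where [simp]: "x = (t, j)" by (cases x)
      have "k0 ^ j \<le> 1" using k0 by (intro power_le_one) auto
      then have "sqrt (Klow * Kup * k0 ^ j) \<le> sqrt (Klow * Kup)"
        using KK mult_left_mono[of "k0 ^ j" 1 "Klow * Kup"] by simp
      then have "sqrt (Klow * Kup * k0 ^ j) * ?d (z 0 0) \<le> sqrt (Klow * Kup) * ?d (z 0 0)"
        by (intro mult_right_mono infdist_nonneg)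
      then show "case x of (t, j) \<Rightarrow> ?d (z t j) \<le> sqrt (Klow * Kup) * ?d (z 0 0)"
        using bound[OF sol, of t j] x by simp
    qed
    fix \<epsilon> r :: real assume \<epsilon>: "0 < \<epsilon>" and r: "0 < r"
    define \<Delta> where "\<Delta> = Tmax - Tmin"
    have \<Delta>: "0 \<le> \<Delta>" using Tmax by (simp add: \<Delta>_def)
    obtain J where J: "\<And>j. J \<le> j \<Longrightarrow> k0 ^ j * (Klow * Kup) \<le> (\<epsilon> / r)\<^sup>2"
      using geometric_small[of k0 "(\<epsilon> / r)\<^sup>2"] k0 \<epsilon> r by auto
    show "\<exists>T>0. \<forall>E z. ?sol E z \<and> ?d (z 0 0) \<le> r \<longrightarrow> (\<forall>(t, j)\<in>E. T \<le> t + real j \<longrightarrow> ?d (z t j) \<le> \<epsilon>)"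
    proof (intro exI[of _ "(real J + 1) * (\<Delta> + 1)"] conjI allI impI ballI)
      show "0 < (real J + 1) * (\<Delta> + 1)" using \<Delta> by (intro mult_pos_pos) auto
      fix E z x assume sol: "?sol E z \<and> ?d (z 0 0) \<le> r" and x: "x \<in> E"
      obtain t j where [simp]: "x = (t, j)" by (cases x)
      show "case x of (t, j) \<Rightarrow> (real J + 1) * (\<Delta> + 1) \<le> t + real j \<longrightarrow> ?d (z t j) \<le> \<epsilon>"
      proof (clarsimp)
        assume T: "(real J + 1) * (\<Delta> + 1) \<le> t + real j"
        have "J \<le> j"
          using many_jumps[OF _ \<Delta> T] nominal_bound(2)[unfolded hand2_solution_def, of E z t j] sol x
          by (simp add: \<Delta>_def)
        then have "sqrt (Klow * Kup * k0 ^ j) \<le> \<epsilon> / r"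
          using J[of j] \<epsilon> r by (intro real_le_lsqrt) (auto simp: mult.commute)
        then have "sqrt (Klow * Kup * k0 ^ j) * ?d (z 0 0) \<le> \<epsilon> / r * r"
          using sol \<epsilon> r by (intro mult_mono infdist_nonneg) auto
        then show "?d (z t j) \<le> \<epsilon>" using bound[of E z t j] sol x r by simp
      qed
    qed
  qed
qed

section \<open>Exponential rate\<close>

text \<open>From \<open>k0 \<le> exp (k0 - 1)\<close> and the fact that \<open>\<alpha> (t + j)\<close> is a lower bound for the number of
  jumps.\<close>

lemma exponential_rate:
  fixes \<alpha> :: "real \<Rightarrow> real"
  assumes \<alpha>: "\<alpha> = (\<lambda>s. max (s - (Tmax - Tmin)) 0 / (Tmax - Tmin + 1))"
  shows "\<exists>ka>0. \<forall>E z. hand2_solution c f Tmin Tmax E z \<and>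
           fst (z 0 0) = fst (snd (z 0 0)) \<and> snd (snd (z 0 0)) = Tmin \<longrightarrow>
           (\<forall>(t, j)\<in>E. f (fst (z t j)) - f xs
              \<le> ka * exp (- (1 - k0) * \<alpha> (t + real j)) * (norm (fst (z 0 0) - xs))\<^sup>2)"
proof (intro exI[of _ "2 * Kup / (c * Tmin\<^sup>2)"] conjI allI impI ballI)
  show "0 < 2 * Kup / (c * Tmin\<^sup>2)" using Kup c Tmin by simp
  fix E z x
  assume sol: "hand2_solution c f Tmin Tmax E z \<and> fst (z 0 0) = fst (snd (z 0 0)) \<and> timer (z 0 0) = Tmin"
    and x: "x \<in> E"
  obtain t j where tj[simp]: "x = (t, j)" by (cases x)
  note b = nominal_bound[OF conjunct1[OF sol] x[unfolded tj]]
  have W0: "W (z 0 0) \<le> Kup * (2 * (norm (fst (z 0 0) - xs))\<^sup>2)"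
  proof -
    have "0 \<le> timer (z 0 0)" "timer (z 0 0) \<le> T1" using sol T01 Tmin Tmax by auto
    from W_upper[OF this, of "fst (z 0 0)" "fst (snd (z 0 0))"] show ?thesis
      using conjunct1[OF conjunct2[OF sol]] by (metis mult_2 prod.collapse)
  qed
  have \<alpha>j: "\<alpha> (t + real j) \<le> real j"
  proof -
    have "t + real j - (Tmax - Tmin) \<le> real j * (Tmax - Tmin + 1)"
      using b(2) by (simp add: algebra_simps)
    moreover have "0 \<le> real j * (Tmax - Tmin + 1)" using Tmax by simp
    ultimately show ?thesis unfolding \<alpha> using Tmax by (simp add: divide_le_eq)
  qed
  have "k0 ^ j \<le> exp (- (1 - k0)) ^ j"
    using k0 exp_ge_add_one_self[of "- (1 - k0)"] by (intro power_mono) auto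
  also have "\<dots> = exp (- (1 - k0) * real j)" by (subst exp_of_nat2_mult) (rule refl)
  also have "\<dots> \<le> exp (- (1 - k0) * \<alpha> (t + real j))" using \<alpha>j k0 by simp
  finally have e: "k0 ^ j \<le> exp (- (1 - k0) * \<alpha> (t + real j))" .
  have "c * Tmin\<^sup>2 * (f (fst (z t j)) - f xs) \<le> c * (timer (z t j))\<^sup>2 * (f (fst (z t j)) - f xs)"
    using b(1) c Tmin min by (intro mult_right_mono mult_left_mono power_mono) auto
  also have "\<dots> \<le> W (z t j)" by (simp add: W_def)
  also have "\<dots> \<le> k0 ^ j * W (z 0 0)" by (rule b)
  also have "\<dots> \<le> exp (- (1 - k0) * \<alpha> (t + real j)) * (Kup * (2 * (norm (fst (z 0 0) - xs))\<^sup>2))"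
    using e W0 W_nonneg by (intro mult_mono) auto
  finally have "f (fst (z t j)) - f xs
      \<le> exp (- (1 - k0) * \<alpha> (t + real j)) * (Kup * (2 * (norm (fst (z 0 0) - xs))\<^sup>2)) / (c * Tmin\<^sup>2)"
    using c Tmin by (subst pos_le_divide_eq) (auto simp: mult.commute)
  then show "case x of (t, j) \<Rightarrow> f (fst (z t j)) - f xs
      \<le> 2 * Kup / (c * Tmin\<^sup>2) * exp (- (1 - k0) * \<alpha> (t + real j)) * (norm (fst (z 0 0) - xs))\<^sup>2"
    by (simp add: mult_ac)
qed

section \<open>Robustness to perturbations\<close>

lemma robustness:
  fixes K0 :: "((real ^ 'n) \<times> (real ^ 'n)) set"
  assumes \<delta>: "0 < \<delta>" and K0: "compact K0"
  shows "\<exists>\<epsilon>>0. \<exists>T>0. \<forall>e. small e \<epsilon> \<longrightarrow>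
     (\<forall>E z. hand2_perturbed_solution c f Tmin Tmax e E z \<and> (fst (z 0 0), fst (snd (z 0 0))) \<in> K0 \<longrightarrow>
        (\<forall>(t, j)\<in>E. t + real j \<ge> T \<longrightarrow> infdist (z t j) (hand2_A xs Tmin Tmax) \<le> \<delta>))"
proof -
  obtain Kf where Kf: "flow_const Kf" by (rule flow_const)
  obtain Kj where Kj: "jump_const Kj" by (rule jump_const)
  have K: "0 \<le> Kf" "0 \<le> Kj" using Kf Kj by (simp_all add: flow_const_def jump_const_def)
  obtain R where R: "\<And>p. p \<in> K0 \<Longrightarrow> norm p \<le> R"
    using compact_imp_bounded[OF K0] by (auto simp: bounded_iff)
  define Wm where "Wm = Kup * (2 * (R + norm xs)\<^sup>2)"
  have Wm: "0 \<le> Wm" using Kup by (simp add: Wm_def)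
  define \<rho> where "\<rho> = (1 + k0) / 2"
  have \<rho>: "k0 < \<rho>" "0 < \<rho>" "\<rho> < 1" using k0 by (auto simp: \<rho>_def)
  define \<eta> where "\<eta> = (\<delta> / 4)\<^sup>2 / (2 * Klow)"
  have \<eta>: "0 < \<eta>" using \<delta> Klow by (simp add: \<eta>_def)
  define h where "h = Tmax - Tmin + 1"
  have h: "0 \<le> h" using Tmax by (simp add: h_def)
  define g where "g \<epsilon> = exp (Kf * \<epsilon> * H \<epsilon>)" for \<epsilon>
  have lims: "(H \<longlongrightarrow> (Tmax - Tmin + 2 * 0) / (1 - 0)) (at_right 0)"
    unfolding H_def[abs_def] by (intro tendsto_intros) auto
  have limg: "(g \<longlongrightarrow> exp (Kf * 0 * ((Tmax - Tmin + 2 * 0) / (1 - 0)))) (at_right 0)"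
    unfolding g_def[abs_def] by (intro tendsto_intros lims)
  have lima: "((\<lambda>\<epsilon>. g \<epsilon> * (k0 + Kj * \<epsilon>)) \<longlongrightarrow> exp (Kf * 0 * ((Tmax - Tmin + 2 * 0) / (1 - 0))) * (k0 + Kj * 0)) (at_right 0)"
    by (intro tendsto_intros limg)
  have limb: "((\<lambda>\<epsilon>. g \<epsilon> * (1 + Kj * \<epsilon>) - 1) \<longlongrightarrow> exp (Kf * 0 * ((Tmax - Tmin + 2 * 0) / (1 - 0))) * (1 + Kj * 0) - 1) (at_right 0)"
    by (intro tendsto_intros limg)
  \<comment> \<open>All requirements on \<open>\<epsilon>\<close> are strict inequalities that hold in the limit \<open>\<epsilon> = 0\<close>.\<close>
  have "\<forall>\<^sub>F \<epsilon> in at_right 0. H \<epsilon> < h" using order_tendstoD(2)[OF lims, of h] by (simp add: h_def)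
  moreover have "\<forall>\<^sub>F \<epsilon> in at_right 0. g \<epsilon> < 2" using order_tendstoD(2)[OF limg, of 2] by simp
  moreover have "\<forall>\<^sub>F \<epsilon> in at_right 0. g \<epsilon> * (k0 + Kj * \<epsilon>) < \<rho>" using order_tendstoD(2)[OF lima, of \<rho>] \<rho> by simp
  moreover have "\<forall>\<^sub>F \<epsilon> in at_right 0. g \<epsilon> * (1 + Kj * \<epsilon>) - 1 < \<eta> * (1 - \<rho>)"
    using order_tendstoD(2)[OF limb, of "\<eta> * (1 - \<rho>)"] \<eta> \<rho> by simp
  moreover have "\<forall>\<^sub>F \<epsilon> in at_right 0. \<epsilon> \<in> {0<..<1 / 2::real}" by (intro eventually_at_right_real) simp
  moreover have "\<forall>\<^sub>F \<epsilon> in at_right 0. \<epsilon> \<in> {0<..<T0 / 2}" using T01 by (intro eventually_at_right_real) simp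
  moreover have "\<forall>\<^sub>F \<epsilon> in at_right 0. \<epsilon> \<in> {0<..<\<delta> / 2}" using \<delta> by (intro eventually_at_right_real) simp
  ultimately have "\<forall>\<^sub>F \<epsilon> in at_right 0. H \<epsilon> < h \<and> g \<epsilon> < 2 \<and> g \<epsilon> * (k0 + Kj * \<epsilon>) < \<rho> \<and>
      g \<epsilon> * (1 + Kj * \<epsilon>) - 1 < \<eta> * (1 - \<rho>) \<and> 0 < \<epsilon> \<and> \<epsilon> < 1 / 2 \<and> \<epsilon> < T0 / 2 \<and> \<epsilon> < \<delta> / 2"
    by eventually_elim simp
  then obtain \<epsilon> where \<epsilon>: "H \<epsilon> < h" "g \<epsilon> < 2" "g \<epsilon> * (k0 + Kj * \<epsilon>) < \<rho>"
      "g \<epsilon> * (1 + Kj * \<epsilon>) - 1 < \<eta> * (1 - \<rho>)" "0 < \<epsilon>" "\<epsilon> < 1 / 2" "\<epsilon> < T0 / 2" "\<epsilon> < \<delta> / 2"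
    using eventually_happens'[OF trivial_limit_at_right_real] by blast
  obtain J where J: "\<And>j. J \<le> j \<Longrightarrow> \<rho> ^ j * (2 * (1 + Wm)) \<le> \<eta>"
    using geometric_small[of \<rho> \<eta>] \<rho> \<eta> by auto
  show ?thesis
  proof (rule exI[of _ \<epsilon>], rule conjI, rule \<epsilon>(5), rule exI[of _ "(real J + 1) * (h + 1)"],
      intro conjI allI impI ballI)
    show "0 < (real J + 1) * (h + 1)" using h by (intro mult_pos_pos) auto
    fix e E z x
    assume small: "small e \<epsilon>" and x: "x \<in> E"
      and sol: "hand2_perturbed_solution c f Tmin Tmax e E z \<and> (fst (z 0 0), fst (snd (z 0 0))) \<in> K0"
    obtain t j where tj[simp]: "x = (t, j)" by (cases x)
    define a where "a = g \<epsilon> * (k0 + Kj * \<epsilon>)"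
    have a: "0 \<le> a" "a < \<rho>" using \<epsilon> K k0 by (auto simp: a_def g_def)
    have tb: "timer (z t j) \<in> {Tmin - \<epsilon>..Tmax + \<epsilon>} \<and> t \<le> (real j + 1) * H \<epsilon> \<and>
      W (z t j) \<le> a ^ j * (g \<epsilon> * (1 + W (z 0 0)) - 1) + (g \<epsilon> * (1 + Kj * \<epsilon>) - 1) * (\<Sum>i<j. a ^ i)"
      using sol small x \<epsilon> by (intro trajectory_bound[OF Kf Kj]) (auto simp: g_def a_def)
    have "W (z 0 0) \<le> Kup * ((norm (fst (z 0 0) - xs))\<^sup>2 + (norm (fst (snd (z 0 0)) - xs))\<^sup>2)"
      using W_upper[of "timer (z 0 0)" "fst (z 0 0)" "fst (snd (z 0 0))"] initial_timer[OF conjunct1[OF sol] small]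
        \<epsilon> Tmin Tmax by (simp add: T0_def T1_def)
    also have "\<dots> \<le> Kup * ((R + norm xs)\<^sup>2 + (R + norm xs)\<^sup>2)"
    proof -
      have "norm (fst (z 0 0)) \<le> R" "norm (fst (snd (z 0 0))) \<le> R"
        using R[OF conjunct2[OF sol]] norm_fst_le[of "fst (z 0 0)" "fst (snd (z 0 0))"]
          norm_snd_le[of "fst (snd (z 0 0))" "fst (z 0 0)"] by auto
      then have "norm (fst (z 0 0) - xs) \<le> R + norm xs" "norm (fst (snd (z 0 0)) - xs) \<le> R + norm xs"
        by (auto intro: order_trans[OF norm_triangle_ineq4])
      then show ?thesis using Kup by (intro mult_left_mono add_mono power_mono) auto
    qed
    finally have W0: "W (z 0 0) \<le> Wm" by (simp add: Wm_def)
    show "case x of (t, j) \<Rightarrow> (real J + 1) * (h + 1) \<le> t + real j \<longrightarrow>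
        infdist (z t j) (hand2_A xs Tmin Tmax) \<le> \<delta>"
    proof clarsimp
      assume T: "(real J + 1) * (h + 1) \<le> t + real j"
      have "(real j + 1) * H \<epsilon> \<le> (real j + 1) * h" using \<epsilon> by (intro mult_left_mono) auto
      then have Jj: "J \<le> j" using many_jumps[OF _ h T] tb by linarith
      have "a ^ j * (g \<epsilon> * (1 + W (z 0 0)) - 1) \<le> \<rho> ^ j * (2 * (1 + Wm))"
      proof -
        have "g \<epsilon> * (1 + W (z 0 0)) \<le> 2 * (1 + Wm)"
          using \<epsilon>(2) W0 W_nonneg[of "z 0 0"] by (intro mult_mono) (auto simp: g_def)
        then have "a ^ j * (g \<epsilon> * (1 + W (z 0 0)) - 1) \<le> a ^ j * (2 * (1 + Wm))"
          using a by (intro mult_left_mono) auto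
        also have "\<dots> \<le> \<rho> ^ j * (2 * (1 + Wm))" using a Wm by (intro mult_right_mono power_mono) auto
        finally show ?thesis .
      qed
      also have "\<dots> \<le> \<eta>" by (rule J[OF Jj])
      finally have 1: "a ^ j * (g \<epsilon> * (1 + W (z 0 0)) - 1) \<le> \<eta>" .
      have 2: "(g \<epsilon> * (1 + Kj * \<epsilon>) - 1) * (\<Sum>i<j. a ^ i) \<le> \<eta>"
      proof -
        have "(\<Sum>i<j. a ^ i) \<le> (\<Sum>i<j. \<rho> ^ i)" using a by (intro sum_mono power_mono) auto
        also have "\<dots> \<le> 1 / (1 - \<rho>)"
          using \<rho> by (simp add: sum_gp_strict divide_right_mono)
        finally have s: "(\<Sum>i<j. a ^ i) \<le> 1 / (1 - \<rho>)" .
        have "(g \<epsilon> * (1 + Kj * \<epsilon>) - 1) * (\<Sum>i<j. a ^ i) \<le> \<eta> * (1 - \<rho>) * (1 / (1 - \<rho>))"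
          using s \<epsilon>(4) \<eta> \<rho> a by (intro mult_mono) (auto intro: sum_nonneg)
        then show ?thesis using \<rho> by simp
      qed
      have "(norm (fst (z t j) - xs))\<^sup>2 + (norm (fst (snd (z t j)) - xs))\<^sup>2 \<le> Klow * W (z t j)"
        using W_lower[of "timer (z t j)" "fst (z t j)" "fst (snd (z t j))"] tb \<epsilon> Tmin by (simp add: T0_def)
      also have "\<dots> \<le> Klow * (2 * \<eta>)" using tb 1 2 Klow by (intro mult_left_mono) auto
      also have "\<dots> = (\<delta> / 4)\<^sup>2" using Klow by (simp add: \<eta>_def)
      finally have sq: "(norm (fst (z t j) - xs))\<^sup>2 + (norm (fst (snd (z t j)) - xs))\<^sup>2 \<le> (\<delta> / 4)\<^sup>2" .
      have "(norm (fst (z t j) - xs))\<^sup>2 \<le> (\<delta> / 4)\<^sup>2" "(norm (fst (snd (z t j)) - xs))\<^sup>2 \<le> (\<delta> / 4)\<^sup>2"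
        using sq zero_le_power2[of "norm (fst (z t j) - xs)"]
          zero_le_power2[of "norm (fst (snd (z t j)) - xs)"] by linarith+
      then have "norm (fst (z t j) - xs) \<le> \<delta> / 4" "norm (fst (snd (z t j)) - xs) \<le> \<delta> / 4"
        using \<delta> power2_le_imp_le[of _ "\<delta> / 4"] by simp_all
      then show "infdist (z t j) (hand2_A xs Tmin Tmax) \<le> \<delta>"
        using dist_A_le[of "z t j" \<epsilon>] tb \<epsilon> by simp
    qed
  qed
qed

section \<open>Completeness of maximal solutions\<close>

lemma nominal_tv:
  assumes "hand2_solution c f Tmin Tmax E z"
  shows "tv_hybrid_solution (\<lambda>_. hand2_F c f) (\<lambda>_. hand2_C Tmin Tmax) (\<lambda>_. hand2_G Tmin) (\<lambda>_. hand2_D Tmax) E z"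
  using assms by (simp add: hand2_solution_def hybrid_solution_def)

lemma nominal_htd:
  assumes "hand2_solution c f Tmin Tmax E z"
  shows "hybrid_time_domain E"
  using nominal_tv[OF assms] by (simp add: tv_hybrid_solution_def)

lemma nominal_jump:
  assumes "hand2_solution c f Tmin Tmax E z" "(t, j) \<in> E" "(t, Suc j) \<in> E"
  shows "z t j \<in> hand2_D Tmax" "z t (Suc j) = hand2_G Tmin (z t j)"
  using nominal_tv[OF assms(1)] assms(2,3) by (simp_all add: tv_hybrid_solution_def)

lemma nominal_in_C:
  assumes "hand2_solution c f Tmin Tmax E z" "(t, j) \<in> E"
  shows "z t j \<in> hand2_C Tmin Tmax"
  using nominal_bound(1)[OF assms] by (simp add: hand2_C_eq)

text \<open>At the jump that leaves level \<open>j\<close> the timer equals \<open>Tmax\<close>. A continuation of that level would let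
  the timer exceed \<open>Tmax\<close>.\<close>

lemma nominal_ordered:
  assumes sol: "hand2_solution c f Tmin Tmax E z" and tj: "(t, j) \<in> E" and t0: "(t0, J) \<in> E" "j < J"
  shows "t \<le> t0"
proof (rule ccontr)
  assume "\<not> t \<le> t0"
  note E = nominal_htd[OF sol]
  obtain ts where ts: "ts 0 = (0::real)" "\<forall>i\<le>J. ts i \<le> ts (Suc i)" "ts (Suc J) = t0"
    "\<And>r i. i \<le> J \<Longrightarrow> (r, i) \<in> E \<and> 0 \<le> r \<and> r \<le> t0 \<longleftrightarrow> ts i \<le> r \<and> r \<le> ts (Suc i)"
    by (rule hybrid_time_domain_at_iff[OF E t0(1)]) blast
  define s where "s = ts (Suc j)"
  have "(s, j) \<in> E \<and> 0 \<le> s \<and> s \<le> t0" using ts(4)[of j s] ts(2) t0(2) by (simp add: s_def)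
  moreover have "(s, Suc j) \<in> E" using ts(4)[of "Suc j" s] ts(2) t0(2) by (simp add: s_def Suc_le_eq)
  ultimately have s: "(s, j) \<in> E" "0 \<le> s" "s < t" "(s, Suc j) \<in> E" using \<open>\<not> t \<le> t0\<close> by auto
  have "timer (z s j) = Tmax"
    using nominal_jump(1)[OF sol s(1,4)] by (auto simp: hand2_D_def)
  moreover have "(1 - 0) * (t - s) \<le> timer (z t j) - timer (z s j)"
    using s by (intro timer_growth[OF sol[unfolded nominal_eq_perturbed] small_0 _ _ time_slice_convex[OF E s(1) tj]]) auto
  ultimately show False using nominal_bound(1)[OF sol tj] s by auto
qed

lemma extend_by_flow:
  assumes sol: "hand2_solution c f Tmin Tmax E z" and top: "\<And>t j. (t, j) \<in> E \<Longrightarrow> j \<le> J"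
    and t0: "(t0, J) \<in> E" "t0 \<le> t1" and t1: "\<And>t. (t, J) \<in> E \<Longrightarrow> t \<le> t1"
    and y: "absolutely_continuous_Icc t0 t1 y" "\<And>t. t \<in> {t0..t1} \<Longrightarrow> y t \<in> hand2_C Tmin Tmax"
    and yz: "\<And>t. (t, J) \<in> E \<Longrightarrow> t0 \<le> t \<Longrightarrow> y t = z t J"
    and N: "negligible N"
    and yd: "\<And>t. t \<in> {t0..t1} - N \<Longrightarrow> (y has_vector_derivative hand2_F c f (y t)) (at t within {t0..t1})"
  shows "\<exists>z'. hand2_solution c f Tmin Tmax (E \<union> {t0..t1} \<times> {J}) z' \<and> (\<forall>(t, j)\<in>E. z' t j = z t j)"
proof -
  note tv = nominal_tv[OF sol]
  note E = nominal_htd[OF sol]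
  define E' where "E' = E \<union> {t0..t1} \<times> {J}"
  define z' where "z' t j = (if j = J \<and> t0 \<le> t then y t else z t j)" for t j
  have z'z: "z' t j = z t j" if "(t, j) \<in> E" for t j using yz[of t] that by (auto simp: z'_def)
  define S where "S = time_slice E J"
  have S: "r \<in> S \<longleftrightarrow> (r, J) \<in> E" for r by (simp add: S_def time_slice_def)
  have S': "time_slice E' J = S \<union> {t0..t1}" by (auto simp: E'_def S_def time_slice_def)
  have Sle: "r \<le> t1" if "r \<in> S" for r using t1 that by (simp add: S)
  have t0S: "t0 \<in> S" using t0 by (simp add: S)
  have zy: "z' r J = y r" if "t0 \<le> r" for r using that by (simp add: z'_def)
  have zz: "z' r J = z r J" if "r \<in> S" for r using z'z that by (simp add: S)
  have other: "time_slice E' j = time_slice E j" if "j \<noteq> J" for j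
    using that by (auto simp: E'_def time_slice_def)
  have z'o: "z' t j = z t j" if "j \<noteq> J" for t j using that by (simp add: z'_def)
  have both: "(t, j) \<in> E \<and> (t, Suc j) \<in> E" if "(t, j) \<in> E'" "(t, Suc j) \<in> E'" for t j
  proof -
    have 1: "(t, j) \<in> E" if "j \<noteq> J" using that \<open>(t, j) \<in> E'\<close> by (simp add: E'_def)
    have 2: "(t, Suc j) \<in> E" if "Suc j \<noteq> J" using that \<open>(t, Suc j) \<in> E'\<close> by (simp add: E'_def)
    have 3: "j \<noteq> J" using 2 top[of t "Suc j"] by auto
    have "(t, Suc j) \<in> E" if J: "Suc j = J"
    proof (rule ccontr)
      assume n: "(t, Suc j) \<notin> E"
      then have "t0 \<le> t" using \<open>(t, Suc j) \<in> E'\<close> J by (auto simp: E'_def)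
      moreover have "t \<le> t0" using nominal_ordered[OF sol 1[OF 3] t0(1)] J by simp
      ultimately show False using n t0(1) J by simp
    qed
    then show ?thesis using 1 2 3 by blast
  qed
  have ac: "absolutely_continuous_Icc a b (\<lambda>t. z' t J)" if sub: "{a..b} \<subseteq> S \<union> {t0..t1}" for a b
  proof -
    have L: "absolutely_continuous_Icc a b' (\<lambda>t. z' t J)" if "b' \<le> b" "b' \<le> t0" for b'
    proof -
      have "{a..b'} \<subseteq> S"
      proof
        fix r assume "r \<in> {a..b'}"
        then have "r \<in> {a..b}" "r \<le> t0" using that by auto
        with sub have "r \<in> S \<union> {t0..t1}" by blast
        with \<open>r \<le> t0\<close> show "r \<in> S" using t0S by (cases "r = t0") auto
      qed
      then have "absolutely_continuous_Icc a b' (\<lambda>t. z t J)"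
        using tv_flow_ac[OF tv] by (simp add: S_def)
      then show ?thesis
        by (rule ac_dominated[where A = 1 and B = 0]) (use \<open>{a..b'} \<subseteq> S\<close> in \<open>auto simp: zz subset_iff\<close>)
    qed
    have R: "absolutely_continuous_Icc a' b (\<lambda>t. z' t J)" if "a \<le> a'" "t0 \<le> a'" for a'
    proof (cases "a' \<le> b")
      case True
      then have "b \<in> {a..b}" using that by auto
      then have "b \<in> S \<union> {t0..t1}" using sub by blast
      then have "b \<le> t1" using Sle by auto
      then have "absolutely_continuous_Icc a' b y" using y(1) that by (intro ac_subinterval[OF y(1)]) auto
      then show ?thesis
        by (rule ac_dominated[where A = 1 and B = 0]) (use that in \<open>auto simp: zy\<close>)
    qed (auto intro!: lipschitz_imp_ac[of 0])
    show ?thesis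
    proof (cases "a \<le> t0 \<and> t0 \<le> b")
      case True
      then show ?thesis using ac_concat[of a t0 _ b] L[of t0] R[of t0] by blast
    next
      case False
      then show ?thesis using L[of b] R[of a] by fastforce
    qed
  qed
  have AE': "AE t in lebesgue. t \<in> S \<union> {t0..t1} \<longrightarrow>
      ((\<lambda>t. z' t J) has_vector_derivative hand2_F c f (z' t J)) (at t within S \<union> {t0..t1})"
  proof -
    have 1: "AE t in lebesgue. t \<in> S \<longrightarrow> ((\<lambda>t. z t J) has_vector_derivative hand2_F c f (z t J)) (at t within S)"
      using tv by (simp add: tv_hybrid_solution_def S_def)
    have "negligible (insert t0 N)" using N by (simp add: negligible_insert)
    then have 2: "AE t in lebesgue. t \<notin> insert t0 N"
      by (intro AE_not_in) (simp add: negligible_iff_null_sets)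
    show ?thesis
      using 1 2
    proof eventually_elim
      case (elim t)
      show ?case
      proof
        assume t: "t \<in> S \<union> {t0..t1}"
        show "((\<lambda>t. z' t J) has_vector_derivative hand2_F c f (z' t J)) (at t within S \<union> {t0..t1})"
        proof (cases "t < t0")
          case True
          then have tS: "t \<in> S" using t by auto
          have "((\<lambda>t. z t J) has_vector_derivative hand2_F c f (z' t J)) (at t within S)"
            using elim tS by (simp add: zz)
          then show ?thesis
            by (rule vector_derivative_local[where U = "{..<t0}"]) (use True tS in \<open>auto simp: zz\<close>)
        next
          case False
          then have tt: "t0 < t" "t \<in> {t0..t1}" using t elim Sle by auto
          have "(y has_vector_derivative hand2_F c f (z' t J)) (at t within {t0..t1})"
            using yd[of t] elim tt by (simp add: zy)
          then show ?thesis
            by (rule vector_derivative_local[where U = "{t0<..}"]) (use tt Sle in \<open>auto simp: zy\<close>)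
        qed
      qed
    qed
  qed
  have inC: "z' t j \<in> hand2_C Tmin Tmax" if "t \<in> time_slice E' j" for t j
  proof (cases "(t, j) \<in> E")
    case True
    then show ?thesis using nominal_in_C[OF sol True] z'z by simp
  next
    case False
    then have "j = J" "t \<in> {t0..t1}" using that by (auto simp: E'_def time_slice_def)
    then show ?thesis using y(2)[of t] by (simp add: zy)
  qed
  have "tv_hybrid_solution (\<lambda>_. hand2_F c f) (\<lambda>_. hand2_C Tmin Tmax) (\<lambda>_. hand2_G Tmin) (\<lambda>_. hand2_D Tmax) E' z'"
    unfolding tv_hybrid_solution_def
  proof (intro conjI allI impI ballI)
    show "hybrid_time_domain E'"
      unfolding E'_def using nominal_ordered[OF sol _ t0(1)]
      by (intro hybrid_time_domain_extend_flow E top t0 t1)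
    have 00: "(0, 0) \<in> E" using tv by (simp add: tv_hybrid_solution_def)
    then show "(0, 0) \<in> E'" by (simp add: E'_def)
    show "z' 0 0 \<in> closure (hand2_C Tmin Tmax) \<union> hand2_D Tmax"
      using tv z'z[OF 00] by (simp add: tv_hybrid_solution_def)
  next
    fix j
    show "locally_absolutely_continuous_on (time_slice E' j) (\<lambda>t. z' t j)"
    proof (cases "j = J")
      case True
      then show ?thesis using ac by (simp add: locally_absolutely_continuous_on_def S')
    next
      case False
      then show ?thesis using tv by (simp add: other z'o tv_hybrid_solution_def)
    qed
    show "z' t j \<in> hand2_C Tmin Tmax" if "t \<in> interior (time_slice E' j)" for t
      using that interior_subset[of "time_slice E' j"] by (intro inC) auto
    show "AE t in lebesgue. t \<in> time_slice E' j \<longrightarrow>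
        ((\<lambda>s. z' s j) has_vector_derivative hand2_F c f (z' t j)) (at t within time_slice E' j)"
    proof (cases "j = J")
      case True
      then show ?thesis using AE' by (simp add: S')
    next
      case False
      then show ?thesis using tv by (simp add: other z'o tv_hybrid_solution_def)
    qed
  next
    fix t j assume tj: "(t, j) \<in> E' \<and> (t, Suc j) \<in> E'"
    note b = both[OF conjunct1[OF tj] conjunct2[OF tj]]
    show "z' t j \<in> hand2_D Tmax" "z' t (Suc j) = hand2_G Tmin (z' t j)"
      using nominal_jump[OF sol conjunct1[OF b] conjunct2[OF b]] b by (simp_all add: z'z)
  qed
  then show ?thesis
    using z'z by (intro exI[of _ z']) (auto simp: hand2_solution_def hybrid_solution_def E'_def)
qed

lemma extend_by_jump:
  assumes sol: "hand2_solution c f Tmin Tmax E z" and top: "\<And>t j. (t, j) \<in> E \<Longrightarrow> j \<le> J"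
    and T: "(T, J) \<in> E" and D: "z T J \<in> hand2_D Tmax"
  shows "\<exists>z'. hand2_solution c f Tmin Tmax (insert (T, Suc J) E) z' \<and> (\<forall>(t, j)\<in>E. z' t j = z t j)"
proof -
  note tv = nominal_tv[OF sol]
  note E = nominal_htd[OF sol]
  define E' where "E' = insert (T, Suc J) E"
  define z' where "z' t j = (if j = Suc J then hand2_G Tmin (z T J) else z t j)" for t j
  have new: "j \<noteq> Suc J" if "(t, j) \<in> E" for t j using top[OF that] by auto
  have z'z: "z' t j = z t j" if "(t, j) \<in> E" for t j using new[OF that] by (simp add: z'_def)
  have slice: "time_slice E' (Suc J) = {T}" using new by (auto simp: E'_def time_slice_def)
  have other: "time_slice E' j = time_slice E j" if "j \<noteq> Suc J" for j
    using that by (auto simp: E'_def time_slice_def)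
  have z'o: "z' t j = z t j" if "j \<noteq> Suc J" for t j using that by (simp add: z'_def)
  have "tv_hybrid_solution (\<lambda>_. hand2_F c f) (\<lambda>_. hand2_C Tmin Tmax) (\<lambda>_. hand2_G Tmin) (\<lambda>_. hand2_D Tmax) E' z'"
    unfolding tv_hybrid_solution_def
  proof (intro conjI allI impI ballI)
    show "hybrid_time_domain E'"
      unfolding E'_def by (intro hybrid_time_domain_extend_jump E top T)
    have 00: "(0, 0) \<in> E" using tv by (simp add: tv_hybrid_solution_def)
    then show "(0, 0) \<in> E'" by (simp add: E'_def)
    show "z' 0 0 \<in> closure (hand2_C Tmin Tmax) \<union> hand2_D Tmax"
      using tv z'z[OF 00] by (simp add: tv_hybrid_solution_def)
  next
    fix j
    show "locally_absolutely_continuous_on (time_slice E' j) (\<lambda>t. z' t j)"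
    proof (cases "j = Suc J")
      case True
      then show ?thesis
        by (auto simp: locally_absolutely_continuous_on_def z'_def intro!: lipschitz_imp_ac[of 0])
    next
      case False
      then show ?thesis using tv by (simp add: other z'o tv_hybrid_solution_def)
    qed
    show "z' t j \<in> hand2_C Tmin Tmax" if "t \<in> interior (time_slice E' j)" for t
    proof (cases "j = Suc J")
      case True
      then show ?thesis using that by (simp add: slice)
    next
      case False
      then show ?thesis using tv that by (simp add: other z'o tv_hybrid_solution_def)
    qed
    show "AE t in lebesgue. t \<in> time_slice E' j \<longrightarrow>
        ((\<lambda>s. z' s j) has_vector_derivative hand2_F c f (z' t j)) (at t within time_slice E' j)"
    proof (cases "j = Suc J")
      case True
      have "AE t in lebesgue. t \<notin> {T}" by (intro AE_not_in) (simp add: negligible_iff_null_sets[symmetric])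
      then show ?thesis unfolding True slice by eventually_elim simp
    next
      case False
      then show ?thesis using tv by (simp add: other z'o tv_hybrid_solution_def)
    qed
  next
    fix t j assume tj: "(t, j) \<in> E' \<and> (t, Suc j) \<in> E'"
    have tE: "(t, j) \<in> E" using tj top[of T "Suc (Suc J)"] by (auto simp: E'_def)
    have "z' t j \<in> hand2_D Tmax \<and> z' t (Suc j) = hand2_G Tmin (z' t j)"
    proof (cases "j = J")
      case True
      then have "t = T" using tj new[of t "Suc j"] by (auto simp: E'_def)
      then show ?thesis using True D by (simp add: z'_def)
    next
      case False
      then have b: "(t, Suc j) \<in> E" using tj by (auto simp: E'_def)
      show ?thesis using nominal_jump[OF sol tE b] by (simp add: z'z[OF tE] z'z[OF b])
    qed
    then show "z' t j \<in> hand2_D Tmax" "z' t (Suc j) = hand2_G Tmin (z' t j)" by blast+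
  qed
  then show ?thesis
    using z'z by (intro exI[of _ z']) (auto simp: hand2_solution_def hybrid_solution_def E'_def)
qed

text \<open>The timer is an explicit function of time, which leaves an equation for \<open>(x1, x2)\<close> whose right-hand
  side is globally Lipschitz, with a constant that is uniform for timers in \<open>{Tmin..Tmax}\<close>.\<close>

lemma flow_exists:
  assumes \<tau>0: "Tmin \<le> \<tau>0" "\<tau>0 < Tmax"
  obtains t1 y where "T < t1" "y T = (p, q, \<tau>0)" "absolutely_continuous_Icc T t1 y"
    "\<And>t. t \<in> {T..t1} \<Longrightarrow> y t \<in> hand2_C Tmin Tmax"
    "\<And>t. t \<in> {T..t1} \<Longrightarrow> (y has_vector_derivative hand2_F c f (y t)) (at t within {T..t1})"
proof -
  define \<Lambda> where "\<Lambda> = 4 / Tmin + 2 * c * Tmax * L"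
  have \<Lambda>: "0 < \<Lambda>" unfolding \<Lambda>_def using Tmin Tmax c L by (intro add_pos_nonneg) auto
  define h where "h = min (Tmax - \<tau>0) (1 / (2 * \<Lambda>))"
  have h: "0 < h" "\<Lambda> * h < 1" "\<tau>0 + h \<le> Tmax"
  proof -
    show "0 < h" using \<tau>0 \<Lambda> by (simp add: h_def)
    have "\<Lambda> * h \<le> \<Lambda> * (1 / (2 * \<Lambda>))" using \<Lambda> unfolding h_def by (intro mult_left_mono) auto
    then show "\<Lambda> * h < 1" using \<Lambda> by simp
    show "\<tau>0 + h \<le> Tmax" by (simp add: h_def)
  qed
  define t1 where "t1 = T + h"
  define tau where "tau t = \<tau>0 + (t - T)" for t
  have tau: "Tmin \<le> tau t \<and> tau t \<le> Tmax \<and> 0 < tau t" if "t \<in> {T..t1}" for t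
    using that \<tau>0 h Tmin by (auto simp: tau_def t1_def)
  define \<Phi> :: "real \<Rightarrow> (real ^ 'n) \<times> (real ^ 'n) \<Rightarrow> (real ^ 'n) \<times> (real ^ 'n)"
    where "\<Phi> t x = ((2 / tau t) *\<^sub>R (snd x - fst x), (- 2 * c * tau t) *\<^sub>R grad f (fst x))" for t x
  have gc: "continuous_on UNIV (grad f)" using lipschitz_on_continuous_on[OF lip] .
  have cont: "continuous_on {T..t1} (\<lambda>t. \<Phi> t (w t))" if w: "continuous_on {T..t1} w" for w
  proof -
    have "continuous_on {T..t1} (\<lambda>t. grad f (fst (w t)))"
      by (rule continuous_on_compose2[OF gc]) (auto intro!: continuous_intros w)
    moreover have "continuous_on {T..t1} tau" unfolding tau_def by (intro continuous_intros)
    ultimately show ?thesis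
      unfolding \<Phi>_def by (intro continuous_intros w) (use tau in force)+
  qed
  have lipP: "norm (\<Phi> t x - \<Phi> t x') \<le> \<Lambda> * norm (x - x')" if t: "t \<in> {T..t1}" for t x x'
  proof -
    have n: "norm (fst x - fst x') \<le> norm (x - x')" "norm (snd x - snd x') \<le> norm (x - x')"
      unfolding minus_prod_def by (rule norm_fst_le norm_snd_le)+
    have "\<Phi> t x - \<Phi> t x' = ((2 / tau t) *\<^sub>R ((snd x - snd x') - (fst x - fst x')),
        (- 2 * c * tau t) *\<^sub>R (grad f (fst x) - grad f (fst x')))"
      by (simp add: \<Phi>_def algebra_simps)
    then have "norm (\<Phi> t x - \<Phi> t x') \<le> norm ((2 / tau t) *\<^sub>R ((snd x - snd x') - (fst x - fst x')))
        + norm ((- 2 * c * tau t) *\<^sub>R (grad f (fst x) - grad f (fst x')))"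
      by (simp only: norm_Pair_le)
    also have "\<dots> = (2 / tau t) * norm ((snd x - snd x') - (fst x - fst x'))
        + 2 * c * tau t * norm (grad f (fst x) - grad f (fst x'))"
      using tau[OF t] c by simp
    also have "\<dots> \<le> (2 / Tmin) * (norm (x - x') + norm (x - x')) + 2 * c * Tmax * (L * norm (x - x'))"
    proof (intro add_mono mult_mono)
      show "2 / tau t \<le> 2 / Tmin" using tau[OF t] Tmin by (intro divide_left_mono) auto
      show "norm ((snd x - snd x') - (fst x - fst x')) \<le> norm (x - x') + norm (x - x')"
        using norm_triangle_ineq4[of "snd x - snd x'" "fst x - fst x'"] n by linarith
      show "norm (grad f (fst x) - grad f (fst x')) \<le> L * norm (x - x')"
        using grad_diff[of "fst x" "fst x'"] mult_left_mono[OF n(1) L] by linarith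
    qed (use tau[OF t] Tmin Tmax c in auto)
    also have "\<dots> = \<Lambda> * norm (x - x')" by (simp add: \<Lambda>_def algebra_simps)
    finally show ?thesis .
  qed
  obtain x where x: "x T = (p, q)"
    "\<And>t. t \<in> {T..t1} \<Longrightarrow> (x has_vector_derivative \<Phi> t (x t)) (at t within {T..t1})"
    using picard_local[of T t1 \<Lambda> \<Phi> "(p, q)"] cont lipP \<Lambda> h by (auto simp: t1_def)
  define y where "y t = (fst (x t), snd (x t), tau t)" for t
  have F: "hand2_F c f (y t) = (fst (\<Phi> t (x t)), snd (\<Phi> t (x t)), 1)" for t
    by (simp add: y_def hand2_F_def \<Phi>_def)
  have yd: "(y has_vector_derivative hand2_F c f (y t)) (at t within {T..t1})" if "t \<in> {T..t1}" for t
  proof -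
    have "(tau has_vector_derivative 1) (at t within {T..t1})"
      unfolding tau_def has_real_derivative_iff_has_vector_derivative[symmetric]
      by (auto intro!: derivative_eq_intros)
    moreover have "((\<lambda>t. fst (x t)) has_vector_derivative fst (\<Phi> t (x t))) (at t within {T..t1})"
        "((\<lambda>t. snd (x t)) has_vector_derivative snd (\<Phi> t (x t))) (at t within {T..t1})"
      using has_derivative_fst[OF x(2)[OF that, unfolded has_vector_derivative_def]]
        has_derivative_snd[OF x(2)[OF that, unfolded has_vector_derivative_def]]
      by (simp_all add: has_vector_derivative_def)
    ultimately show ?thesis
      unfolding F unfolding y_def by (intro has_vector_derivative_Pair)
  qed
  have xc: "continuous_on {T..t1} x"
    using x(2) has_vector_derivative_continuous unfolding continuous_on_eq_continuous_within by blast
  show thesis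
  proof (rule that[of t1 y])
    show "T < t1" using h by (simp add: t1_def)
    show "y T = (p, q, \<tau>0)" by (simp add: y_def x tau_def)
    show "absolutely_continuous_Icc T t1 y"
    proof (rule C1_imp_ac[OF yd])
      show "continuous_on {T..t1} (\<lambda>t. hand2_F c f (y t))"
        unfolding F by (intro continuous_intros cont xc)
    qed
    show "y t \<in> hand2_C Tmin Tmax" if "t \<in> {T..t1}" for t
      using tau[OF that] by (simp add: y_def hand2_C_eq)
  qed (rule yd)
qed

lemma nominal_F_bounded:
  assumes sol: "hand2_solution c f Tmin Tmax E z"
  obtains M where "0 \<le> M" "\<And>t j. (t, j) \<in> E \<Longrightarrow> norm (hand2_F c f (z t j)) \<le> M"
proof -
  define R where "R = sqrt (Klow * W (z 0 0))"
  have R: "0 \<le> R" and R2: "R\<^sup>2 = Klow * W (z 0 0)" using Klow W_nonneg by (simp_all add: R_def)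
  show thesis
  proof (rule that[of "2 / Tmin * (2 * R) + 2 * c * Tmax * (L * R) + 1"])
    show "0 \<le> 2 / Tmin * (2 * R) + 2 * c * Tmax * (L * R) + 1"
      using R Tmin Tmax c L by (intro add_nonneg_nonneg mult_nonneg_nonneg) auto
    fix t j assume tj: "(t, j) \<in> E"
    obtain x1 x2 \<tau> where z: "z t j = (x1, x2, \<tau>)" by (metis prod_cases3)
    note b = nominal_bound[OF sol tj]
    have \<tau>: "Tmin \<le> \<tau>" "\<tau> \<le> Tmax" using b(1) z by auto
    have "k0 ^ j * W (z 0 0) \<le> 1 * W (z 0 0)"
      using k0 W_nonneg by (intro mult_right_mono power_le_one) auto
    then have "W (z t j) \<le> W (z 0 0)" using b(3) by simp
    then have "Klow * W (x1, x2, \<tau>) \<le> Klow * W (z 0 0)" using Klow z by simp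
    then have "(norm (x1 - xs))\<^sup>2 + (norm (x2 - xs))\<^sup>2 \<le> Klow * W (z 0 0)"
      using W_lower[of \<tau> x1 x2] \<tau> T01 by linarith
    then have "(norm (x1 - xs))\<^sup>2 \<le> R\<^sup>2" "(norm (x2 - xs))\<^sup>2 \<le> R\<^sup>2"
      using zero_le_power2[of "norm (x1 - xs)"] zero_le_power2[of "norm (x2 - xs)"]
      unfolding R2 by linarith+
    then have n: "norm (x1 - xs) \<le> R" "norm (x2 - xs) \<le> R" using R power2_le_imp_le by blast+
    have "norm (hand2_F c f (z t j)) \<le> norm ((2 / \<tau>) *\<^sub>R (x2 - x1)) + norm ((- 2 * c * \<tau>) *\<^sub>R grad f x1, 1::real)"
      unfolding z hand2_F_def prod.case by (rule norm_Pair_le)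
    also have "norm ((- 2 * c * \<tau>) *\<^sub>R grad f x1, 1::real) \<le> norm ((- 2 * c * \<tau>) *\<^sub>R grad f x1) + norm (1::real)"
      by (rule norm_Pair_le)
    also have "norm ((2 / \<tau>) *\<^sub>R (x2 - x1)) \<le> 2 / Tmin * (2 * R)"
    proof -
      have "norm (x2 - x1) \<le> 2 * R"
        using norm_triangle_ineq4[of "x2 - xs" "x1 - xs"] n by simp
      moreover have "2 / \<tau> \<le> 2 / Tmin" using \<tau> Tmin by (intro divide_left_mono) auto
      ultimately have "(2 / \<tau>) * norm (x2 - x1) \<le> 2 / Tmin * (2 * R)"
        using Tmin \<tau> by (intro mult_mono) auto
      then show ?thesis using Tmin \<tau> by simp
    qed
    also have "norm ((- 2 * c * \<tau>) *\<^sub>R grad f x1) \<le> 2 * c * Tmax * (L * R)"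
    proof -
      have "norm (grad f x1) \<le> L * R" using grad_bound[of x1] mult_left_mono[OF n(1) L] by linarith
      then have "2 * c * \<tau> * norm (grad f x1) \<le> 2 * c * Tmax * (L * R)"
        using \<tau> c Tmin by (intro mult_mono) auto
      then show ?thesis using \<tau> c Tmin by simp
    qed
    finally show "norm (hand2_F c f (z t j)) \<le> 2 / Tmin * (2 * R) + 2 * c * Tmax * (L * R) + 1"
      by simp
  qed
qed

text \<open>Bounded speed makes the solution Lipschitz on its last level, so it extends to the closure.\<close>

lemma flow_closes:
  assumes sol: "hand2_solution c f Tmin Tmax E z" and t0: "(t0, J) \<in> E"
    and T: "\<forall>t. (t, J) \<in> E \<longrightarrow> t < T" "\<forall>t<T. \<exists>s>t. (s, J) \<in> E"
  shows "\<exists>y N. absolutely_continuous_Icc t0 T y \<and> (\<forall>t\<in>{t0..T}. y t \<in> hand2_C Tmin Tmax) \<and>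
    (\<forall>t. (t, J) \<in> E \<longrightarrow> y t = z t J) \<and> negligible N \<and>
    (\<forall>t\<in>{t0..T} - N. (y has_vector_derivative hand2_F c f (y t)) (at t within {t0..T}))"
proof -
  note tv = nominal_tv[OF sol]
  note E = nominal_htd[OF sol]
  define S where "S = time_slice E J"
  have S: "r \<in> S \<longleftrightarrow> (r, J) \<in> E" for r by (simp add: S_def time_slice_def)
  obtain M where M: "0 \<le> M" "\<And>t j. (t, j) \<in> E \<Longrightarrow> norm (hand2_F c f (z t j)) \<le> M"
    by (rule nominal_F_bounded[OF sol]) blast
  have "AE r in lebesgue. r \<in> S \<longrightarrow> ((\<lambda>r. z r J) has_vector_derivative hand2_F c f (z r J)) (at r within S)"
    using tv by (simp add: tv_hybrid_solution_def S_def)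
  then obtain N where N: "N \<in> null_sets lebesgue" "{r \<in> space lebesgue. \<not> (r \<in> S \<longrightarrow>
      ((\<lambda>r. z r J) has_vector_derivative hand2_F c f (z r J)) (at r within S))} \<subseteq> N"
    by (rule AE_E3) auto
  have lip: "norm (z b J - z a J) \<le> M * (b - a)" if ab: "a \<in> S" "b \<in> S" "a \<le> b" for a b
  proof -
    have sub: "{a..b} \<subseteq> time_slice E J" using ab by (intro time_slice_convex[OF E]) (auto simp: S)
    obtain N where N: "negligible N" "\<And>r. r \<in> {a..b} - N \<Longrightarrow>
      ((\<lambda>r. z r J) has_vector_derivative hand2_F c f (z r J)) (at r within {a..b})"
      using tv_flow_deriv[OF tv sub] by blast
    show ?thesis
    proof (rule ac_lipschitz[OF tv_flow_ac[OF tv sub] ab(3) N(1) M(1)])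
      fix t assume t: "t \<in> {a..b} - N"
      then have "(t, J) \<in> E" using sub by (auto simp: time_slice_def)
      then show "\<exists>D. norm D \<le> M \<and> ((\<lambda>r. z r J) has_vector_derivative D) (at t within {a..b})"
        using N(2)[OF t] M(2) by blast
    qed
  qed
  have "M-lipschitz_on S (\<lambda>r. z r J)"
  proof (rule lipschitz_onI[OF _ M(1)])
    fix a b assume "a \<in> S" "b \<in> S"
    then show "dist (z a J) (z b J) \<le> M * dist a b"
      using lip[of a b] lip[of b a] by (cases "a \<le> b") (auto simp: dist_norm norm_minus_commute)
  qed
  then obtain y where y: "M-lipschitz_on (closure S) y" "\<And>r. r \<in> S \<Longrightarrow> y r = z r J"
    using lipschitz_extend_closure by blast
  have inS: "t \<in> S" if t: "t0 \<le> t" "t < T" for t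
  proof -
    obtain s where "t < s" "(s, J) \<in> E" using T(2) t(2) by blast
    then show ?thesis using time_slice_convex[OF E t0, of s] t by (auto simp: S_def)
  qed
  have t0T: "t0 < T" using T(1) t0 by blast
  have sub: "{t0..T} \<subseteq> closure S"
  proof -
    have "closure {t0..<T} \<subseteq> closure S" using inS by (intro closure_mono) auto
    then show ?thesis using t0T by simp
  qed
  show ?thesis
  proof (intro exI[of _ y] exI[of _ "insert T N"] conjI ballI allI impI)
    show "absolutely_continuous_Icc t0 T y"
    proof (rule lipschitz_imp_ac[OF M(1)])
      fix a b assume "t0 \<le> a" "a \<le> b" "b \<le> T"
      then show "norm (y b - y a) \<le> M * (b - a)"
        using lipschitz_onD[OF y(1), of b a] sub by (auto simp: dist_norm subset_iff)
    qed
    show "y t = z t J" if "(t, J) \<in> E" for t using y(2) that by (simp add: S)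
    show "y t \<in> hand2_C Tmin Tmax" if "t \<in> {t0..T}" for t
    proof -
      have "closed {w :: 'n hand_state. Tmin \<le> timer w \<and> timer w \<le> Tmax}"
        by (intro closed_Collect_conj closed_Collect_le continuous_intros)
      then have "closed (hand2_C Tmin Tmax :: 'n hand_state set)" by (simp add: hand2_C_eq)
      moreover have "y ` S \<subseteq> hand2_C Tmin Tmax"
        using nominal_in_C[OF sol] y(2) by (auto simp: S)
      ultimately have "y ` closure S \<subseteq> hand2_C Tmin Tmax"
        by (intro image_closure_subset lipschitz_on_continuous_on[OF y(1)])
      then show ?thesis using that sub by blast
    qed
    show "negligible (insert T N)"
      using N(1) by (simp add: negligible_insert negligible_iff_null_sets)
    fix t assume t: "t \<in> {t0..T} - insert T N"
    then have tS: "t \<in> S" using inS by auto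
    then have "((\<lambda>r. z r J) has_vector_derivative hand2_F c f (y t)) (at t within S)"
      using N(2) t y(2) by auto
    then have "(y has_vector_derivative hand2_F c f (y t)) (at t within S)"
      by (rule vector_derivative_local[where U = UNIV]) (use tS y(2) in auto)
    then have "(y has_vector_derivative hand2_F c f (y t)) (at t within {t0..<T})"
      by (rule has_vector_derivative_within_subset) (use inS in auto)
    then show "(y has_vector_derivative hand2_F c f (y t)) (at t within {t0..T})"
      by (rule vector_derivative_local[where U = "{..<T}"]) (use t in auto)
  qed
qed

lemma maximal_complete:
  assumes max: "hand2_maximal_solution c f Tmin Tmax E z"
  shows "complete_hybrid_domain E"
proof (rule ccontr)
  assume "\<not> complete_hybrid_domain E"
  then have "bounded ((\<lambda>(t, j). (t, real j)) ` E)" by (simp add: complete_hybrid_domain_def)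
  then obtain B where B: "\<And>p. p \<in> E \<Longrightarrow> norm (fst p, real (snd p)) \<le> B"
    unfolding bounded_iff by force
  have sol: "hand2_solution c f Tmin Tmax E z"
    and noext: "\<And>E'. \<exists>z'. hand2_solution c f Tmin Tmax E' z' \<and> (\<forall>(t, j)\<in>E. z' t j = z t j) \<Longrightarrow> \<not> E \<subset> E'"
    using max unfolding hand2_maximal_solution_def maximal_hybrid_solution_def hand2_solution_def by blast+
  have tB: "t \<le> B" and jB: "j \<le> nat \<lfloor>B\<rfloor>" if "(t, j) \<in> E" for t j
    using B[OF that] norm_fst_le[of t "real j"] norm_snd_le[of "real j" t] by (auto simp: le_nat_floor)
  have "(0, 0) \<in> E" using nominal_tv[OF sol] by (simp add: tv_hybrid_solution_def)
  then have ne: "snd ` E \<noteq> {}" by auto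
  have fin: "finite (snd ` E)"
    by (rule finite_subset[of _ "{..nat \<lfloor>B\<rfloor>}"]) (use jB in auto)
  define J where "J = Max (snd ` E)"
  have top: "j \<le> J" if "(t, j) \<in> E" for t j
    unfolding J_def using fin that by (intro Max_ge) force+
  obtain t0 where t0: "(t0, J) \<in> E" using Max_in[OF fin ne] unfolding J_def[symmetric] by force
  define S where "S = {t. (t, J) \<in> E}"
  have S: "S \<noteq> {}" "bdd_above S" using t0 tB by (auto simp: S_def intro!: bdd_aboveI[of _ B])
  define T where "T = Sup S"
  have leT: "t \<le> T" if "(t, J) \<in> E" for t
    unfolding T_def using S that by (intro cSup_upper) (auto simp: S_def)
  show False
  proof (cases "(T, J) \<in> E")
    case False
    have "\<forall>t. (t, J) \<in> E \<longrightarrow> t < T" using leT False by (metis order_less_le)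
    moreover have "\<forall>t<T. \<exists>s>t. (s, J) \<in> E"
    proof (intro allI impI)
      fix t assume "t < T"
      then obtain s where "s \<in> S" "t < s" unfolding T_def using less_cSup_iff[OF S] by blast
      then show "\<exists>s>t. (s, J) \<in> E" by (auto simp: S_def)
    qed
    ultimately obtain y N where y: "absolutely_continuous_Icc t0 T y" "\<forall>t\<in>{t0..T}. y t \<in> hand2_C Tmin Tmax"
      "\<forall>t. (t, J) \<in> E \<longrightarrow> y t = z t J" "negligible N"
      "\<forall>t\<in>{t0..T} - N. (y has_vector_derivative hand2_F c f (y t)) (at t within {t0..T})"
      using flow_closes[OF sol t0] by blast
    have ext: "\<exists>z'. hand2_solution c f Tmin Tmax (E \<union> {t0..T} \<times> {J}) z' \<and> (\<forall>(t, j)\<in>E. z' t j = z t j)"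
    proof (rule extend_by_flow[OF sol _ t0 leT[OF t0] _ y(1) _ _ y(4)])
      show "j \<le> J" if "(t, j) \<in> E" for t j using that by (rule top)
      show "t \<le> T" if "(t, J) \<in> E" for t using that by (rule leT)
      show "y t \<in> hand2_C Tmin Tmax" if "t \<in> {t0..T}" for t using y(2) that by blast
      show "y t = z t J" if "(t, J) \<in> E" for t using y(3) that by blast
      show "(y has_vector_derivative hand2_F c f (y t)) (at t within {t0..T})" if "t \<in> {t0..T} - N" for t
        using y(5) that by blast
    qed
    have "(T, J) \<in> {t0..T} \<times> {J}" using leT[OF t0] by simp
    with False have "E \<subset> E \<union> {t0..T} \<times> {J}" by blast
    then show False using noext[OF ext] by contradiction
  next
    case True
    obtain p q \<tau>0 where zT: "z T J = (p, q, \<tau>0)" by (metis prod_cases3)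
    have \<tau>0: "Tmin \<le> \<tau>0" "\<tau>0 \<le> Tmax" using nominal_bound(1)[OF sol True] zT by auto
    show False
    proof (cases "\<tau>0 = Tmax")
      case tm: True
      then have D: "z T J \<in> hand2_D Tmax" using zT by (simp add: hand2_D_def)
      have ext: "\<exists>z'. hand2_solution c f Tmin Tmax (insert (T, Suc J) E) z' \<and> (\<forall>(t, j)\<in>E. z' t j = z t j)"
        by (rule extend_by_jump[OF sol _ True D]) (rule top)
      have "(T, Suc J) \<notin> E" using top[of T "Suc J"] by auto
      then have "E \<subset> insert (T, Suc J) E" by blast
      then show False using noext[OF ext] by contradiction
    next
      case False
      then have "\<tau>0 < Tmax" using \<tau>0 by simp
      then obtain t1 y where y: "T < t1" "y T = (p, q, \<tau>0)" "absolutely_continuous_Icc T t1 y"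
        "\<And>t. t \<in> {T..t1} \<Longrightarrow> y t \<in> hand2_C Tmin Tmax"
        "\<And>t. t \<in> {T..t1} \<Longrightarrow> (y has_vector_derivative hand2_F c f (y t)) (at t within {T..t1})"
        using flow_exists[OF \<tau>0(1)] by blast
      have yz: "y t = z t J" if "(t, J) \<in> E" "T \<le> t" for t
      proof -
        have "t = T" using leT[OF that(1)] that(2) by simp
        then show ?thesis using y(2) zT by simp
      qed
      have le: "t \<le> t1" if "(t, J) \<in> E" for t using leT[OF that] y(1) by simp
      have ext: "\<exists>z'. hand2_solution c f Tmin Tmax (E \<union> {T..t1} \<times> {J}) z' \<and> (\<forall>(t, j)\<in>E. z' t j = z t j)"
      proof (rule extend_by_flow[OF sol _ True le[OF True] _ y(3) _ _ negligible_empty])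
        show "j \<le> J" if "(t, j) \<in> E" for t j using that by (rule top)
        show "t \<le> t1" if "(t, J) \<in> E" for t using that by (rule le)
        show "y t \<in> hand2_C Tmin Tmax" if "t \<in> {T..t1}" for t using that by (rule y(4))
        show "y t = z t J" if "(t, J) \<in> E" "T \<le> t" for t using that by (rule yz)
        show "(y has_vector_derivative hand2_F c f (y t)) (at t within {T..t1})" if "t \<in> {T..t1} - {}" for t
          using that y(5) by simp
      qed
      have "(t1, J) \<notin> E" using leT[of t1] y(1) by auto
      moreover have "(t1, J) \<in> {T..t1} \<times> {J}" using y(1) by simp
      ultimately have "E \<subset> E \<union> {T..t1} \<times> {J}" by blast
      then show False using noext[OF ext] by contradiction
    qed
  qed
qed

end

section \<open>HAND-2 for strongly convex functions\<close>

theorem mainTheorem2: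
  fixes f :: "real ^ 'n::finite \<Rightarrow> real"
    and xs :: "real ^ 'n"
    and \<mu> L Tmin Tmax c :: real
  assumes "twice_continuously_differentiable f"
    and "convex_on UNIV f"
    and "radially_unbounded f"
    and "unique_minimizer f xs"
    and "\<mu> > 0"
    and "strongly_convex \<mu> f"
    and "L-lipschitz_on UNIV (grad f)"
    and "0 < Tmin"
    and "Tmin < Tmax"
    and "c > 0"
    and "Tmax\<^sup>2 - Tmin\<^sup>2 > 1 / (\<mu> * c)"
  shows
    "((\<forall>E z. hand2_maximal_solution c f Tmin Tmax E z \<longrightarrow> complete_hybrid_domain E) \<and>
      UGAS (hand2_F c f) (hand2_C Tmin Tmax) (hand2_G Tmin) (hand2_D Tmax)
        (hand2_A xs Tmin Tmax)) \<and>
     (\<forall>\<delta>>0. \<forall>K0 :: ((real ^ 'n) \<times> (real ^ 'n)) set. compact K0 \<longrightarrow>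
        (\<exists>\<epsilon>>0. \<exists>T>0. \<forall>e :: nat \<Rightarrow> real \<Rightarrow> 'n hand_state.
           (\<forall>i\<in>{1..6}. e i \<in> borel_measurable (lebesgue_on {0..}) \<and>
              (\<forall>t\<ge>0. norm (e i t) \<le> \<epsilon>)) \<longrightarrow>
           (\<forall>E z. hand2_perturbed_solution c f Tmin Tmax e E z \<and>
              (fst (z 0 0), fst (snd (z 0 0))) \<in> K0 \<longrightarrow>
              (\<forall>(t, j)\<in>E. t + real j \<ge> T \<longrightarrow>
                 infdist (z t j) (hand2_A xs Tmin Tmax) \<le> \<delta>)))) \<and>
     (let \<Delta>T = Tmax - Tmin;
          k0 = (1 / (c * \<mu>) + Tmin\<^sup>2) / Tmax\<^sup>2;
          kb = 1 - k0;
          \<alpha> = (\<lambda>s :: real. max (s - \<Delta>T) 0 / (\<Delta>T + 1))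
      in \<exists>ka>0. \<forall>E z. hand2_solution c f Tmin Tmax E z \<and>
           fst (z 0 0) = fst (snd (z 0 0)) \<and> snd (snd (z 0 0)) = Tmin \<longrightarrow>
           (\<forall>(t, j)\<in>E. f (fst (z t j)) - f xs
              \<le> ka * exp (- kb * \<alpha> (t + real j)) * (norm (fst (z 0 0) - xs))\<^sup>2))"
proof -
  interpret hand2_data f xs \<mu> L Tmin Tmax c
  proof
    show "f differentiable (at x)" for x
      using assms(1) by (simp add: twice_continuously_differentiable_def)
    show "f xs \<le> f y" for y using assms(4) by (simp add: unique_minimizer_def)
  qed (use assms in auto)
  have complete: "complete_hybrid_domain E" if "hand2_maximal_solution c f Tmin Tmax E z" for E z
    using that by (rule maximal_complete)
  have robust: "\<exists>\<epsilon>>0. \<exists>T>0. \<forall>e :: nat \<Rightarrow> real \<Rightarrow> 'n hand_state.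
           (\<forall>i\<in>{1..6}. e i \<in> borel_measurable (lebesgue_on {0..}) \<and>
              (\<forall>t\<ge>0. norm (e i t) \<le> \<epsilon>)) \<longrightarrow>
           (\<forall>E z. hand2_perturbed_solution c f Tmin Tmax e E z \<and>
              (fst (z 0 0), fst (snd (z 0 0))) \<in> K0 \<longrightarrow>
              (\<forall>(t, j)\<in>E. t + real j \<ge> T \<longrightarrow>
                 infdist (z t j) (hand2_A xs Tmin Tmax) \<le> \<delta>))"
    if \<delta>: "\<delta> > 0" and K0: "compact K0" for \<delta> and K0 :: "((real ^ 'n) \<times> (real ^ 'n)) set"
  proof -
    obtain \<epsilon> T where \<epsilon>: "\<epsilon> > 0" "T > 0" and bound: "\<forall>e. small e \<epsilon> \<longrightarrow>
       (\<forall>E z. hand2_perturbed_solution c f Tmin Tmax e E z \<and> (fst (z 0 0), fst (snd (z 0 0))) \<in> K0 \<longrightarrow>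
          (\<forall>(t, j)\<in>E. t + real j \<ge> T \<longrightarrow> infdist (z t j) (hand2_A xs Tmin Tmax) \<le> \<delta>))"
      using robustness[OF \<delta> K0] by blast
    show ?thesis
      by (rule exI[of _ \<epsilon>], rule conjI[OF \<epsilon>(1)], rule exI[of _ T], rule conjI[OF \<epsilon>(2)],
          rule allI, rule impI, rule bound[THEN spec, THEN mp]) (simp add: small_def)
  qed
  show ?thesis
    unfolding Let_def
    by (intro conjI allI impI complete UGAS_A robust exponential_rate[OF refl, unfolded k0_def])
qed

end
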